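(* Let $\Omega=(0,1)$, $T>0$, $1<\alpha<2$, $\mu<\frac14$, $u_0\in\mathcal H^1(\Omega)$, $u_1\in L^2(\Omega)$ and $q\in L^\infty(0,T)$. For $p\in L^2(\Omega)$ let $u[p]$ be the unique weak solution of $$\begin{cases}{}_0^C D_t^\alpha u-u_{xx}-\dfrac{\mu}{x^2}u=p(x)q(t), & (x,t)\in\Omega\times(0,T),\\ u(x,0)=u_0(x),\quad \partial_t u(x,0)=u_1(x), & x\in\Omega,\\ u(0,t)=u(1,t)=0,& t\in(0,T).\end{cases}$$ Then the linear source-to-terminal operator $$\mathcal A:L^2(\Omega)\to L^2(\Omega),\qquad \mathcal A p:=u[p](\cdot,T)-u[0](\cdot,T),$$ is compact.
   Context: Here $\mu$ is a real number with $\mu<1/4$ and $\Omega=(0,1)$. For $v,w\in H_0^1(\Omega)$ put $a_\mu(v,w)=\int_0^1 v_xw_x\,dx-\mu\int_0^1\frac{vw}{x^2}\,dx$. By Hardy's inequality $\int_0^1|v|^2/x^2\,dx\le 4\int_0^1|v_x|^2\,dx$ this is a continuous, symmetric, coercive form on $H_0^1(\Omega)$. Let $L_\mu$ be the associated positive self-adjoint operator in $L^2(\Omega)$ (the Friedrichs realization of $-\frac{d^2}{dx^2}-\frac{\mu}{x^2}$ with Dirichlet conditions): $v\in D(L_\mu)$ and $L_\mu v=g$ iff $v\in H_0^1(\Omega)$, $g\in L^2(\Omega)$ and $a_\mu(v,\varphi)=(g,\varphi)_{L^2(\Omega)}$ for all $\varphi\in H_0^1(\Omega)$. $L_\mu$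 has compact resolvent; let $\{\phi_n\}_{n\ge1}$ be an orthonormal basis of $L^2(\Omega)$ of eigenfunctions, $L_\mu\phi_n=\lambda_n\phi_n$, $0<\lambda_1\le\lambda_2\le\cdots\to\infty$. For $\sigma\ge0$, $\mathcal H^\sigma(\Omega)=D(L_\mu^{\sigma/2})$ with $\|v\|_{\mathcal H^\sigma}^2=\sum_n\lambda_n^\sigma|(v,\phi_n)_{L^2(\Omega)}|^2$; for $\sigma<0$, $\mathcal H^\sigma(\Omega)$ is the completion of $L^2(\Omega)$ in the norm given by the same formula, equivalently $\mathcal H^{\sigma}=(\mathcal H^{-\sigma})'$ with pivot space $L^2(\Omega)$. In particular $\mathcal H^1(\Omega)=H_0^1(\Omega)$ with the equivalent norm $a_\mu(v,v)^{1/2}$. Caputo derivative of order $1<\alpha<2$: ${}_0^C D_t^\alpha u(t)=I_{0+}^{2-\alpha}u''(t)$, where $I_{0+}^{\beta}g(t)=\frac1{\Gamma(\beta)}\int_0^t(t-s)^{\beta-1}g(s)\,ds$. For $u$ that is only $C^1$ in time (with values in $\mathcal H^{-1}(\Omega)$) it is understood as $\frac{d}{dt}I_{0+}^{2-\alpha}(\partial_tu-\partial_tu(0))$, with $\frac{d}{dt}$ in the sense of $\mathcal H^{-1}(\Omega)$-valued distributions on $(0,T)$. Weak solution: with $f(t):=p\,q(t)$, a function $u$ is a weak solution if $u\in C([0,T];\mathcal H^1(\Omega))\cap C^1([0,T];\mathcal H^{-1}(\Omega))$, ${}_0^C D_t^\alpha u\in L^2(0,T;\mathcal H^{-1}(\Omega))$,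 $u(\cdot,0)=u_0$ in $\mathcal H^1(\Omega)$, $\partial_tu(\cdot,0)=u_1$ in $\mathcal H^{-1}(\Omega)$, and for a.e. $t\in(0,T)$ $$\langle {}_0^C D_t^\alpha u(t),v\rangle_{\mathcal H^{-1},\mathcal H^1}+a_\mu(u(t),v)=(f(t),v)_{L^2(\Omega)}\qquad\forall v\in\mathcal H^1(\Omega).$$ For every $p\in L^2(\Omega)$ (and $q,u_0,u_1$ as in the claim) there is a unique weak solution, so $u[p](\cdot,T)\in\mathcal H^1(\Omega)$ is well defined; $u[0]$ is the solution with $p=0$ and the same initial data. *)

theory Defs
  imports "HOL-Analysis.Analysis"
begin

section \<open>The Hilbert space of square-integrable functions on the unit interval\<close>

abbreviation Omega :: "real measure" where
  "Omega \<equiv> lebesgue_on {0<..<1}"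

definition square_int :: "(real \<Rightarrow> real) \<Rightarrow> bool" where
  "square_int f \<longleftrightarrow> f \<in> borel_measurable Omega \<and> integrable Omega (\<lambda>x. (f x)\<^sup>2)"

lemma square_int_mult:
  assumes "square_int f" "square_int g"
  shows "integrable Omega (\<lambda>x. f x * g x)"
proof (rule Bochner_Integration.integrable_bound)
  show "integrable Omega (\<lambda>x. (f x)\<^sup>2 + (g x)\<^sup>2)"
    using assms by (simp add: square_int_def)
  show "(\<lambda>x. f x * g x) \<in> borel_measurable Omega"
    using assms unfolding square_int_def by (intro borel_measurable_times) auto
  have "\<bar>a * b\<bar> \<le> a\<^sup>2 + b\<^sup>2" for a b :: real
  proof -
    have "2 * \<bar>a\<bar> * \<bar>b\<bar> \<le> a\<^sup>2 + b\<^sup>2"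
      using sum_squares_bound[of "\<bar>a\<bar>" "\<bar>b\<bar>"] by simp
    moreover have "0 \<le> \<bar>a\<bar> * \<bar>b\<bar>" by simp
    ultimately show ?thesis unfolding abs_mult by linarith
  qed
  then show "AE x in Omega. norm (f x * g x) \<le> norm ((f x)\<^sup>2 + (g x)\<^sup>2)"
    by (intro AE_I2) (metis abs_ge_self order_trans real_norm_def)
qed

lemma square_int_add:
  assumes "square_int f" "square_int g"
  shows "square_int (\<lambda>x. f x + g x)"
proof -
  have "integrable Omega (\<lambda>x. (f x)\<^sup>2 + (g x)\<^sup>2 + 2 * (f x * g x))"
    using assms square_int_mult[OF assms] by (simp add: square_int_def)
  moreover have "(\<lambda>x. (f x)\<^sup>2 + (g x)\<^sup>2 + 2 * (f x * g x)) = (\<lambda>x. (f x + g x)\<^sup>2)"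
    by (auto simp: power2_sum)
  ultimately show ?thesis
    using assms unfolding square_int_def by auto
qed

lemma square_int_scale:
  assumes "square_int f"
  shows "square_int (\<lambda>x. c * f x)"
  using assms unfolding square_int_def by (auto simp: power_mult_distrib)

lemma square_int_zero: "square_int (\<lambda>x. 0)"
  by (simp add: square_int_def)

definition l2_eq :: "(real \<Rightarrow> real) \<Rightarrow> (real \<Rightarrow> real) \<Rightarrow> bool" where
  "l2_eq f g \<longleftrightarrow> square_int f \<and> square_int g \<and> (AE x in Omega. f x = g x)"

lemma l2_eq_part_equivp: "part_equivp l2_eq"
proof (rule part_equivpI)
  show "\<exists>f. l2_eq f f"
    by (rule exI[of _ "\<lambda>x. 0"]) (simp add: l2_eq_def square_int_zero)
  show "symp l2_eq"
    by (rule sympI) (auto simp: l2_eq_def eq_commute)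
  show "transp l2_eq"
  proof (rule transpI)
    fix f g h assume "l2_eq f g" "l2_eq g h"
    then have "AE x in Omega. f x = g x" "AE x in Omega. g x = h x"
      and sq: "square_int f" "square_int h"
      by (auto simp: l2_eq_def)
    from this(1,2) have "AE x in Omega. f x = h x"
      by eventually_elim simp
    with sq show "l2_eq f h"
      by (simp add: l2_eq_def)
  qed
qed

quotient_type L2 = "real \<Rightarrow> real" / partial: l2_eq
  by (rule l2_eq_part_equivp)

instantiation L2 :: real_vector
begin

lift_definition zero_L2 :: L2 is "\<lambda>x. 0"
  by (simp add: l2_eq_def square_int_zero)

lift_definition plus_L2 :: "L2 \<Rightarrow> L2 \<Rightarrow> L2" is "\<lambda>f g x. f x + g x"
proof -
  fix f f' g g' assume "l2_eq f f'" "l2_eq g g'"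
  then have sq: "square_int f" "square_int f'" "square_int g" "square_int g'"
    and "AE x in Omega. f x = f' x" "AE x in Omega. g x = g' x"
    by (auto simp: l2_eq_def)
  from this(5,6) have "AE x in Omega. f x + g x = f' x + g' x"
    by eventually_elim simp
  with sq show "l2_eq (\<lambda>x. f x + g x) (\<lambda>x. f' x + g' x)"
    by (simp add: l2_eq_def square_int_add)
qed

lift_definition scaleR_L2 :: "real \<Rightarrow> L2 \<Rightarrow> L2" is "\<lambda>c f x. c * f x"
proof -
  fix c :: real and f g assume "l2_eq f g"
  then have sq: "square_int f" "square_int g" and ae: "AE x in Omega. f x = g x"
    by (auto simp: l2_eq_def)
  from ae have "AE x in Omega. c * f x = c * g x"
    by eventually_elim simp
  with sq show "l2_eq (\<lambda>x. c * f x) (\<lambda>x. c * g x)"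
    by (simp add: l2_eq_def square_int_scale)
qed

definition uminus_L2 :: "L2 \<Rightarrow> L2" where "uminus_L2 v = (-1) *\<^sub>R v"

definition minus_L2 :: "L2 \<Rightarrow> L2 \<Rightarrow> L2" where "minus_L2 v w = v + - w"

instance
proof
  fix a b :: real and u v w :: L2
  show "u + v + w = u + (v + w)"
    by transfer (auto simp: l2_eq_def ac_simps intro!: square_int_add)
  show "u + v = v + u"
    by transfer (auto simp: l2_eq_def ac_simps intro!: square_int_add)
  show "0 + u = u"
    by transfer (auto simp: l2_eq_def)
  show "- u + u = 0"
    unfolding uminus_L2_def
    by transfer (auto simp: l2_eq_def square_int_zero)
  show "u - v = u + - v"
    by (simp add: minus_L2_def)
  show "a *\<^sub>R (u + v) = a *\<^sub>R u + a *\<^sub>R v"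
    by transfer (auto simp: l2_eq_def distrib_left intro!: square_int_add square_int_scale)
  show "(a + b) *\<^sub>R u = a *\<^sub>R u + b *\<^sub>R u"
    by transfer (auto simp: l2_eq_def distrib_right intro!: square_int_add square_int_scale)
  show "a *\<^sub>R b *\<^sub>R u = (a * b) *\<^sub>R u"
    by transfer (auto simp: l2_eq_def mult.assoc intro!: square_int_scale)
  show "1 *\<^sub>R u = u"
    by transfer (auto simp: l2_eq_def)
qed

end

instantiation L2 :: real_inner
begin

lift_definition inner_L2 :: "L2 \<Rightarrow> L2 \<Rightarrow> real" is "\<lambda>f g. LINT x|Omega. f x * g x"
proof -
  fix f f' g g' assume "l2_eq f f'" "l2_eq g g'"
  then have "square_int f" "square_int f'" "square_int g" "square_int g'"
    and "AE x in Omega. f x = f' x" "AE x in Omega. g x = g' x"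
    by (auto simp: l2_eq_def)
  moreover from this(5,6) have "AE x in Omega. f x * g x = f' x * g' x"
    by eventually_elim simp
  ultimately show "(LINT x|Omega. f x * g x) = (LINT x|Omega. f' x * g' x)"
    by (intro integral_cong_AE) (auto simp: square_int_def)
qed

definition norm_L2 :: "L2 \<Rightarrow> real" where "norm_L2 v = sqrt (v \<bullet> v)"
definition sgn_L2 :: "L2 \<Rightarrow> L2" where "sgn_L2 v = v /\<^sub>R norm v"
definition dist_L2 :: "L2 \<Rightarrow> L2 \<Rightarrow> real" where "dist_L2 v w = norm (v - w)"
definition uniformity_L2 :: "(L2 \<times> L2) filter" where
  "uniformity_L2 = (INF e\<in>{0<..}. principal {(v, w). dist v w < e})"
definition open_L2 :: "L2 set \<Rightarrow> bool" where
  "open_L2 U \<longleftrightarrow> (\<forall>v\<in>U. \<forall>\<^sub>F (v', w) in uniformity. v' = v \<longrightarrow> w \<in> U)"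

instance
proof
  fix a :: real and u v w :: L2 and U :: "L2 set"
  show "sgn u = u /\<^sub>R norm u" by (rule sgn_L2_def)
  show "dist u v = norm (u - v)" by (rule dist_L2_def)
  show "(uniformity :: (L2 \<times> L2) filter) = (INF e\<in>{0<..}. principal {(v, w). dist v w < e})"
    by (rule uniformity_L2_def)
  show "open U \<longleftrightarrow> (\<forall>v\<in>U. \<forall>\<^sub>F (v', w) in uniformity. v' = v \<longrightarrow> w \<in> U)"
    by (rule open_L2_def)
  show "u \<bullet> v = v \<bullet> u"
    by transfer (simp add: mult.commute)
  show "(u + v) \<bullet> w = u \<bullet> w + v \<bullet> w"
    by transfer (simp add: l2_eq_def distrib_right square_int_mult)
  show "(a *\<^sub>R u) \<bullet> v = a * (u \<bullet> v)"
    by transfer (simp add: mult.assoc)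
  show "0 \<le> u \<bullet> u"
    by transfer simp
  show "u \<bullet> u = 0 \<longleftrightarrow> u = 0"
  proof transfer
    fix f assume f: "l2_eq f f"
    then have "integrable Omega (\<lambda>x. f x * f x)"
      by (simp add: l2_eq_def square_int_mult)
    then have "(LINT x|Omega. f x * f x) = 0 \<longleftrightarrow> (AE x in Omega. f x * f x = 0)"
      by (intro integral_nonneg_eq_0_iff_AE) auto
    then show "(LINT x|Omega. f x * f x) = 0 \<longleftrightarrow> l2_eq f (\<lambda>x. 0)"
      using f by (simp add: l2_eq_def square_int_zero)
  qed
  show "norm u = sqrt (u \<bullet> u)" by (rule norm_L2_def)
qed

end

section \<open>Test functions, weak derivatives and the form\<close>

definition test_fun :: "real \<Rightarrow> real \<Rightarrow> (real \<Rightarrow> real) \<Rightarrow> bool" where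
  "test_fun a b \<psi> \<longleftrightarrow>
     (\<forall>n x. ((deriv ^^ n) \<psi>) field_differentiable (at x)) \<and>
     (\<exists>c d. a < c \<and> d < b \<and> (\<forall>x. x \<notin> {c..d} \<longrightarrow> \<psi> x = 0))"

text \<open>\<open>rep_L2 v\<close> is some representative of the class \<open>v\<close>; \<open>abs_L2 f\<close> is the class of a
  square-integrable \<open>f\<close>. All integrals below are independent of the representative.\<close>

definition has_weak_deriv :: "L2 \<Rightarrow> L2 \<Rightarrow> bool" where
  "has_weak_deriv v g \<longleftrightarrow> (\<forall>\<psi>. test_fun 0 1 \<psi> \<longrightarrow>
     (LINT x|Omega. rep_L2 v x * deriv \<psi> x) = - (LINT x|Omega. rep_L2 g x * \<psi> x))"

definition weak_deriv :: "L2 \<Rightarrow> L2" where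
  "weak_deriv v = (THE g. has_weak_deriv v g)"

definition H1 :: "L2 set" where
  "H1 = {v. \<exists>g. has_weak_deriv v g}"

definition H01 :: "L2 set" where
  "H01 = {v \<in> H1. \<exists>\<psi>. (\<forall>k. test_fun 0 1 (\<psi> k)) \<and>
     (\<lambda>k::nat. abs_L2 (\<psi> k)) \<longlonglongrightarrow> v \<and> (\<lambda>k. abs_L2 (deriv (\<psi> k))) \<longlonglongrightarrow> weak_deriv v}"

definition form_a :: "real \<Rightarrow> L2 \<Rightarrow> L2 \<Rightarrow> real" where
  "form_a \<mu> v w = (LINT x|Omega. rep_L2 (weak_deriv v) x * rep_L2 (weak_deriv w) x)
     - \<mu> * (LINT x|Omega. rep_L2 v x * rep_L2 w x / x\<^sup>2)"

text \<open>The graph of \<open>L\<^sub>\<mu>\<close>: \<open>v \<in> D(L\<^sub>\<mu>)\<close> and \<open>L\<^sub>\<mu> v = g\<close>.\<close>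

definition op_L :: "real \<Rightarrow> L2 \<Rightarrow> L2 \<Rightarrow> bool" where
  "op_L \<mu> v g \<longleftrightarrow> v \<in> H01 \<and> (\<forall>w\<in>H01. form_a \<mu> v w = g \<bullet> w)"

text \<open>Enumeration starts at \<open>0\<close> instead of \<open>1\<close>.\<close>

definition eigenbasis :: "real \<Rightarrow> (nat \<Rightarrow> L2) \<Rightarrow> (nat \<Rightarrow> real) \<Rightarrow> bool" where
  "eigenbasis \<mu> \<phi> lam \<longleftrightarrow>
     (\<forall>m n. \<phi> m \<bullet> \<phi> n = (if m = n then 1 else 0)) \<and>
     closure (span (range \<phi>)) = UNIV \<and>
     (\<forall>n. op_L \<mu> (\<phi> n) (lam n *\<^sub>R \<phi> n)) \<and>
     0 < lam 0 \<and> incseq lam \<and> filterlim lam at_top sequentially"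

section \<open>The scale of spaces\<close>

text \<open>For \<open>\<sigma> \<ge> 0\<close>, \<open>Hs \<phi> lam \<sigma>\<close> is \<open>D(L\<^sub>\<mu>\<^bsup>\<sigma>/2\<^esup>)\<close>.\<close>

definition Hs :: "(nat \<Rightarrow> L2) \<Rightarrow> (nat \<Rightarrow> real) \<Rightarrow> real \<Rightarrow> L2 set" where
  "Hs \<phi> lam \<sigma> = {v. summable (\<lambda>n. lam n powr \<sigma> * (v \<bullet> \<phi> n)\<^sup>2)}"

definition Hs_norm :: "(nat \<Rightarrow> L2) \<Rightarrow> (nat \<Rightarrow> real) \<Rightarrow> real \<Rightarrow> L2 \<Rightarrow> real" where
  "Hs_norm \<phi> lam \<sigma> v = sqrt (\<Sum>n. lam n powr \<sigma> * (v \<bullet> \<phi> n)\<^sup>2)"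

text \<open>For \<open>\<sigma> \<ge> 0\<close>, the space of order \<open>- \<sigma>\<close> is realised as the dual of the space of order \<open>\<sigma>\<close>
  with its dual norm; \<open>L2\<close> is the pivot space, embedded by \<open>pivot\<close>. A functional is a function
  on all of \<open>L2\<close> of which only the values on \<open>Hs \<phi> lam \<sigma>\<close> matter, and the duality pairing is
  application.\<close>

type_synonym functional = "L2 \<Rightarrow> real"

definition Hdual :: "(nat \<Rightarrow> L2) \<Rightarrow> (nat \<Rightarrow> real) \<Rightarrow> real \<Rightarrow> functional set" where
  "Hdual \<phi> lam \<sigma> = {l.
     (\<forall>v\<in>Hs \<phi> lam \<sigma>. \<forall>w\<in>Hs \<phi> lam \<sigma>. l (v + w) = l v + l w) \<and>
     (\<forall>c. \<forall>v\<in>Hs \<phi> lam \<sigma>. l (c *\<^sub>R v) = c * l v) \<and>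
     (\<exists>C. \<forall>v\<in>Hs \<phi> lam \<sigma>. \<bar>l v\<bar> \<le> C * Hs_norm \<phi> lam \<sigma> v)}"

definition Hdual_norm :: "(nat \<Rightarrow> L2) \<Rightarrow> (nat \<Rightarrow> real) \<Rightarrow> real \<Rightarrow> functional \<Rightarrow> real" where
  "Hdual_norm \<phi> lam \<sigma> l = (SUP v\<in>{v \<in> Hs \<phi> lam \<sigma>. Hs_norm \<phi> lam \<sigma> v \<le> 1}. \<bar>l v\<bar>)"

definition pivot :: "L2 \<Rightarrow> functional" where
  "pivot f = (\<lambda>v. f \<bullet> v)"

section \<open>Functions of time\<close>

definition Cont_H1 :: "(nat \<Rightarrow> L2) \<Rightarrow> (nat \<Rightarrow> real) \<Rightarrow> real \<Rightarrow> (real \<Rightarrow> L2) \<Rightarrow> bool" where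
  "Cont_H1 \<phi> lam T u \<longleftrightarrow>
     (\<forall>t\<in>{0..T}. u t \<in> Hs \<phi> lam 1 \<and>
        ((\<lambda>s. Hs_norm \<phi> lam 1 (u s - u t)) \<longlongrightarrow> 0) (at t within {0..T}))"

definition Cont_Hm1 :: "(nat \<Rightarrow> L2) \<Rightarrow> (nat \<Rightarrow> real) \<Rightarrow> real \<Rightarrow> (real \<Rightarrow> functional) \<Rightarrow> bool" where
  "Cont_Hm1 \<phi> lam T w \<longleftrightarrow>
     (\<forall>t\<in>{0..T}. w t \<in> Hdual \<phi> lam 1 \<and>
        ((\<lambda>s. Hdual_norm \<phi> lam 1 (\<lambda>v. w s v - w t v)) \<longlongrightarrow> 0) (at t within {0..T}))"

text \<open>\<open>u \<in> C\<^sup>1([0,T])\<close> with values in the space of order \<open>-1\<close>, with time derivative \<open>w\<close>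
  (one-sided at the end points).\<close>

definition C1_Hm1 ::
  "(nat \<Rightarrow> L2) \<Rightarrow> (nat \<Rightarrow> real) \<Rightarrow> real \<Rightarrow> (real \<Rightarrow> L2) \<Rightarrow> (real \<Rightarrow> functional) \<Rightarrow> bool" where
  "C1_Hm1 \<phi> lam T u w \<longleftrightarrow> Cont_Hm1 \<phi> lam T w \<and>
     (\<forall>t\<in>{0..T}. ((\<lambda>s. Hdual_norm \<phi> lam 1
          (\<lambda>v. pivot ((u s - u t) /\<^sub>R (s - t)) v - w t v)) \<longlongrightarrow> 0) (at t within {0..T}))"

text \<open>\<open>L\<^sup>2(0,T)\<close> with values in the space of order \<open>-1\<close>: strong measurability, i.e.
  almost everywhere approximation by simple functions, and square-integrability of the norm.\<close>

definition L2_Hm1 :: "(nat \<Rightarrow> L2) \<Rightarrow> (nat \<Rightarrow> real) \<Rightarrow> real \<Rightarrow> (real \<Rightarrow> functional) \<Rightarrow> bool" where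
  "L2_Hm1 \<phi> lam T D \<longleftrightarrow>
     (AE t in lebesgue_on {0<..<T}. D t \<in> Hdual \<phi> lam 1) \<and>
     (\<exists>S. (\<forall>k::nat. simple_function (lebesgue_on {0<..<T}) (S k) \<and>
             (\<forall>t\<in>{0<..<T}. S k t \<in> Hdual \<phi> lam 1)) \<and>
          (AE t in lebesgue_on {0<..<T}.
             (\<lambda>k. Hdual_norm \<phi> lam 1 (\<lambda>v. S k t v - D t v)) \<longlonglongrightarrow> 0)) \<and>
     integrable (lebesgue_on {0<..<T}) (\<lambda>t. (Hdual_norm \<phi> lam 1 (D t))\<^sup>2)"

text \<open>Bochner integrals of functional-valued maps commute with evaluation at a fixed \<open>v\<close>, so
  they are computed by evaluating under the integral sign.\<close>

definition RL_integral :: "real \<Rightarrow> (real \<Rightarrow> functional) \<Rightarrow> real \<Rightarrow> functional" where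
  "RL_integral \<beta> g t =
     (\<lambda>v. 1 / Gamma \<beta> * (LINT s|lebesgue_on {0<..<t}. (t - s) powr (\<beta> - 1) * g s v))"

text \<open>\<open>D = dG/dt\<close> in the sense of distributions on \<open>(0,T)\<close> with values in the space of
  order \<open>-1\<close>.\<close>

definition distr_deriv ::
  "(nat \<Rightarrow> L2) \<Rightarrow> (nat \<Rightarrow> real) \<Rightarrow> real \<Rightarrow> (real \<Rightarrow> functional) \<Rightarrow> (real \<Rightarrow> functional) \<Rightarrow> bool"
where
  "distr_deriv \<phi> lam T G D \<longleftrightarrow>
     (\<forall>\<psi>. test_fun 0 T \<psi> \<longrightarrow> (\<forall>v\<in>Hs \<phi> lam 1.
        (LINT t|lebesgue_on {0<..<T}. \<psi> t * D t v) =
        - (LINT t|lebesgue_on {0<..<T}. deriv \<psi> t * G t v)))"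

text \<open>Caputo derivative of order \<open>\<alpha> \<in> (1,2)\<close> of a function with time derivative \<open>w\<close>:
  \<open>D = d/dt I\<^bsup>2-\<alpha>\<^esup> (w - w 0)\<close>.\<close>

definition Caputo_deriv ::
  "(nat \<Rightarrow> L2) \<Rightarrow> (nat \<Rightarrow> real) \<Rightarrow> real \<Rightarrow> real \<Rightarrow> (real \<Rightarrow> functional) \<Rightarrow> (real \<Rightarrow> functional) \<Rightarrow> bool"
where
  "Caputo_deriv \<phi> lam T \<alpha> w D \<longleftrightarrow>
     distr_deriv \<phi> lam T (RL_integral (2 - \<alpha>) (\<lambda>s v. w s v - w 0 v)) D"

definition weak_solution ::
  "real \<Rightarrow> (nat \<Rightarrow> L2) \<Rightarrow> (nat \<Rightarrow> real) \<Rightarrow> real \<Rightarrow> real \<Rightarrow> L2 \<Rightarrow> L2 \<Rightarrow> (real \<Rightarrow> L2) \<Rightarrow>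
   (real \<Rightarrow> L2) \<Rightarrow> bool"
where
  "weak_solution \<mu> \<phi> lam T \<alpha> u0 u1 f u \<longleftrightarrow>
     Cont_H1 \<phi> lam T u \<and> u 0 = u0 \<and>
     (\<exists>w D. C1_Hm1 \<phi> lam T u w \<and>
        (\<forall>v\<in>Hs \<phi> lam 1. w 0 v = pivot u1 v) \<and>
        L2_Hm1 \<phi> lam T D \<and> Caputo_deriv \<phi> lam T \<alpha> w D \<and>
        (AE t in lebesgue_on {0<..<T}. \<forall>v\<in>Hs \<phi> lam 1.
           D t v + form_a \<mu> (u t) v = f t \<bullet> v))"

definition Linf :: "real \<Rightarrow> (real \<Rightarrow> real) \<Rightarrow> bool" where
  "Linf T q \<longleftrightarrow> q \<in> borel_measurable (lebesgue_on {0<..<T}) \<and>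
     (\<exists>C. AE t in lebesgue_on {0<..<T}. \<bar>q t\<bar> \<le> C)"

definition compact_operator :: "('a::real_normed_vector \<Rightarrow> 'b::real_normed_vector) \<Rightarrow> bool" where
  "compact_operator A \<longleftrightarrow> linear A \<and> (\<forall>B. bounded B \<longrightarrow> compact (closure (A ` B)))"

end

theory Submission
  imports Defs
begin

text \<open>
  The operator is diagonal in the eigenbasis. Testing the equation with \<open>\<phi> n\<close> shows that the
  coefficient \<open>u p t \<bullet> \<phi> n\<close> solves a scalar Caputo equation of order \<open>\<alpha>\<close> with constant \<open>lam n\<close> and
  right-hand side \<open>q t * (p \<bullet> \<phi> n)\<close> (\<open>weak_solution_coeff\<close>), and the scalar equation has at most one
  solution with given initial data (\<open>frac_sol_zero\<close>). Hence the \<open>n\<close>-th coefficient of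
  \<open>A p = u p T - u 0 T\<close> is \<open>m n * (p \<bullet> \<phi> n)\<close> with a number \<open>m n\<close> that does not depend on \<open>p\<close>
  (\<open>terminal_coeff\<close>).

  That \<open>m n\<close> tends to zero follows from regularity alone. The terminal value of every weak solution
  lies in the space of order one, so \<open>\<Sum> lam n (m n (p \<bullet> \<phi> n))\<^sup>2\<close> converges
  for every \<open>p\<close> in \<open>L\<^sup>2\<close>. Since \<open>lam n\<close> tends to infinity, and since every square-summable sequence
  is a sequence of coefficients, this forces \<open>m n\<close> to tend to zero (\<open>multiplier_tendsto_0\<close>). A
  diagonal operator with such multipliers is a uniform limit of operators of finite rank on bounded
  sets, hence compact (\<open>diagonal_operator_compact\<close>).

  Two points require work. First, testing with \<open>\<phi> n\<close> uses that the space of order one, which is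
  defined by coefficients, is contained in \<open>H01\<close>, where the eigenvalue equation holds
  (\<open>Hs_1_subset_H01\<close>); this is where Hardy's inequality and the condition \<open>\<mu> < 1 / 4\<close> enter.
  Secondly, uniqueness for the scalar equation: for zero data, the lemma of du Bois-Reymond turns the
  distributional equation into \<open>I\<^bsup>2-\<alpha>\<^esup> y' = - l \<integral> y\<close>; Abel inversion bounds \<open>\<bar>y t\<bar>\<close> by a multiple
  of the integral of \<open>\<bar>y\<bar>\<close> over \<open>[0,t]\<close>, and Gronwall's inequality gives \<open>y = 0\<close>.

  The supply of test functions comes from the eigenbasis itself: the eigenfunctions are limits of
  test functions in \<open>L\<^sup>2\<close> and span a dense subspace, so test functions are dense (\<open>test_fun_dense\<close>).
  This yields the uniqueness of weak derivatives and, after rescaling \<open>(0,1)\<close> to \<open>(0,T)\<close>, the lemma of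
  du Bois-Reymond in time.
\<close>

section \<open>Orthonormal bases and diagonal operators\<close>

text \<open>Approximability by compact sets gives total boundedness, and a totally bounded set in a complete
  space has compact closure.\<close>

lemma compact_closure_approx:
  fixes S :: "'b::complete_space set"
  assumes "\<And>e. e > 0 \<Longrightarrow> \<exists>K. compact K \<and> (\<forall>x\<in>S. \<exists>y\<in>K. dist x y \<le> e)"
  shows "compact (closure S)"
  unfolding compact_eq_totally_bounded
proof (intro conjI allI impI)
  show "complete (closure S)" by (simp add: complete_eq_closed)
next
  fix e :: real assume "e > 0"
  then obtain K where K: "compact K" "\<And>x. x \<in> S \<Longrightarrow> \<exists>y\<in>K. dist x y \<le> e/4"
    using assms[of "e/4"] by auto
  from K(1) obtain k where k: "finite k" "K \<subseteq> (\<Union>x\<in>k. ball x (e/4))"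
    unfolding compact_eq_totally_bounded using \<open>e > 0\<close> by (metis zero_less_divide_iff zero_less_numeral)
  have "closure S \<subseteq> (\<Union>x\<in>k. ball x e)"
  proof
    fix x assume "x \<in> closure S"
    then obtain y where y: "y \<in> S" "dist y x < e/4"
      using closure_approachable[of x S] \<open>e > 0\<close> by (metis zero_less_divide_iff zero_less_numeral)
    from K(2)[OF y(1)] obtain z where z: "z \<in> K" "dist y z \<le> e/4" by blast
    with k(2) obtain w where w: "w \<in> k" "dist w z < e/4" by auto
    have "dist w x \<le> dist w z + dist y z + dist y x"
      using dist_triangle[of w x z] dist_triangle[of z x y] by (simp add: dist_commute)
    then have "dist w x < e"
      using w(2) z(2) y(2) \<open>e > 0\<close> by linarith
    with w(1) show "x \<in> (\<Union>x\<in>k. ball x e)" by auto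
  qed
  with k(1) show "\<exists>k. finite k \<and> closure S \<subseteq> (\<Union>x\<in>k. ball x e)" by blast
qed

locale orthonormal_basis =
  fixes \<phi> :: "nat \<Rightarrow> 'a::real_inner"
  assumes orth: "\<phi> m \<bullet> \<phi> n = (if m = n then 1 else 0)"
    and total: "closure (span (range \<phi>)) = UNIV"
begin

definition fourier_sum :: "nat \<Rightarrow> 'a \<Rightarrow> 'a" where
  "fourier_sum N v = (\<Sum>n<N. (v \<bullet> \<phi> n) *\<^sub>R \<phi> n)"

lemma sum_coeff: "finite F \<Longrightarrow> (\<Sum>n\<in>F. c n *\<^sub>R \<phi> n) \<bullet> \<phi> k = (if k \<in> F then c k else 0)"
  by (simp add: inner_sum_left orth if_distrib cong: if_cong)

lemma norm_sum: "finite F \<Longrightarrow> (norm (\<Sum>n\<in>F. c n *\<^sub>R \<phi> n))\<^sup>2 = (\<Sum>n\<in>F. (c n)\<^sup>2)"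
  unfolding power2_norm_eq_inner inner_sum_right[of "\<Sum>n\<in>F. c n *\<^sub>R \<phi> n"] inner_scaleR_right
  by (intro sum.cong) (auto simp: sum_coeff power2_eq_square)

lemma fourier_sum_coeff: "fourier_sum N v \<bullet> \<phi> k = (if k < N then v \<bullet> \<phi> k else 0)"
  unfolding fourier_sum_def by (subst sum_coeff) auto

lemma fourier_sum_best:
  assumes "w \<in> span (\<phi> ` {..<N})"
  shows "norm (v - fourier_sum N v) \<le> norm (v - w)"
proof -
  have ortho: "(v - fourier_sum N v) \<bullet> x = 0" if "x \<in> span (\<phi> ` {..<N})" for x
    using that
  proof (induction rule: span_induct_alt)
    case base then show ?case by simp
  next
    case (step c x y)
    then show ?case
      by (auto simp: inner_add_right inner_diff_left fourier_sum_coeff)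
  qed
  have "fourier_sum N v \<in> span (\<phi> ` {..<N})"
    unfolding fourier_sum_def by (intro span_sum span_scale span_base) auto
  then have "fourier_sum N v - w \<in> span (\<phi> ` {..<N})"
    using assms by (rule span_diff)
  from ortho[OF this]
  have "(norm (v - w))\<^sup>2 = (norm (v - fourier_sum N v))\<^sup>2 + (norm (fourier_sum N v - w))\<^sup>2"
    using norm_add_Pythagorean[of "v - fourier_sum N v" "fourier_sum N v - w"]
    by (simp add: orthogonal_def)
  then have "(norm (v - fourier_sum N v))\<^sup>2 \<le> (norm (v - w))\<^sup>2"
    by (metis le_add_same_cancel1 zero_le_power2)
  then show ?thesis
    by (rule power2_le_imp_le) (rule norm_ge_zero)
qed

text \<open>A partial sum is the best approximation from its span, and finite linear combinations of the
  basis are dense.\<close>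

lemma fourier_sum_tendsto: "(\<lambda>N. fourier_sum N v) \<longlonglongrightarrow> v"
proof (rule LIMSEQ_I)
  fix e :: real assume "e > 0"
  have "v \<in> closure (span (range \<phi>))" using total by simp
  then obtain w where w: "w \<in> span (range \<phi>)" "dist w v < e"
    using closure_approachable \<open>e > 0\<close> by blast
  have "\<exists>N. w \<in> span (\<phi> ` {..<N})"
    using w(1)
  proof (induction rule: span_induct_alt)
    case base show ?case by (auto simp: span_zero)
  next
    case (step c x y)
    then obtain N n where N: "y \<in> span (\<phi> ` {..<N})" and n: "x = \<phi> n" by auto
    have "y \<in> span (\<phi> ` {..<max N (Suc n)})"
      using N by (rule subsetD[OF span_mono, rotated]) auto
    moreover have "x \<in> span (\<phi> ` {..<max N (Suc n)})"
      unfolding n by (rule span_base) auto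
    ultimately show ?case by (meson span_add span_scale)
  qed
  then obtain N where N: "w \<in> span (\<phi> ` {..<N})" ..
  show "\<exists>N. \<forall>k\<ge>N. norm (fourier_sum k v - v) < e"
  proof (intro exI allI impI)
    fix k assume "k \<ge> N"
    then have "w \<in> span (\<phi> ` {..<k})"
      by (intro subsetD[OF span_mono N]) auto
    from fourier_sum_best[OF this, of v] w(2) show "norm (fourier_sum k v - v) < e"
      by (simp add: norm_minus_commute dist_norm)
  qed
qed

lemma parseval: "(\<lambda>n. (v \<bullet> \<phi> n)\<^sup>2) sums (norm v)\<^sup>2"
proof -
  have "(\<lambda>N. (norm (fourier_sum N v))\<^sup>2) \<longlonglongrightarrow> (norm v)\<^sup>2"
    by (intro tendsto_power tendsto_norm fourier_sum_tendsto)
  then show ?thesis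
    by (simp add: sums_def fourier_sum_def norm_sum)
qed

lemma coeff_eqI:
  assumes "\<And>n. v \<bullet> \<phi> n = w \<bullet> \<phi> n"
  shows "v = w"
proof -
  have "fourier_sum N v = fourier_sum N w" for N
    using assms by (simp add: fourier_sum_def)
  then have "(\<lambda>N. fourier_sum N v) \<longlonglongrightarrow> w"
    using fourier_sum_tendsto[of w] by simp
  with fourier_sum_tendsto[of v] show ?thesis by (rule LIMSEQ_unique)
qed

lemma dense_orthogonal:
  assumes "\<And>n. v \<bullet> \<phi> n = 0"
  shows "v = 0"
  using coeff_eqI[of v 0] assms by simp

end

locale hilbert_basis = orthonormal_basis \<phi>
  for \<phi> :: "nat \<Rightarrow> 'a::{real_inner,complete_space}"
begin

lemma riesz_fischer:
  assumes "summable (\<lambda>n. (c n)\<^sup>2)"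
  obtains v where "\<And>n. v \<bullet> \<phi> n = c n"
proof -
  define s where "s N = (\<Sum>n<N. c n *\<^sub>R \<phi> n)" for N
  have "Cauchy s"
  proof (rule metric_CauchyI)
    fix e :: real assume "e > 0"
    from assms have C: "Cauchy (\<lambda>N. \<Sum>n<N. (c n)\<^sup>2)"
      by (simp add: summable_iff_convergent convergent_Cauchy)
    have "e\<^sup>2 > 0" using \<open>e > 0\<close> by simp
    from metric_CauchyD[OF C this] obtain M where M: "\<And>m n. m \<ge> M \<Longrightarrow> n \<ge> M \<Longrightarrow>
        dist (\<Sum>i<m. (c i)\<^sup>2) (\<Sum>i<n. (c i)\<^sup>2) < e\<^sup>2"
      by blast
    have *: "dist (s m) (s n) < e" if "M \<le> n" "n \<le> m" for m n
    proof -
      have "s m - s n = (\<Sum>i\<in>{n..<m}. c i *\<^sub>R \<phi> i)"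
        unfolding s_def using that(2) by (metis lessThan_atLeast0 sum_diff_nat_ivl zero_le)
      then have "(dist (s m) (s n))\<^sup>2 = (\<Sum>i\<in>{n..<m}. (c i)\<^sup>2)"
        by (simp add: dist_norm norm_sum)
      also have "\<dots> = (\<Sum>i<m. (c i)\<^sup>2) - (\<Sum>i<n. (c i)\<^sup>2)"
        using that(2) by (metis lessThan_atLeast0 sum_diff_nat_ivl zero_le)
      also have "\<dots> < e\<^sup>2"
        using M[of m n] that by (simp add: dist_real_def)
      finally show ?thesis
        by (rule power2_less_imp_less) (use \<open>e > 0\<close> in simp)
    qed
    show "\<exists>M. \<forall>m\<ge>M. \<forall>n\<ge>M. dist (s m) (s n) < e"
      using * by (metis dist_commute nle_le)
  qed
  then obtain v where v: "s \<longlonglongrightarrow> v"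
    using Cauchy_convergent_iff convergent_def by blast
  have "v \<bullet> \<phi> k = c k" for k
  proof -
    have "(\<lambda>N. s N \<bullet> \<phi> k) \<longlonglongrightarrow> v \<bullet> \<phi> k"
      by (intro tendsto_inner v tendsto_const)
    moreover have "(\<lambda>N. s N \<bullet> \<phi> k) \<longlonglongrightarrow> c k"
      by (rule tendsto_eventually)
        (auto simp: s_def sum_coeff eventually_sequentially intro!: exI[of _ "Suc k"])
    ultimately show ?thesis by (rule LIMSEQ_unique)
  qed
  then show thesis by (rule that)
qed

text \<open>If \<open>m\<close> stayed away from zero along a subsequence, then along a sparser one, on which \<open>lam\<close>
  exceeds \<open>4 ^ k\<close>, the vector with coefficients \<open>(1/2) ^ k\<close> would give a series whose terms do not
  tend to zero.\<close>

lemma multiplier_tendsto_0: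
  fixes m lam :: "nat \<Rightarrow> real"
  assumes lam: "filterlim lam at_top sequentially"
    and summ: "\<And>p. summable (\<lambda>n. lam n * (m n * (p \<bullet> \<phi> n))\<^sup>2)"
  shows "m \<longlonglongrightarrow> 0"
proof (rule ccontr)
  assume "\<not> m \<longlonglongrightarrow> 0"
  then obtain e where e: "e > 0" and freq: "\<And>N. \<exists>n\<ge>N. \<bar>m n\<bar> \<ge> e"
    unfolding LIMSEQ_iff by (auto simp: not_less)
  have ex: "\<exists>n>k. \<bar>m n\<bar> \<ge> e \<and> lam n \<ge> 4 ^ j" for j k :: nat
  proof -
    from lam obtain N where "\<And>n. n \<ge> N \<Longrightarrow> lam n \<ge> 4 ^ j"
      unfolding filterlim_at_top eventually_sequentially by blast
    with freq[of "max N (Suc k)"] show ?thesis by (metis Suc_le_eq max.bounded_iff)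
  qed
  have "\<exists>r :: nat \<Rightarrow> nat. \<forall>j. (\<bar>m (r j)\<bar> \<ge> e \<and> lam (r j) \<ge> 4 ^ j) \<and> r j < r (Suc j)"
    by (rule dependent_nat_choice) (use ex in blast)+
  then obtain r where r: "\<And>j. \<bar>m (r j)\<bar> \<ge> e" "\<And>j. lam (r j) \<ge> 4 ^ j" "strict_mono r"
    by (auto simp: strict_mono_Suc_iff)
  define c where "c n = (if n \<in> range r then (1/2) ^ inv r n else 0 :: real)" for n
  have inj: "inj r" using r(3) by (rule strict_mono_imp_inj_on)
  then have cr: "c (r j) = (1/2) ^ j" for j by (simp add: c_def)
  have "summable (\<lambda>j. (c (r j))\<^sup>2)"
    unfolding cr power_mult[symmetric]
    by (subst mult.commute, subst power_mult) (simp add: power2_eq_square)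
  then have "summable (\<lambda>n. (c n)\<^sup>2)"
    by (subst (asm) summable_mono_reindex[OF r(3), of "\<lambda>n. (c n)\<^sup>2"]) (auto simp: c_def)
  then obtain p where p: "\<And>n. p \<bullet> \<phi> n = c n" by (rule riesz_fischer) blast
  have "summable (\<lambda>j. lam (r j) * (m (r j) * c (r j))\<^sup>2)"
    using summ[of p]
    by (subst summable_mono_reindex[OF r(3), of "\<lambda>n. lam n * (m n * c n)\<^sup>2"]) (auto simp: p c_def)
  then have "(\<lambda>j. lam (r j) * (m (r j) * c (r j))\<^sup>2) \<longlonglongrightarrow> 0"
    by (rule summable_LIMSEQ_zero)
  then obtain j where j: "lam (r j) * (m (r j) * c (r j))\<^sup>2 < e\<^sup>2"
    using order_tendstoD(2)[of _ 0 sequentially "e\<^sup>2"] e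
    by (metis (no_types, lifting) eventually_sequentially order_refl zero_less_power)
  have "e\<^sup>2 = 4 ^ j * (e * (1/2) ^ j)\<^sup>2"
    by (simp add: power_mult_distrib power_divide power_mult[symmetric] mult.commute[of j])
      (simp add: power_mult)
  also have "\<dots> \<le> lam (r j) * (m (r j) * c (r j))\<^sup>2"
  proof (intro mult_mono r)
    have "\<bar>e * (1/2) ^ j\<bar> \<le> \<bar>m (r j) * c (r j)\<bar>"
      using r(1)[of j] e by (simp add: abs_mult cr)
    then show "(e * (1/2) ^ j)\<^sup>2 \<le> (m (r j) * c (r j))\<^sup>2"
      by (simp only: abs_le_square_iff)
    show "0 \<le> lam (r j)" using r(2)[of j] by (meson order_trans zero_le_numeral zero_le_power)
  qed simp
  finally show False using j by simp
qed

lemma compact_coeff_box: "compact {v. \<exists>c. v = (\<Sum>n<N. c n *\<^sub>R \<phi> n) \<and> (\<forall>n<N. \<bar>c n\<bar> \<le> R)}"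
proof (induction N)
  case 0
  have "{v. \<exists>c :: nat \<Rightarrow> real. v = (0::'a)} = {0}" by auto
  then show ?case by simp
next
  case (Suc N)
  let ?K = "\<lambda>N. {v. \<exists>c. v = (\<Sum>n<N. c n *\<^sub>R \<phi> n) \<and> (\<forall>n<N. \<bar>c n\<bar> \<le> R)}"
  have "compact ((\<lambda>c. c *\<^sub>R \<phi> N) ` {-R..R})"
    by (intro compact_continuous_image continuous_intros) auto
  from compact_sums[OF Suc this]
  have "compact {x + y |x y. x \<in> ?K N \<and> y \<in> (\<lambda>c. c *\<^sub>R \<phi> N) ` {-R..R}}" .
  also have "{x + y |x y. x \<in> ?K N \<and> y \<in> (\<lambda>c. c *\<^sub>R \<phi> N) ` {-R..R}} = ?K (Suc N)"
  proof (intro equalityI subsetI)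
    fix z assume "z \<in> {x + y |x y. x \<in> ?K N \<and> y \<in> (\<lambda>c. c *\<^sub>R \<phi> N) ` {-R..R}}"
    then obtain c d where cd: "z = (\<Sum>n<N. c n *\<^sub>R \<phi> n) + d *\<^sub>R \<phi> N"
        "\<forall>n<N. \<bar>c n\<bar> \<le> R" "d \<in> {-R..R}"
      by auto
    show "z \<in> ?K (Suc N)"
      using cd by (auto simp: less_Suc_eq intro!: exI[of _ "c(N := d)"] sum.cong)
  next
    fix z assume "z \<in> ?K (Suc N)"
    then obtain c where "z = (\<Sum>n<N. c n *\<^sub>R \<phi> n) + c N *\<^sub>R \<phi> N" "\<forall>n<Suc N. \<bar>c n\<bar> \<le> R"
      by auto
    moreover from this(2) have "c N \<in> {-R..R}" by (auto simp: abs_le_iff dest: spec[of _ N])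
    ultimately show "z \<in> {x + y |x y. x \<in> ?K N \<and> y \<in> (\<lambda>c. c *\<^sub>R \<phi> N) ` {-R..R}}"
      by (intro CollectI exI[of _ "\<Sum>n<N. c n *\<^sub>R \<phi> n"] exI[of _ "c N *\<^sub>R \<phi> N"]) auto
  qed
  finally show ?case .
qed

text \<open>Cutting off the coefficients from \<open>N\<close> on changes \<open>A p\<close> by at most \<open>sup {\<bar>m n\<bar> | n \<ge> N} * norm p\<close>,
  and the truncated vectors lie in a compact box of dimension \<open>N\<close>.\<close>

lemma diagonal_operator_compact:
  assumes coeff: "\<And>p n. A p \<bullet> \<phi> n = m n * (p \<bullet> \<phi> n)" and m: "m \<longlonglongrightarrow> 0"
  shows "compact_operator A"
  unfolding compact_operator_def
proof (intro conjI allI impI)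
  show "linear A"
    by (rule linearI; rule coeff_eqI) (auto simp: coeff inner_add_left distrib_left)
next
  fix B :: "'a set" assume "bounded B"
  then obtain R where R: "R > 0" "\<And>p. p \<in> B \<Longrightarrow> norm p \<le> R"
    unfolding bounded_pos by blast
  show "compact (closure (A ` B))"
  proof (rule compact_closure_approx)
    fix e :: real assume "e > 0"
    then obtain N where N: "\<And>n. n \<ge> N \<Longrightarrow> \<bar>m n\<bar> < e / R"
      using LIMSEQ_D[OF m, of "e / R"] R(1) by auto
    from m have "Bseq m" by (meson convergentI convergent_imp_Bseq)
    then obtain M where M: "\<And>n. \<bar>m n\<bar> \<le> M" "M > 0" unfolding Bseq_def by auto
    let ?K = "{v. \<exists>c. v = (\<Sum>n<N. c n *\<^sub>R \<phi> n) \<and> (\<forall>n<N. \<bar>c n\<bar> \<le> M * R)}"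
    have unit: "norm (\<phi> n) = 1" for n by (simp add: norm_eq_sqrt_inner orth)
    have "\<exists>y\<in>?K. dist (A p) y \<le> e" if p: "p \<in> B" for p
    proof
      show "fourier_sum N (A p) \<in> ?K"
        unfolding fourier_sum_def
      proof (intro CollectI exI conjI allI impI)
        fix n
        have "\<bar>p \<bullet> \<phi> n\<bar> \<le> R"
          using Cauchy_Schwarz_ineq2[of p "\<phi> n"] R(2)[OF p] by (simp add: unit)
        then show "\<bar>A p \<bullet> \<phi> n\<bar> \<le> M * R"
          using M by (simp add: coeff abs_mult mult_mono')
      qed (rule refl)
      have "(norm (A p - fourier_sum N (A p)))\<^sup>2 \<le> (e / R)\<^sup>2 * (norm p)\<^sup>2"
      proof (rule sums_le[OF _ parseval sums_mult[OF parseval]])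
        fix n
        show "((A p - fourier_sum N (A p)) \<bullet> \<phi> n)\<^sup>2 \<le> (e / R)\<^sup>2 * (p \<bullet> \<phi> n)\<^sup>2"
          using N[of n] R(1) \<open>e > 0\<close>
          by (auto simp: inner_diff_left fourier_sum_coeff coeff power_mult_distrib
              abs_le_square_iff[symmetric] intro!: mult_right_mono)
      qed
      also have "\<dots> \<le> (e / R)\<^sup>2 * R\<^sup>2"
        using R p by (intro mult_left_mono power_mono) auto
      also have "\<dots> = e\<^sup>2" using R(1) by (simp add: power_divide)
      finally show "dist (A p) (fourier_sum N (A p)) \<le> e"
        unfolding dist_norm by (rule power2_le_imp_le) (use \<open>e > 0\<close> in simp)
    qed
    with compact_coeff_box show "\<exists>K. compact K \<and> (\<forall>x\<in>A ` B. \<exists>y\<in>K. dist x y \<le> e)"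
      by (intro exI[of _ ?K]) auto
  qed
qed

end

section \<open>Completeness of \<open>L\<^sup>2\<close>\<close>

lemma square_int_rep: "square_int (rep_L2 v)"
  using Quotient3_rep_reflp[OF Quotient3_L2, of v] by (simp add: l2_eq_def)

lemma abs_rep_L2: "abs_L2 (rep_L2 v) = v"
  by (rule Quotient3_abs_rep[OF Quotient3_L2])

lemma l2_eq_refl: "square_int f \<Longrightarrow> l2_eq f f"
  by (simp add: l2_eq_def)

lemma rep_abs_L2: "square_int f \<Longrightarrow> AE x in Omega. rep_L2 (abs_L2 f) x = f x"
  using rep_abs_rsp_left[OF Quotient3_L2 l2_eq_refl] by (simp add: l2_eq_def)

lemma inner_L2_rep: "v \<bullet> w = (LINT x|Omega. rep_L2 v x * rep_L2 w x)"
  by (simp add: inner_L2_def)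

lemma inner_L2_abs:
  "square_int f \<Longrightarrow> square_int g \<Longrightarrow> abs_L2 f \<bullet> abs_L2 g = (LINT x|Omega. f x * g x)"
  by (simp add: inner_L2.abs_eq l2_eq_refl)

lemma inner_L2_abs_right:
  "square_int g \<Longrightarrow> v \<bullet> abs_L2 g = (LINT x|Omega. rep_L2 v x * g x)"
  using inner_L2_abs[OF square_int_rep[of v], of g] by (simp add: abs_rep_L2)

lemma norm_L2_sq: "(norm v)\<^sup>2 = (LINT x|Omega. (rep_L2 v x)\<^sup>2)"
  unfolding power2_norm_eq_inner inner_L2_rep by (simp add: power2_eq_square)

lemma norm_L2_abs: "square_int f \<Longrightarrow> (norm (abs_L2 f))\<^sup>2 = (LINT x|Omega. (f x)\<^sup>2)"
  unfolding power2_norm_eq_inner by (simp add: inner_L2_abs power2_eq_square)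

lemma abs_L2_add:
  "square_int f \<Longrightarrow> square_int g \<Longrightarrow> abs_L2 (\<lambda>x. f x + g x) = abs_L2 f + abs_L2 g"
  by (simp add: plus_L2.abs_eq l2_eq_refl)

lemma abs_L2_scale: "square_int f \<Longrightarrow> abs_L2 (\<lambda>x. c * f x) = c *\<^sub>R abs_L2 f"
  by (simp add: scaleR_L2.abs_eq l2_eq_refl)

lemma square_int_diff:
  "square_int f \<Longrightarrow> square_int g \<Longrightarrow> square_int (\<lambda>x. f x - g x)"
  using square_int_add[OF _ square_int_scale[of g "-1"], of f] by simp

lemma abs_L2_diff:
  assumes "square_int f" "square_int g"
  shows "abs_L2 (\<lambda>x. f x - g x) = abs_L2 f - abs_L2 g"
  using abs_L2_add[OF assms(1) square_int_scale[OF assms(2), of "-1"]] abs_L2_scale[OF assms(2), of "-1"]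
  by simp

lemma abs_L2_eq_iff:
  assumes "square_int f" "square_int g"
  shows "abs_L2 f = abs_L2 g \<longleftrightarrow> (AE x in Omega. f x = g x)"
  using Quotient3_rel[OF Quotient3_L2, of f g] assms by (auto simp: l2_eq_def)

lemma rep_L2_add: "AE x in Omega. rep_L2 (v + w) x = rep_L2 v x + rep_L2 w x"
  using rep_abs_L2[OF square_int_add[OF square_int_rep square_int_rep], of v w]
  by (simp add: abs_L2_add square_int_rep abs_rep_L2)

lemma rep_L2_diff: "AE x in Omega. rep_L2 (v - w) x = rep_L2 v x - rep_L2 w x"
  using rep_abs_L2[OF square_int_diff[OF square_int_rep square_int_rep], of v w]
  by (simp add: abs_L2_diff square_int_rep abs_rep_L2)

lemma rep_L2_scale: "AE x in Omega. rep_L2 (c *\<^sub>R v) x = c * rep_L2 v x"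
  using rep_abs_L2[OF square_int_scale[OF square_int_rep], of c v]
  by (simp add: abs_L2_scale square_int_rep abs_rep_L2)

lemma finite_measure_Omega: "finite_measure Omega"
  by (rule finite_measureI) (simp add: emeasure_restrict_space)

lemma square_int_bounded:
  assumes "f \<in> borel_measurable Omega" "\<And>x. 0 < x \<Longrightarrow> x < 1 \<Longrightarrow> \<bar>f x\<bar> \<le> C"
  shows "square_int f"
proof -
  interpret finite_measure Omega by (rule finite_measure_Omega)
  have "integrable Omega (\<lambda>x. (f x)\<^sup>2)"
    using assms abs_le_square_iff[of _ C] assms(2)[THEN order_trans[OF _ abs_ge_self]]
    by (intro integrable_const_bound[where B = "C\<^sup>2"])
      (auto simp: space_restrict_space intro!: AE_I2)
  with assms(1) show ?thesis by (simp add: square_int_def)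
qed

text \<open>The Cauchy--Schwarz inequality against the constant \<open>1\<close>, which has norm \<open>1\<close> on the unit
  interval.\<close>

lemma integral_abs_rep_le: "(LINT x|Omega. \<bar>rep_L2 v x\<bar>) \<le> norm v"
proof -
  let ?f = "\<lambda>x. \<bar>rep_L2 v x\<bar>"
  have f: "square_int ?f"
    using square_int_rep[of v] by (auto simp: square_int_def)
  have one: "square_int (\<lambda>x. 1)" by (rule square_int_bounded[of _ 1]) auto
  have "(norm (abs_L2 (\<lambda>x. 1)))\<^sup>2 = 1"
    by (simp add: norm_L2_abs[OF one] measure_restrict_space)
  then have 1: "norm (abs_L2 (\<lambda>x. 1)) = 1"
    by (simp add: power2_eq_1_iff) (metis norm_ge_zero not_one_le_zero neg_0_le_iff_le)
  have "(norm (abs_L2 ?f))\<^sup>2 = (norm v)\<^sup>2"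
    by (subst norm_L2_abs[OF f]) (simp add: norm_L2_sq)
  then have 2: "norm (abs_L2 ?f) = norm v" by simp
  have "(LINT x|Omega. ?f x) = abs_L2 ?f \<bullet> abs_L2 (\<lambda>x. 1)"
    by (simp add: inner_L2_abs f one)
  also have "\<dots> \<le> norm v"
    using norm_cauchy_schwarz[of "abs_L2 ?f" "abs_L2 (\<lambda>x. 1)"] by (simp add: 1 2)
  finally show ?thesis .
qed

lemma integrable_square_int: "square_int f \<Longrightarrow> integrable Omega f"
  using square_int_mult[of f "\<lambda>x. 1"] square_int_bounded[of "\<lambda>x. 1" 1] by simp

text \<open>Fatou's lemma in the form that is used twice: for the completeness of \<open>L\<^sup>2\<close> and to extend Hardy's
  inequality to limits. The slack \<open>e\<close> allows bounds that hold only in the limit.\<close>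

lemma fatou_square_int:
  assumes g: "\<And>j. square_int (g j)" and lim: "AE x in Omega. (\<lambda>j. g j x) \<longlonglongrightarrow> G x"
    and G: "G \<in> borel_measurable Omega"
    and C: "\<And>e. e > 0 \<Longrightarrow> \<forall>\<^sub>F j in sequentially. (LINT x|Omega. (g j x)\<^sup>2) \<le> C + e"
  shows "square_int G" "(LINT x|Omega. (G x)\<^sup>2) \<le> C"
proof -
  have [measurable]: "g j \<in> borel_measurable Omega" for j using g by (auto simp: square_int_def)
  note G[measurable]
  have le: "(\<integral>\<^sup>+x. ennreal ((G x)\<^sup>2) \<partial>Omega) \<le> ennreal (C + e)" if "e > 0" for e
  proof -
    have "(\<integral>\<^sup>+x. ennreal ((G x)\<^sup>2) \<partial>Omega) = (\<integral>\<^sup>+x. liminf (\<lambda>j. ennreal ((g j x)\<^sup>2)) \<partial>Omega)"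
    proof (rule nn_integral_cong_AE)
      from lim show "AE x in Omega. ennreal ((G x)\<^sup>2) = liminf (\<lambda>j. ennreal ((g j x)\<^sup>2))"
      proof eventually_elim
        case (elim x)
        then have "(\<lambda>j. ennreal ((g j x)\<^sup>2)) \<longlonglongrightarrow> ennreal ((G x)\<^sup>2)"
          by (intro tendsto_ennrealI tendsto_power)
        then show ?case by (intro lim_imp_Liminf[symmetric]) simp_all
      qed
    qed
    also have "\<dots> \<le> liminf (\<lambda>j. \<integral>\<^sup>+x. ennreal ((g j x)\<^sup>2) \<partial>Omega)"
      by (rule nn_integral_liminf) measurable
    also have "\<dots> = liminf (\<lambda>j. ennreal (LINT x|Omega. (g j x)\<^sup>2))"
      using g by (intro arg_cong[where f = liminf] ext nn_integral_eq_integral) (auto simp: square_int_def)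
    also have "\<dots> \<le> ennreal (C + e)"
    proof -
      have "\<forall>\<^sub>F j in sequentially. ennreal (LINT x|Omega. (g j x)\<^sup>2) \<le> ennreal (C + e)"
        using C[OF that] by eventually_elim (rule ennreal_leI)
      then have "liminf (\<lambda>j. ennreal (LINT x|Omega. (g j x)\<^sup>2)) \<le> liminf (\<lambda>j::nat. ennreal (C + e))"
        by (rule Liminf_mono)
      also have "\<dots> = ennreal (C + e)" by (intro Liminf_const) simp
      finally show ?thesis .
    qed
    finally show ?thesis .
  qed
  have int: "integrable Omega (\<lambda>x. (G x)\<^sup>2)"
  proof (rule integrableI_bounded)
    show "(\<integral>\<^sup>+x. ennreal (norm ((G x)\<^sup>2)) \<partial>Omega) < \<infinity>"
      using le[of 1] by (auto intro: le_less_trans)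
  qed measurable
  then show "square_int G" using G by (simp add: square_int_def)
  have "C + e \<ge> 0" if "e > 0" for e
  proof -
    from C[OF that] obtain j where "(LINT x|Omega. (g j x)\<^sup>2) \<le> C + e"
      by (auto simp: eventually_sequentially)
    moreover have "(LINT x|Omega. (g j x)\<^sup>2) \<ge> 0" by simp
    ultimately show ?thesis by linarith
  qed
  with le have "(LINT x|Omega. (G x)\<^sup>2) \<le> C + e" if "e > 0" for e
    using that int by (subst (asm) nn_integral_eq_integral) auto
  then show "(LINT x|Omega. (G x)\<^sup>2) \<le> C" by (rule field_le_epsilon)
qed

lemma L2_tendsto_AE_subseq:
  assumes "X \<longlonglongrightarrow> (v :: L2)"
  obtains r where "strict_mono r" "AE x in Omega. (\<lambda>k. rep_L2 (X (r k)) x) \<longlonglongrightarrow> rep_L2 v x"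
proof -
  have "(\<lambda>n. LINT x|Omega. norm (rep_L2 (X n - v) x)) \<longlonglongrightarrow> 0"
  proof (rule tendsto_sandwich[OF _ _ tendsto_const])
    show "(\<lambda>n. norm (X n - v)) \<longlonglongrightarrow> 0"
      using assms by (simp add: LIM_zero tendsto_norm_zero)
  qed (auto intro!: always_eventually integral_abs_rep_le)
  from tendsto_L1_AE_subseq[OF integrable_square_int[OF square_int_rep] this]
  obtain r where r: "strict_mono r" "AE x in Omega. (\<lambda>n. rep_L2 (X (r n) - v) x) \<longlonglongrightarrow> 0" by blast
  have "AE x in Omega. \<forall>n. rep_L2 (X (r n) - v) x = rep_L2 (X (r n)) x - rep_L2 v x"
    unfolding AE_all_countable using rep_L2_diff by blast
  with r(2) have "AE x in Omega. (\<lambda>k. rep_L2 (X (r k)) x) \<longlonglongrightarrow> rep_L2 v x"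
    by eventually_elim (auto dest: LIM_zero_cancel)
  with r(1) show thesis by (rule that)
qed

lemma Cauchy_fast_subseq:
  fixes X :: "nat \<Rightarrow> 'a::metric_space"
  assumes "Cauchy X"
  obtains r :: "nat \<Rightarrow> nat" where "strict_mono r" "\<And>k. dist (X (r (Suc k))) (X (r k)) < (1/2) ^ k"
proof -
  have "\<exists>N. \<forall>m\<ge>N. \<forall>n\<ge>N. dist (X m) (X n) < (1/2) ^ k" for k :: nat
    using metric_CauchyD[OF assms, of "(1/2) ^ k"] by auto
  then obtain N where N: "\<And>k m n. m \<ge> N k \<Longrightarrow> n \<ge> N k \<Longrightarrow> dist (X m) (X n) < (1/2) ^ k"
    by metis
  define r where "r k = k + (\<Sum>i\<le>k. N i)" for k
  have "strict_mono r" by (simp add: strict_mono_Suc_iff r_def)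
  moreover have ge: "r k \<ge> N k" for k
    using member_le_sum[of k "{..k}" N] by (simp add: r_def)
  moreover have "r (Suc k) \<ge> r k" for k by (simp add: r_def)
  ultimately show thesis
    by (intro that[of r] N) (auto intro: order_trans)
qed

text \<open>Riesz--Fischer: a fast Cauchy sequence converges almost everywhere, because its increments
  have a summable \<open>L\<^sup>1\<close> norm, and Fatou's lemma turns this into convergence in \<open>L\<^sup>2\<close>.\<close>

instance L2 :: complete_space
proof
  fix X :: "nat \<Rightarrow> L2" assume X: "Cauchy X"
  then obtain r where r: "strict_mono r" "\<And>k. dist (X (r (Suc k))) (X (r k)) < (1/2) ^ k"
    by (rule Cauchy_fast_subseq) blast
  define d where "d k = rep_L2 (X (r (Suc k)) - X (r k))" for k
  have [measurable]: "rep_L2 v \<in> borel_measurable Omega" for v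
    using square_int_rep by (auto simp: square_int_def)
  then have [measurable]: "d k \<in> borel_measurable Omega" for k by (simp add: d_def)
  have int: "integrable Omega (d k)" for k
    unfolding d_def by (rule integrable_square_int[OF square_int_rep])
  have "(LINT x|Omega. \<bar>d k x\<bar>) \<le> (1/2) ^ k" for k
    using r(2)[of k] integral_abs_rep_le[of "X (r (Suc k)) - X (r k)"]
    by (simp add: d_def dist_norm)
  then have summ: "summable (\<lambda>k. LINT x|Omega. \<bar>d k x\<bar>)"
    by (intro summable_comparison_test[OF _ summable_geometric[of "1/2::real"]]) auto
  have "(\<integral>\<^sup>+x. (\<Sum>k. ennreal \<bar>d k x\<bar>) \<partial>Omega) = (\<Sum>k. \<integral>\<^sup>+x. ennreal \<bar>d k x\<bar> \<partial>Omega)"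
    by (rule nn_integral_suminf) measurable
  also have "\<dots> = (\<Sum>k. ennreal (LINT x|Omega. \<bar>d k x\<bar>))"
    using int by (intro suminf_cong nn_integral_eq_integral) auto
  also have "\<dots> \<noteq> \<infinity>"
    using summ by (subst suminf_ennreal2) auto
  finally have "AE x in Omega. (\<Sum>k. ennreal \<bar>d k x\<bar>) \<noteq> \<infinity>"
    by (intro nn_integral_noteq_infinite) measurable
  then have sabs: "AE x in Omega. summable (\<lambda>k. \<bar>d k x\<bar>)"
    by eventually_elim (auto intro: summable_suminf_not_top)
  define S where "S x = rep_L2 (X (r 0)) x + (\<Sum>k. d k x)" for x
  have S[measurable]: "S \<in> borel_measurable Omega" unfolding S_def by measurable
  have "AE x in Omega. \<forall>k. d k x = rep_L2 (X (r (Suc k))) x - rep_L2 (X (r k)) x"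
    unfolding AE_all_countable d_def using rep_L2_diff by blast
  with sabs have lim: "AE x in Omega. (\<lambda>j. rep_L2 (X (r j)) x) \<longlonglongrightarrow> S x"
  proof eventually_elim
    case (elim x)
    have "(\<lambda>n. \<Sum>k<n. d k x) \<longlonglongrightarrow> (\<Sum>k. d k x)"
      by (rule summable_LIMSEQ[OF summable_rabs_cancel[OF elim(1)]])
    moreover have "(\<Sum>k<n. d k x) = rep_L2 (X (r n)) x - rep_L2 (X (r 0)) x" for n
      using elim(2) by (simp add: sum_lessThan_telescope[of "\<lambda>k. rep_L2 (X (r k)) x"])
    ultimately have "(\<lambda>n. rep_L2 (X (r n)) x - rep_L2 (X (r 0)) x) \<longlonglongrightarrow> (\<Sum>k. d k x)" by simp
    from tendsto_add[OF tendsto_const[of "rep_L2 (X (r 0)) x"] this] show ?case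
      by (simp add: S_def)
  qed
  have fatou: "square_int (\<lambda>x. S x - rep_L2 (X n) x) \<and> (LINT x|Omega. (S x - rep_L2 (X n) x)\<^sup>2) \<le> e\<^sup>2"
    if n: "\<And>m. m \<ge> N \<Longrightarrow> dist (X m) (X n) < e" for n N and e :: real
  proof -
    let ?g = "\<lambda>j x. rep_L2 (X (r j)) x - rep_L2 (X n) x"
    have 1: "square_int (?g j)" for j by (intro square_int_diff square_int_rep)
    have 2: "AE x in Omega. (\<lambda>j. ?g j x) \<longlonglongrightarrow> S x - rep_L2 (X n) x"
      using lim by eventually_elim (intro tendsto_diff tendsto_const)
    have 3: "\<forall>\<^sub>F j in sequentially. (LINT x|Omega. (?g j x)\<^sup>2) \<le> e\<^sup>2 + d" if "d > 0" for d
      using eventually_ge_at_top[of N]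
    proof eventually_elim
      case (elim j)
      then have "dist (X (r j)) (X n) < e"
        using n seq_suble[OF r(1), of j] by (meson order_trans)
      moreover have "(LINT x|Omega. (?g j x)\<^sup>2) = (dist (X (r j)) (X n))\<^sup>2"
        using norm_L2_abs[OF 1[of j]] by (simp add: abs_L2_diff square_int_rep abs_rep_L2 dist_norm)
      ultimately have "(LINT x|Omega. (?g j x)\<^sup>2) \<le> e\<^sup>2" by (simp add: power_mono)
      then show ?case using that by linarith
    qed
    from fatou_square_int[OF 1 2 _ 3] show ?thesis by auto
  qed
  obtain N0 where N0: "\<And>m. m \<ge> N0 \<Longrightarrow> dist (X m) (X N0) < 1"
    using metric_CauchyD[OF X, of 1] by auto
  have "square_int (\<lambda>x. (S x - rep_L2 (X N0) x) + rep_L2 (X N0) x)"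
    using fatou[OF N0] by (intro square_int_add square_int_rep) auto
  then have Ssq: "square_int S" by simp
  have "X \<longlonglongrightarrow> abs_L2 S"
  proof (rule metric_LIMSEQ_I)
    fix e :: real assume e: "e > 0"
    then obtain N where N: "\<And>m n. m \<ge> N \<Longrightarrow> n \<ge> N \<Longrightarrow> dist (X m) (X n) < e/2"
      using metric_CauchyD[OF X, of "e/2"] by auto
    show "\<exists>N. \<forall>n\<ge>N. dist (X n) (abs_L2 S) < e"
    proof (intro exI allI impI)
      fix n assume "n \<ge> N"
      then have f: "(LINT x|Omega. (S x - rep_L2 (X n) x)\<^sup>2) \<le> (e/2)\<^sup>2"
        using fatou N by blast
      have "(dist (X n) (abs_L2 S))\<^sup>2 = (norm (abs_L2 S - X n))\<^sup>2"
        by (simp add: dist_norm norm_minus_commute)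
      also have "\<dots> = (LINT x|Omega. (S x - rep_L2 (X n) x)\<^sup>2)"
        using norm_L2_abs[OF square_int_diff[OF Ssq square_int_rep[of "X n"]]]
        by (simp add: abs_L2_diff Ssq square_int_rep abs_rep_L2)
      finally have "(dist (X n) (abs_L2 S))\<^sup>2 \<le> (e/2)\<^sup>2" using f by simp
      then have "dist (X n) (abs_L2 S) \<le> e/2"
        by (rule power2_le_imp_le) (use e in simp)
      then show "dist (X n) (abs_L2 S) < e" using e by simp
    qed
  qed
  then show "convergent X" by (rule convergentI)
qed

section \<open>Test functions\<close>

definition smooth_fun :: "(real \<Rightarrow> real) \<Rightarrow> bool" where
  "smooth_fun f \<longleftrightarrow> (\<forall>n x. ((deriv ^^ n) f) field_differentiable (at x))"

lemma smooth_fun_deriv: "smooth_fun f \<Longrightarrow> smooth_fun (deriv f)"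
  unfolding smooth_fun_def by (metis comp_apply funpow_Suc_right)

lemma smooth_fun_has_deriv: "smooth_fun f \<Longrightarrow> (f has_real_derivative deriv f x) (at x)"
  unfolding smooth_fun_def by (metis DERIV_deriv_iff_field_differentiable funpow_0)

lemma smooth_funI:
  assumes "\<And>x. (f has_real_derivative g x) (at x)" "smooth_fun g"
  shows "smooth_fun f"
proof -
  have g: "deriv f = g" using assms(1) by (auto intro: DERIV_imp_deriv)
  show ?thesis
    unfolding smooth_fun_def
  proof (intro allI)
    fix n x
    show "((deriv ^^ n) f) field_differentiable (at x)"
    proof (cases n)
      case 0
      then show ?thesis using assms(1)[of x] by (auto simp: field_differentiable_def)
    next
      case (Suc k)
      have "(deriv ^^ Suc k) f = (deriv ^^ k) g"
        by (simp only: funpow_Suc_right comp_apply g)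
      then show ?thesis using assms(2) unfolding Suc smooth_fun_def by simp
    qed
  qed
qed

lemma smooth_fun_lincomb:
  assumes "smooth_fun f" "smooth_fun g"
  shows "smooth_fun (\<lambda>x. f x + c * g x)"
    and "deriv (\<lambda>x. f x + c * g x) = (\<lambda>x. deriv f x + c * deriv g x)"
proof -
  have d: "((deriv ^^ n) f has_real_derivative (deriv ^^ Suc n) f x) (at x)"
    "((deriv ^^ n) g has_real_derivative (deriv ^^ Suc n) g x) (at x)" for n x
    using assms unfolding smooth_fun_def funpow.simps comp_apply
    by (auto simp: DERIV_deriv_iff_field_differentiable)
  have *: "(deriv ^^ n) (\<lambda>x. f x + c * g x) = (\<lambda>x. (deriv ^^ n) f x + c * (deriv ^^ n) g x)" for n
  proof (induction n)
    case (Suc n)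
    show ?case
    proof
      fix x
      have "(deriv ^^ Suc n) (\<lambda>x. f x + c * g x) x
          = deriv (\<lambda>x. (deriv ^^ n) f x + c * (deriv ^^ n) g x) x"
        using Suc by simp
      also have "\<dots> = (deriv ^^ Suc n) f x + c * (deriv ^^ Suc n) g x"
        by (intro DERIV_imp_deriv DERIV_add DERIV_cmult d)
      finally show "(deriv ^^ Suc n) (\<lambda>x. f x + c * g x) x
          = (deriv ^^ Suc n) f x + c * (deriv ^^ Suc n) g x" .
    qed
  qed simp
  show "smooth_fun (\<lambda>x. f x + c * g x)"
    unfolding smooth_fun_def *
  proof (intro allI)
    fix n x
    show "(\<lambda>x. (deriv ^^ n) f x + c * (deriv ^^ n) g x) field_differentiable at x"
      unfolding field_differentiable_def using DERIV_add[OF d(1) DERIV_cmult[OF d(2)]] by blast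
  qed
  show "deriv (\<lambda>x. f x + c * g x) = (\<lambda>x. deriv f x + c * deriv g x)"
    using *[of 1] by simp
qed

lemma smooth_fun_rescale:
  assumes "smooth_fun f"
  shows "smooth_fun (\<lambda>x. f (c * x))"
    and "deriv (\<lambda>x. f (c * x)) = (\<lambda>x. c * deriv f (c * x))"
proof -
  have d: "((deriv ^^ n) f has_real_derivative (deriv ^^ Suc n) f x) (at x)" for n x
    using assms unfolding smooth_fun_def funpow.simps comp_apply
    by (auto simp: DERIV_deriv_iff_field_differentiable)
  have dd: "((\<lambda>x. c ^ n * (deriv ^^ n) f (c * x)) has_real_derivative c ^ Suc n * (deriv ^^ Suc n) f (c * x)) (at x)" for n x
  proof -
    have "((\<lambda>x. c * x) has_real_derivative c) (at x)"
      by (auto intro!: derivative_eq_intros)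
    from DERIV_cmult[OF DERIV_chain2[OF d this], of "c ^ n" n] show ?thesis by (simp add: mult_ac)
  qed
  have *: "(deriv ^^ n) (\<lambda>x. f (c * x)) = (\<lambda>x. c ^ n * (deriv ^^ n) f (c * x))" for n
  proof (induction n)
    case (Suc n)
    then have "(deriv ^^ Suc n) (\<lambda>x. f (c * x)) = deriv (\<lambda>x. c ^ n * (deriv ^^ n) f (c * x))"
      by simp
    also have "\<dots> = (\<lambda>x. c ^ Suc n * (deriv ^^ Suc n) f (c * x))"
      by (intro ext DERIV_imp_deriv dd)
    finally show ?case .
  qed simp
  show "smooth_fun (\<lambda>x. f (c * x))"
    unfolding smooth_fun_def * field_differentiable_def using dd by blast
  show "deriv (\<lambda>x. f (c * x)) = (\<lambda>x. c * deriv f (c * x))"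
    using *[of 1] by simp
qed

lemma test_fun_smooth: "test_fun a b \<psi> \<Longrightarrow> smooth_fun \<psi>"
  by (simp add: test_fun_def smooth_fun_def)

lemma test_fun_has_deriv: "test_fun a b \<psi> \<Longrightarrow> (\<psi> has_real_derivative deriv \<psi> x) (at x)"
  by (rule smooth_fun_has_deriv[OF test_fun_smooth])

lemma test_fun_support:
  assumes "test_fun a b \<psi>"
  obtains c d where "a < c" "d < b" "\<And>x. x < c \<or> d < x \<Longrightarrow> \<psi> x = 0"
  using assms unfolding test_fun_def by (metis atLeastAtMost_iff linorder_not_less)

lemma test_funI:
  "smooth_fun \<psi> \<Longrightarrow> a < c \<Longrightarrow> d < b \<Longrightarrow> (\<And>x. x < c \<or> d < x \<Longrightarrow> \<psi> x = 0) \<Longrightarrow> test_fun a b \<psi>"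
  unfolding test_fun_def smooth_fun_def by (metis atLeastAtMost_iff linorder_not_less)

lemma test_fun_deriv:
  assumes "test_fun a b \<psi>"
  shows "test_fun a b (deriv \<psi>)"
proof -
  obtain c d where cd: "a < c" "d < b" "\<And>x. x < c \<or> d < x \<Longrightarrow> \<psi> x = 0"
    using assms by (rule test_fun_support) blast
  have "deriv \<psi> x = 0" if "x < c \<or> d < x" for x
  proof (rule DERIV_imp_deriv)
    have "\<forall>\<^sub>F y in nhds x. y \<in> {..<c} \<union> {d<..}"
      using that by (intro eventually_nhds_in_open) auto
    then have "\<forall>\<^sub>F y in nhds x. \<psi> y = 0" by eventually_elim (auto intro: cd)
    then show "(\<psi> has_real_derivative 0) (at x)"
      by (subst DERIV_cong_ev[OF refl _ refl, of _ "\<lambda>_. 0"]) auto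
  qed
  then show ?thesis
    using cd by (intro test_funI[OF smooth_fun_deriv[OF test_fun_smooth[OF assms]], of a c d]) auto
qed

lemma test_fun_continuous: "test_fun a b \<psi> \<Longrightarrow> continuous_on S \<psi>"
  by (meson DERIV_isCont continuous_at_imp_continuous_on test_fun_has_deriv)

lemma test_fun_lincomb:
  assumes "test_fun a b \<psi>" "test_fun a b \<xi>"
  shows "test_fun a b (\<lambda>x. \<psi> x + k * \<xi> x)"
proof -
  obtain c d where cd: "a < c" "d < b" "\<And>x. x < c \<or> d < x \<Longrightarrow> \<psi> x = 0"
    using assms(1) by (rule test_fun_support) blast
  obtain c' d' where cd': "a < c'" "d' < b" "\<And>x. x < c' \<or> d' < x \<Longrightarrow> \<xi> x = 0"
    using assms(2) by (rule test_fun_support) blast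
  show ?thesis
  proof (rule test_funI)
    show "smooth_fun (\<lambda>x. \<psi> x + k * \<xi> x)"
      by (rule smooth_fun_lincomb[OF test_fun_smooth[OF assms(1)] test_fun_smooth[OF assms(2)]])
    show "a < min c c'" "max d d' < b" using cd cd' by auto
    show "\<psi> x + k * \<xi> x = 0" if "x < min c c' \<or> max d d' < x" for x
      using that cd(3)[of x] cd'(3)[of x] by auto
  qed
qed

lemma continuous_integral_Ioo:
  fixes f :: "real \<Rightarrow> real"
  assumes "continuous_on {a..b} f"
  shows "integrable (lebesgue_on {a<..<b}) f"
    and "(LINT x|lebesgue_on {a<..<b}. f x) = integral {a..b} f"
proof -
  have "f absolutely_integrable_on {a<..<b}"
    by (rule set_integrable_subset[OF absolutely_integrable_continuous_real[OF assms]]) auto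
  then show i: "integrable (lebesgue_on {a<..<b}) f"
    by (rule absolutely_integrable_imp_integrable) simp
  show "(LINT x|lebesgue_on {a<..<b}. f x) = integral {a..b} f"
    by (subst lebesgue_integral_eq_integral[OF i]) (simp_all add: integral_open_interval_real)
qed

lemma continuous_square_int:
  assumes "continuous_on {0..1} f"
  shows "square_int f"
  using continuous_integral_Ioo(1)[OF assms]
    continuous_integral_Ioo(1)[OF continuous_on_power[OF assms], of 2]
  by (auto simp: square_int_def)

lemma test_fun_square_int: "test_fun a b \<psi> \<Longrightarrow> square_int \<psi>"
  by (rule continuous_square_int[OF test_fun_continuous])

text \<open>The integral from \<open>a\<close> vanishes to the left of the support and, because the total integral is
  zero, also to the right of it.\<close>

lemma test_fun_primitive:
  assumes \<xi>: "test_fun a b \<xi>" and "a < b" and int: "(LINT x|lebesgue_on {a<..<b}. \<xi> x) = 0"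
  obtains \<psi> where "test_fun a b \<psi>" "deriv \<psi> = \<xi>"
proof -
  obtain c d where cd: "a < c" "d < b" "\<And>x. x < c \<or> d < x \<Longrightarrow> \<xi> x = 0"
    using \<xi> by (rule test_fun_support) blast
  have cont: "continuous_on S \<xi>" for S using \<xi> by (rule test_fun_continuous)
  then have ii: "\<xi> integrable_on {x..y}" for x y by (intro integrable_continuous_real)
  define F where "F x = integral {a..x} \<xi>" for x
  have F0: "F x = 0" if "x < c" for x
    unfolding F_def by (rule trans[OF integral_cong[where g = "\<lambda>_. 0"]]) (use that cd in auto)
  have der: "(F has_real_derivative \<xi> x) (at x)" for x
  proof (cases "x < c")
    case True
    then have "\<forall>\<^sub>F y in nhds x. y \<in> {..<c}"
      by (intro eventually_nhds_in_open) auto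
    then have "\<forall>\<^sub>F y in nhds x. F y = 0" by eventually_elim (auto intro: F0)
    moreover have "\<xi> x = 0" using True cd by auto
    ultimately show ?thesis
      by (subst DERIV_cong_ev[OF refl _ refl, of _ "\<lambda>_. 0"]) auto
  next
    case False
    then have "(F has_real_derivative \<xi> x) (at x within {a..x + 1})"
      unfolding F_def using cd by (intro integral_has_real_derivative cont) auto
    moreover have "at x within {a..x + 1} = at x"
      using False cd by (intro at_within_interior) auto
    ultimately show ?thesis by simp
  qed
  have tot: "F b = 0"
    using int continuous_integral_Ioo(2)[OF cont] by (simp add: F_def)
  have F1: "F x = 0" if "d < x" for x
  proof -
    have z: "integral {y..z} \<xi> = 0" if "d < y" for y z
      by (rule trans[OF integral_cong[where g = "\<lambda>_. 0"]]) (use that cd in auto)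
    consider "x < a" | "a \<le> x" "x \<le> b" | "b < x" by linarith
    then show ?thesis
    proof cases
      case 1 then show ?thesis by (simp add: F_def)
    next
      case 2
      have "F x + integral {x..b} \<xi> = F b"
        unfolding F_def using 2 by (intro Henstock_Kurzweil_Integration.integral_combine ii)
      with tot z[OF that] show ?thesis by simp
    next
      case 3
      have "F b + integral {b..x} \<xi> = F x"
        unfolding F_def using 3 \<open>a < b\<close> by (intro Henstock_Kurzweil_Integration.integral_combine ii) auto
      with tot z[OF cd(2)] show ?thesis by simp
    qed
  qed
  have "test_fun a b F"
    using F0 F1 cd by (intro test_funI[OF smooth_funI[OF der test_fun_smooth[OF \<xi>]], of a c d]) auto
  moreover have "deriv F = \<xi>" using der by (auto intro: DERIV_imp_deriv)
  ultimately show thesis by (rule that)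
qed

section \<open>Hardy's inequality and the form domain\<close>

text \<open>There is no singularity at the origin, since a test function vanishes near it; the value of the
  quotient at \<open>0\<close> is \<open>0\<close>.\<close>

lemma test_fun_div_continuous:
  assumes "test_fun 0 1 \<psi>"
  shows "continuous_on S (\<lambda>x. \<psi> x / x)"
proof -
  obtain c d where cd: "0 < c" "d < 1" "\<And>x. x < c \<or> d < x \<Longrightarrow> \<psi> x = 0"
    using assms by (rule test_fun_support) blast
  have "isCont (\<lambda>x. \<psi> x / x) x" for x
  proof (cases "x < c")
    case True
    then have "\<forall>\<^sub>F y in nhds x. y \<in> {..<c}"
      by (intro eventually_nhds_in_open) auto
    then have "\<forall>\<^sub>F y in nhds x. \<psi> y / y = 0" by eventually_elim (auto simp: cd)
    then show ?thesis by (subst isCont_cong[of _ "\<lambda>_. 0"]) auto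
  next
    case False
    with cd(1) have "x \<noteq> 0" by auto
    then show ?thesis
      using DERIV_isCont[OF test_fun_has_deriv[OF assms]] by (intro continuous_intros) auto
  qed
  then show ?thesis by (simp add: continuous_at_imp_continuous_on)
qed

text \<open>With \<open>h = 2 \<psi>' \<psi> / x - \<psi>\<^sup>2 / x\<^sup>2\<close>, the derivative of \<open>\<psi>\<^sup>2 / x\<close>, one has
  \<open>\<psi>'\<^sup>2 - \<psi>\<^sup>2 / (4 x\<^sup>2) = (\<psi>' - \<psi> / (2 x))\<^sup>2 + h / 2\<close>, and the integral of \<open>h\<close> vanishes because
  \<open>\<psi>\<close> vanishes near both end points.\<close>

lemma hardy_test_fun:
  assumes "test_fun 0 1 \<psi>"
  shows "square_int (\<lambda>x. \<psi> x / x)"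
    and "(LINT x|Omega. (\<psi> x / x)\<^sup>2) \<le> 4 * (LINT x|Omega. (deriv \<psi> x)\<^sup>2)"
proof -
  obtain c d where cd: "0 < c" "d < 1" "\<And>x. x < c \<or> d < x \<Longrightarrow> \<psi> x = 0"
    using assms by (rule test_fun_support) blast
  have c1: "continuous_on {0..1} (\<lambda>x. \<psi> x / x)" by (rule test_fun_div_continuous[OF assms])
  have c2: "continuous_on {0..1} (deriv \<psi>)" by (rule test_fun_continuous[OF test_fun_deriv[OF assms]])
  show "square_int (\<lambda>x. \<psi> x / x)" by (rule continuous_square_int[OF c1])
  define h where "h x = 2 * deriv \<psi> x * (\<psi> x / x) - (\<psi> x / x)\<^sup>2" for x
  have der: "((\<lambda>x. (\<psi> x)\<^sup>2 / x) has_real_derivative h x) (at x)" for x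
  proof (cases "x < c")
    case True
    then have "\<forall>\<^sub>F y in nhds x. y \<in> {..<c}"
      by (intro eventually_nhds_in_open) auto
    then have "\<forall>\<^sub>F y in nhds x. (\<psi> y)\<^sup>2 / y = 0" by eventually_elim (auto simp: cd)
    moreover have "h x = 0" using True cd by (auto simp: h_def)
    ultimately show ?thesis
      by (subst DERIV_cong_ev[OF refl _ refl, of _ "\<lambda>_. 0"]) auto
  next
    case False
    with cd(1) have "x \<noteq> 0" by auto
    then show ?thesis
      by (auto intro!: derivative_eq_intros test_fun_has_deriv[OF assms]
          simp: h_def field_simps power2_eq_square)
  qed
  have "(h has_integral (\<psi> 1)\<^sup>2 / 1 - (\<psi> 0)\<^sup>2 / 0) {0..1}"
    using der by (intro fundamental_theorem_of_calculus)
      (auto simp: has_real_derivative_iff_has_vector_derivative[symmetric] intro: has_field_derivative_at_within)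
  then have h: "(h has_integral 0) {0..1}" using cd by simp
  have "((\<lambda>x. (deriv \<psi> x)\<^sup>2 - (\<psi> x / x)\<^sup>2 / 4 - h x / 2) has_integral
      (integral {0..1} (\<lambda>x. (deriv \<psi> x)\<^sup>2) - integral {0..1} (\<lambda>x. (\<psi> x / x)\<^sup>2) / 4 - 0 / 2)) {0..1}"
    using c1 c2 by (intro has_integral_diff has_integral_divide h integrable_integral
        integrable_continuous_real continuous_on_power)
  moreover have "(\<lambda>x. (deriv \<psi> x)\<^sup>2 - (\<psi> x / x)\<^sup>2 / 4 - h x / 2) = (\<lambda>x. (deriv \<psi> x - (\<psi> x / x) / 2)\<^sup>2)"
  proof -
    have "A\<^sup>2 - t\<^sup>2 / 4 - (2 * A * t - t\<^sup>2) / 2 = (A - t / 2)\<^sup>2" for A t :: real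
      by (simp add: field_simps power2_eq_square)
    then show ?thesis unfolding h_def by blast
  qed
  ultimately have "((\<lambda>x. (deriv \<psi> x - (\<psi> x / x) / 2)\<^sup>2) has_integral
      (integral {0..1} (\<lambda>x. (deriv \<psi> x)\<^sup>2) - integral {0..1} (\<lambda>x. (\<psi> x / x)\<^sup>2) / 4 - 0 / 2)) {0..1}"
    by simp
  from has_integral_nonneg[OF this]
  have "0 \<le> integral {0..1} (\<lambda>x. (deriv \<psi> x)\<^sup>2) - integral {0..1} (\<lambda>x. (\<psi> x / x)\<^sup>2) / 4"
    by simp
  moreover have "(LINT x|Omega. (\<psi> x / x)\<^sup>2) = integral {0..1} (\<lambda>x. (\<psi> x / x)\<^sup>2)"
    "(LINT x|Omega. (deriv \<psi> x)\<^sup>2) = integral {0..1} (\<lambda>x. (deriv \<psi> x)\<^sup>2)"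
    using c1 c2 by (auto intro!: continuous_integral_Ioo continuous_on_power)
  ultimately show "(LINT x|Omega. (\<psi> x / x)\<^sup>2) \<le> 4 * (LINT x|Omega. (deriv \<psi> x)\<^sup>2)" by linarith
qed


lemma has_weak_deriv_iff:
  "has_weak_deriv v g \<longleftrightarrow> (\<forall>\<psi>. test_fun 0 1 \<psi> \<longrightarrow> v \<bullet> abs_L2 (deriv \<psi>) = - (g \<bullet> abs_L2 \<psi>))"
  unfolding has_weak_deriv_def
  by (auto simp: inner_L2_abs_right test_fun_square_int[of 0 1] test_fun_square_int[OF test_fun_deriv, of 0 1])

lemma has_weak_deriv_lincomb:
  "has_weak_deriv v g \<Longrightarrow> has_weak_deriv w h \<Longrightarrow> has_weak_deriv (v + c *\<^sub>R w) (g + c *\<^sub>R h)"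
  by (simp add: has_weak_deriv_iff inner_add_left)

lemma has_weak_deriv_closed:
  assumes "\<And>k. has_weak_deriv (V k) (G k)" "V \<longlonglongrightarrow> v" "G \<longlonglongrightarrow> g"
  shows "has_weak_deriv v g"
  unfolding has_weak_deriv_iff
proof (intro allI impI)
  fix \<psi> assume \<psi>: "test_fun 0 1 \<psi>"
  have "(\<lambda>k. V k \<bullet> abs_L2 (deriv \<psi>)) \<longlonglongrightarrow> v \<bullet> abs_L2 (deriv \<psi>)"
    "(\<lambda>k. - (G k \<bullet> abs_L2 \<psi>)) \<longlonglongrightarrow> - (g \<bullet> abs_L2 \<psi>)"
    using assms by (auto intro!: tendsto_intros)
  moreover have "V k \<bullet> abs_L2 (deriv \<psi>) = - (G k \<bullet> abs_L2 \<psi>)" for k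
    using assms(1) \<psi> by (simp add: has_weak_deriv_iff)
  ultimately show "v \<bullet> abs_L2 (deriv \<psi>) = - (g \<bullet> abs_L2 \<psi>)"
    by (metis (no_types, lifting) LIMSEQ_unique ext)
qed

locale singular_op =
  fixes \<mu> :: real and \<phi> :: "nat \<Rightarrow> L2" and lam :: "nat \<Rightarrow> real"
  assumes mu: "\<mu> < 1 / 4" and eb: "eigenbasis \<mu> \<phi> lam"
begin

sublocale hilbert_basis \<phi>
  using eb by unfold_locales (auto simp: eigenbasis_def)

lemma lam_pos: "lam n > 0"
  using eb unfolding eigenbasis_def by (metis incseqD less_le_trans zero_le)

lemma phi_H01: "\<phi> n \<in> H01"
  using eb by (auto simp: eigenbasis_def op_L_def)

lemma form_phi: "w \<in> H01 \<Longrightarrow> form_a \<mu> (\<phi> n) w = lam n * (\<phi> n \<bullet> w)"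
  using eb by (auto simp: eigenbasis_def op_L_def)

text \<open>Every eigenfunction is a limit of test functions, being an element of \<open>H01\<close>, and the
  eigenfunctions are total.\<close>

lemma test_fun_dense:
  assumes "\<And>\<psi>. test_fun 0 1 \<psi> \<Longrightarrow> v \<bullet> abs_L2 \<psi> = 0"
  shows "v = 0"
proof (rule dense_orthogonal)
  fix n
  from phi_H01[of n] obtain \<psi> where \<psi>: "\<And>k. test_fun 0 1 (\<psi> k)" "(\<lambda>k::nat. abs_L2 (\<psi> k)) \<longlonglongrightarrow> \<phi> n"
    unfolding H01_def by auto
  have "(\<lambda>k. v \<bullet> abs_L2 (\<psi> k)) \<longlonglongrightarrow> v \<bullet> \<phi> n"
    by (intro tendsto_inner tendsto_const \<psi>)
  then have "(\<lambda>k::nat. 0 :: real) \<longlonglongrightarrow> v \<bullet> \<phi> n"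
    by (simp add: assms \<psi>)
  then show "v \<bullet> \<phi> n = 0"
    by (simp add: LIMSEQ_const_iff)
qed

text \<open>Uniqueness of weak derivatives, which makes the definite description in \<open>weak_deriv\<close> meaningful.\<close>

lemma weak_deriv_eqI:
  assumes "has_weak_deriv v g"
  shows "weak_deriv v = g"
  unfolding weak_deriv_def
proof (rule the_equality[of "has_weak_deriv v", OF assms])
  fix h assume h: "has_weak_deriv v h"
  have "h - g = 0"
  proof (rule test_fun_dense)
    fix \<psi> assume "test_fun 0 1 \<psi>"
    with assms h have "h \<bullet> abs_L2 \<psi> = g \<bullet> abs_L2 \<psi>"
      unfolding has_weak_deriv_iff by (metis neg_equal_iff_equal)
    then show "(h - g) \<bullet> abs_L2 \<psi> = 0" by (simp add: inner_diff_left)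
  qed
  then show "h = g" by simp
qed

lemma H01_I:
  assumes "has_weak_deriv v g" "\<And>k. test_fun 0 1 (\<psi> k)"
    "(\<lambda>k::nat. abs_L2 (\<psi> k)) \<longlonglongrightarrow> v" "(\<lambda>k. abs_L2 (deriv (\<psi> k))) \<longlonglongrightarrow> g"
  shows "v \<in> H01" "weak_deriv v = g"
  using assms weak_deriv_eqI[OF assms(1)] unfolding H01_def H1_def by auto

lemma H01_E:
  assumes "v \<in> H01"
  obtains \<psi> where "\<And>k. test_fun 0 1 (\<psi> k)" "(\<lambda>k::nat. abs_L2 (\<psi> k)) \<longlonglongrightarrow> v"
    "(\<lambda>k. abs_L2 (deriv (\<psi> k))) \<longlonglongrightarrow> weak_deriv v" "has_weak_deriv v (weak_deriv v)"
  using assms weak_deriv_eqI unfolding H01_def H1_def by blast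

lemma H01_lincomb:
  assumes "v \<in> H01" "w \<in> H01"
  shows "v + c *\<^sub>R w \<in> H01" "weak_deriv (v + c *\<^sub>R w) = weak_deriv v + c *\<^sub>R weak_deriv w"
proof -
  obtain \<psi> where \<psi>: "\<And>k. test_fun 0 1 (\<psi> k)" "(\<lambda>k::nat. abs_L2 (\<psi> k)) \<longlonglongrightarrow> v"
    "(\<lambda>k. abs_L2 (deriv (\<psi> k))) \<longlonglongrightarrow> weak_deriv v" "has_weak_deriv v (weak_deriv v)"
    using assms(1) by (rule H01_E) blast
  obtain \<xi> where \<xi>: "\<And>k. test_fun 0 1 (\<xi> k)" "(\<lambda>k::nat. abs_L2 (\<xi> k)) \<longlonglongrightarrow> w"
    "(\<lambda>k. abs_L2 (deriv (\<xi> k))) \<longlonglongrightarrow> weak_deriv w" "has_weak_deriv w (weak_deriv w)"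
    using assms(2) by (rule H01_E) blast
  have abs: "abs_L2 (\<lambda>x. \<psi>' x + c * \<xi>' x) = abs_L2 \<psi>' + c *\<^sub>R abs_L2 \<xi>'"
    if "test_fun 0 1 \<psi>'" "test_fun 0 1 \<xi>'" for \<psi>' \<xi>'
    using that by (simp add: abs_L2_add abs_L2_scale square_int_scale test_fun_square_int[of 0 1])
  have d: "deriv (\<lambda>x. \<psi> k x + c * \<xi> k x) = (\<lambda>x. deriv (\<psi> k) x + c * deriv (\<xi> k) x)" for k
    using \<psi>(1) \<xi>(1) by (intro smooth_fun_lincomb test_fun_smooth)
  have "has_weak_deriv (v + c *\<^sub>R w) (weak_deriv v + c *\<^sub>R weak_deriv w)"
    using \<psi>(4) \<xi>(4) by (rule has_weak_deriv_lincomb)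
  moreover have "test_fun 0 1 (\<lambda>x. \<psi> k x + c * \<xi> k x)" for k
    by (intro test_fun_lincomb \<psi> \<xi>)
  moreover have "(\<lambda>k. abs_L2 (\<lambda>x. \<psi> k x + c * \<xi> k x)) \<longlonglongrightarrow> v + c *\<^sub>R w"
    unfolding abs[OF \<psi>(1) \<xi>(1)] by (intro tendsto_intros \<psi> \<xi>)
  moreover have "(\<lambda>k. abs_L2 (deriv (\<lambda>x. \<psi> k x + c * \<xi> k x))) \<longlonglongrightarrow> weak_deriv v + c *\<^sub>R weak_deriv w"
    unfolding d abs[OF test_fun_deriv[OF \<psi>(1)] test_fun_deriv[OF \<xi>(1)]] by (intro tendsto_intros \<psi> \<xi>)
  ultimately show "v + c *\<^sub>R w \<in> H01" "weak_deriv (v + c *\<^sub>R w) = weak_deriv v + c *\<^sub>R weak_deriv w"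
    by (rule H01_I)+
qed

text \<open>A diagonal argument: each \<open>V k\<close> is replaced by a test function that is close to it together with
  the derivative.\<close>

lemma H01_closed:
  assumes V: "\<And>k. V k \<in> H01" "V \<longlonglongrightarrow> v" "(\<lambda>k. weak_deriv (V k)) \<longlonglongrightarrow> g"
  shows "v \<in> H01"
proof -
  have "\<exists>\<psi>. test_fun 0 1 \<psi> \<and> norm (abs_L2 \<psi> - V k) < inverse (Suc k)
      \<and> norm (abs_L2 (deriv \<psi>) - weak_deriv (V k)) < inverse (Suc k)" for k
  proof -
    obtain \<psi> where \<psi>: "\<And>j. test_fun 0 1 (\<psi> j)" "(\<lambda>j::nat. abs_L2 (\<psi> j)) \<longlonglongrightarrow> V k"
      "(\<lambda>j. abs_L2 (deriv (\<psi> j))) \<longlonglongrightarrow> weak_deriv (V k)"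
      using V(1) by (rule H01_E) blast
    have pos: "inverse (real (Suc k)) > 0" by simp
    have "\<forall>\<^sub>F j in sequentially. norm (abs_L2 (\<psi> j) - V k) < inverse (Suc k)
      \<and> norm (abs_L2 (deriv (\<psi> j)) - weak_deriv (V k)) < inverse (Suc k)"
      using tendstoD[OF \<psi>(2) pos] tendstoD[OF \<psi>(3) pos] unfolding dist_norm
      by eventually_elim simp
    then obtain j where "norm (abs_L2 (\<psi> j) - V k) < inverse (Suc k)
      \<and> norm (abs_L2 (deriv (\<psi> j)) - weak_deriv (V k)) < inverse (Suc k)"
      by (auto simp: eventually_sequentially)
    with \<psi>(1) show ?thesis by blast
  qed
  then obtain \<psi> where \<psi>: "\<And>k. test_fun 0 1 (\<psi> k)"
    "\<And>k. norm (abs_L2 (\<psi> k) - V k) < inverse (Suc k)"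
    "\<And>k. norm (abs_L2 (deriv (\<psi> k)) - weak_deriv (V k)) < inverse (Suc k)"
    by metis
  have lim: "A \<longlonglongrightarrow> a" if "\<And>k. norm (A k - B k) < inverse (Suc k)" "B \<longlonglongrightarrow> a" for A B :: "nat \<Rightarrow> L2" and a
  proof -
    have "(\<lambda>k. A k - B k) \<longlonglongrightarrow> 0"
      by (rule Lim_null_comparison[OF _ LIMSEQ_inverse_real_of_nat])
        (intro always_eventually allI less_imp_le that(1))
    from tendsto_add[OF this that(2)] show ?thesis by simp
  qed
  have "has_weak_deriv (V k) (weak_deriv (V k))" for k
    using V(1) by (rule H01_E) blast
  then have "has_weak_deriv v g"
    using V(2,3) by (rule has_weak_deriv_closed)
  then show "v \<in> H01"
    using \<psi>(1) lim[OF \<psi>(2) V(2)] lim[OF \<psi>(3) V(3)] by (rule H01_I)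
qed

text \<open>The quotient \<open>v / x\<close> as an element of \<open>L\<^sup>2\<close>. It turns the singular part of the form into an
  inner product, so that bilinearity of the form on \<open>H01\<close> becomes evident.\<close>

definition hardy_quot :: "L2 \<Rightarrow> L2" where
  "hardy_quot v = abs_L2 (\<lambda>x. rep_L2 v x / x)"

text \<open>Approximating test functions converge almost everywhere along a subsequence, so that Fatou's lemma
  applies to \<open>\<psi> / x\<close>.\<close>

lemma hardy_H01:
  assumes "v \<in> H01"
  shows "square_int (\<lambda>x. rep_L2 v x / x)"
    and "(norm (hardy_quot v))\<^sup>2 \<le> 4 * (norm (weak_deriv v))\<^sup>2"
proof -
  obtain \<psi> where \<psi>: "\<And>k. test_fun 0 1 (\<psi> k)" "(\<lambda>k::nat. abs_L2 (\<psi> k)) \<longlonglongrightarrow> v"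
    "(\<lambda>k. abs_L2 (deriv (\<psi> k))) \<longlonglongrightarrow> weak_deriv v"
    using assms by (rule H01_E) blast
  obtain r where r: "strict_mono r" "AE x in Omega. (\<lambda>k. rep_L2 (abs_L2 (\<psi> (r k))) x) \<longlonglongrightarrow> rep_L2 v x"
    using \<psi>(2) by (rule L2_tendsto_AE_subseq) blast
  have "AE x in Omega. \<forall>k. rep_L2 (abs_L2 (\<psi> k)) x = \<psi> k x"
    unfolding AE_all_countable using rep_abs_L2[OF test_fun_square_int[OF \<psi>(1)]] by blast
  with r(2) have ae: "AE x in Omega. (\<lambda>k. \<psi> (r k) x / x) \<longlonglongrightarrow> rep_L2 v x / x"
    by eventually_elim (auto simp: divide_inverse intro!: tendsto_mult_right)
  have meas: "(\<lambda>x. rep_L2 v x / x) \<in> borel_measurable Omega"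
  proof -
    have [measurable]: "rep_L2 v \<in> borel_measurable Omega"
      using square_int_rep by (auto simp: square_int_def)
    have [measurable]: "(\<lambda>x. x) \<in> borel_measurable Omega"
      by (intro measurable_restrict_space1) (simp add: measurable_completion)
    show ?thesis by measurable
  qed
  have bd: "\<forall>\<^sub>F k in sequentially. (LINT x|Omega. (\<psi> (r k) x / x)\<^sup>2) \<le> 4 * (norm (weak_deriv v))\<^sup>2 + e"
    if "e > 0" for e
  proof -
    have "(\<lambda>k. 4 * (norm (abs_L2 (deriv (\<psi> (r k)))))\<^sup>2) \<longlonglongrightarrow> 4 * (norm (weak_deriv v))\<^sup>2"
      using LIMSEQ_subseq_LIMSEQ[OF \<psi>(3) r(1)] by (auto intro!: tendsto_intros simp: o_def)
    then have "\<forall>\<^sub>F k in sequentially. 4 * (norm (abs_L2 (deriv (\<psi> (r k)))))\<^sup>2 < 4 * (norm (weak_deriv v))\<^sup>2 + e"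
      by (rule order_tendstoD) (use that in simp)
    then show ?thesis
    proof eventually_elim
      case (elim k)
      have "(LINT x|Omega. (\<psi> (r k) x / x)\<^sup>2) \<le> 4 * (norm (abs_L2 (deriv (\<psi> (r k)))))\<^sup>2"
        using hardy_test_fun(2)[OF \<psi>(1)]
        by (simp add: norm_L2_abs test_fun_square_int[OF test_fun_deriv[OF \<psi>(1)]])
      with elim show ?case by linarith
    qed
  qed
  note f = fatou_square_int[OF hardy_test_fun(1)[OF \<psi>(1)] ae meas bd]
  show "square_int (\<lambda>x. rep_L2 v x / x)" by (rule f)
  then show "(norm (hardy_quot v))\<^sup>2 \<le> 4 * (norm (weak_deriv v))\<^sup>2"
    using f(2) by (simp add: hardy_quot_def norm_L2_abs)
qed

lemma hardy_quot_lincomb: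
  assumes "v \<in> H01" "w \<in> H01"
  shows "hardy_quot (v + c *\<^sub>R w) = hardy_quot v + c *\<^sub>R hardy_quot w"
proof -
  note sq = hardy_H01(1)[OF assms(1)] hardy_H01(1)[OF assms(2)]
    hardy_H01(1)[OF H01_lincomb(1)[OF assms, of c]]
  have "AE x in Omega. rep_L2 (v + c *\<^sub>R w) x / x = rep_L2 v x / x + c * (rep_L2 w x / x)"
    using rep_L2_add[of v "c *\<^sub>R w"] rep_L2_scale[of c w]
    by eventually_elim (simp add: add_divide_distrib)
  moreover have "square_int (\<lambda>x. rep_L2 v x / x + c * (rep_L2 w x / x))"
    by (intro square_int_add square_int_scale sq)
  ultimately have "hardy_quot (v + c *\<^sub>R w) = abs_L2 (\<lambda>x. rep_L2 v x / x + c * (rep_L2 w x / x))"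
    unfolding hardy_quot_def using abs_L2_eq_iff[OF sq(3)] by blast
  also have "\<dots> = hardy_quot v + c *\<^sub>R hardy_quot w"
    using sq by (simp add: abs_L2_add abs_L2_scale square_int_scale hardy_quot_def
        del: times_divide_eq_right)
  finally show ?thesis .
qed

lemma form_a_eq:
  assumes "v \<in> H01" "w \<in> H01"
  shows "form_a \<mu> v w = weak_deriv v \<bullet> weak_deriv w - \<mu> * (hardy_quot v \<bullet> hardy_quot w)"
  using hardy_H01(1)[OF assms(1)] hardy_H01(1)[OF assms(2)]
  by (simp add: form_a_def inner_L2_rep[of "weak_deriv v"] hardy_quot_def inner_L2_abs power2_eq_square)

lemma form_a_sym: "form_a \<mu> v w = form_a \<mu> w v"
  by (simp add: form_a_def mult.commute)

lemma form_a_lincomb: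
  assumes "v \<in> H01" "w \<in> H01" "z \<in> H01"
  shows "form_a \<mu> (v + c *\<^sub>R w) z = form_a \<mu> v z + c * form_a \<mu> w z"
  using assms
  by (simp add: form_a_eq H01_lincomb hardy_quot_lincomb inner_add_left algebra_simps)

text \<open>The maximum covers negative \<open>\<mu>\<close>, for which the singular term has the good sign. The factor is
  positive exactly if \<open>\<mu> < 1 / 4\<close>.\<close>

lemma form_a_coercive:
  assumes "v \<in> H01"
  shows "form_a \<mu> v v \<ge> (1 - 4 * max \<mu> 0) * (norm (weak_deriv v))\<^sup>2"
proof -
  have "\<mu> * (norm (hardy_quot v))\<^sup>2 \<le> max \<mu> 0 * (norm (hardy_quot v))\<^sup>2"
    by (intro mult_right_mono) auto
  also have "\<dots> \<le> max \<mu> 0 * (4 * (norm (weak_deriv v))\<^sup>2)"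
    by (intro mult_left_mono hardy_H01 assms) auto
  finally show ?thesis
    by (simp add: form_a_eq assms power2_norm_eq_inner algebra_simps)
qed

lemma H01_zero: "0 \<in> H01"
  using H01_lincomb(1)[OF phi_H01 phi_H01, of 0 "-1" 0] by simp

lemma H01_sum:
  assumes "finite F"
  shows "(\<Sum>n\<in>F. c n *\<^sub>R \<phi> n) \<in> H01"
    and "z \<in> H01 \<Longrightarrow> form_a \<mu> (\<Sum>n\<in>F. c n *\<^sub>R \<phi> n) z = (\<Sum>n\<in>F. c n * (lam n * (\<phi> n \<bullet> z)))"
proof -
  have "(\<Sum>n\<in>F. c n *\<^sub>R \<phi> n) \<in> H01 \<and>
      (z \<in> H01 \<longrightarrow> form_a \<mu> (\<Sum>n\<in>F. c n *\<^sub>R \<phi> n) z = (\<Sum>n\<in>F. c n * (lam n * (\<phi> n \<bullet> z))))"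
    using assms
  proof (induction F rule: finite_induct)
    case empty
    have "form_a \<mu> 0 z = 0" if "z \<in> H01"
      using form_a_lincomb[OF H01_zero H01_zero that, of 1] by simp
    then show ?case by (simp add: H01_zero)
  next
    case (insert n F)
    then have eq: "(\<Sum>i\<in>insert n F. c i *\<^sub>R \<phi> i) = (\<Sum>i\<in>F. c i *\<^sub>R \<phi> i) + c n *\<^sub>R \<phi> n"
      by simp
    show ?case
      unfolding eq using insert by (simp add: H01_lincomb phi_H01 form_a_lincomb form_phi)
  qed
  then show "(\<Sum>n\<in>F. c n *\<^sub>R \<phi> n) \<in> H01"
    "z \<in> H01 \<Longrightarrow> form_a \<mu> (\<Sum>n\<in>F. c n *\<^sub>R \<phi> n) z = (\<Sum>n\<in>F. c n * (lam n * (\<phi> n \<bullet> z)))"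
    by auto
qed

text \<open>The square of the form norm of \<open>\<Sum> c n \<phi> n\<close> is \<open>\<Sum> lam n (c n)\<^sup>2\<close>; by coercivity, the weak
  derivatives of the partial sums of an element of the space of order one form a Cauchy sequence.\<close>

lemma Hs_1_subset_H01:
  assumes "v \<in> Hs \<phi> lam 1"
  shows "v \<in> H01"
proof -
  have summ: "summable (\<lambda>n. lam n * (v \<bullet> \<phi> n)\<^sup>2)"
    using assms lam_pos by (simp add: Hs_def less_imp_le)
  define \<kappa> where "\<kappa> = 1 - 4 * max \<mu> 0"
  have \<kappa>: "\<kappa> > 0" using mu by (simp add: \<kappa>_def max_def)
  have part: "fourier_sum N v \<in> H01" for N
    unfolding fourier_sum_def by (rule H01_sum) simp
  let ?S = "\<lambda>N. \<Sum>n<N. lam n * (v \<bullet> \<phi> n)\<^sup>2"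
  have bound: "\<kappa> * (dist (weak_deriv (fourier_sum M v)) (weak_deriv (fourier_sum N v)))\<^sup>2 \<le> \<bar>?S M - ?S N\<bar>"
    if "N \<le> M" for M N
  proof -
    let ?d = "\<Sum>n\<in>{N..<M}. (v \<bullet> \<phi> n) *\<^sub>R \<phi> n"
    have d: "fourier_sum M v + (-1) *\<^sub>R fourier_sum N v = ?d"
      unfolding fourier_sum_def using sum_diff_nat_ivl[of 0 N M "\<lambda>n. (v \<bullet> \<phi> n) *\<^sub>R \<phi> n"] that
      by (simp add: lessThan_atLeast0)
    have w: "weak_deriv ?d = weak_deriv (fourier_sum M v) - weak_deriv (fourier_sum N v)"
      using H01_lincomb(2)[OF part part, of M "-1" N] by (simp only: d) simp
    have dH: "?d \<in> H01" by (rule H01_sum) simp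
    have "\<kappa> * (norm (weak_deriv ?d))\<^sup>2 \<le> form_a \<mu> ?d ?d"
      unfolding \<kappa>_def by (rule form_a_coercive[OF dH])
    also have "\<dots> = (\<Sum>n\<in>{N..<M}. (v \<bullet> \<phi> n) * (lam n * (\<phi> n \<bullet> ?d)))"
      by (rule H01_sum(2)[OF _ dH]) simp
    also have "\<dots> = (\<Sum>n\<in>{N..<M}. lam n * (v \<bullet> \<phi> n)\<^sup>2)"
      by (intro sum.cong refl) (simp add: inner_commute[of "\<phi> _" ?d] sum_coeff power2_eq_square)
    also have "\<dots> = ?S M - ?S N"
      using sum_diff_nat_ivl[of 0 N M "\<lambda>n. lam n * (v \<bullet> \<phi> n)\<^sup>2"] that
      by (simp add: lessThan_atLeast0)
    finally show ?thesis by (simp add: w dist_norm)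
  qed
  have "Cauchy (\<lambda>N. weak_deriv (fourier_sum N v))"
  proof (rule metric_CauchyI)
    fix e :: real assume e: "e > 0"
    from summ have C: "Cauchy ?S"
      by (simp add: summable_iff_convergent convergent_Cauchy)
    have "\<kappa> * e\<^sup>2 > 0" using e \<kappa> by simp
    from metric_CauchyD[OF C this]
    obtain K where K: "\<And>m n. m \<ge> K \<Longrightarrow> n \<ge> K \<Longrightarrow> dist (?S m) (?S n) < \<kappa> * e\<^sup>2"
      by blast
    have *: "dist (weak_deriv (fourier_sum m v)) (weak_deriv (fourier_sum n v)) < e" if "K \<le> n" "n \<le> m" for m n
    proof -
      have "\<kappa> * (dist (weak_deriv (fourier_sum m v)) (weak_deriv (fourier_sum n v)))\<^sup>2 < \<kappa> * e\<^sup>2"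
        using bound[OF that(2)] K[of m n] that by (simp add: dist_real_def)
      then have "(dist (weak_deriv (fourier_sum m v)) (weak_deriv (fourier_sum n v)))\<^sup>2 < e\<^sup>2"
        using \<kappa> by simp
      then show ?thesis by (rule power2_less_imp_less) (use e in simp)
    qed
    show "\<exists>M. \<forall>m\<ge>M. \<forall>n\<ge>M. dist (weak_deriv (fourier_sum m v)) (weak_deriv (fourier_sum n v)) < e"
      using * by (metis dist_commute nle_le)
  qed
  then obtain g where "(\<lambda>N. weak_deriv (fourier_sum N v)) \<longlonglongrightarrow> g"
    using Cauchy_convergent_iff convergent_def by blast
  with part fourier_sum_tendsto show ?thesis by (rule H01_closed)
qed

lemma form_a_phi_right:
  assumes "v \<in> Hs \<phi> lam 1"
  shows "form_a \<mu> v (\<phi> n) = lam n * (v \<bullet> \<phi> n)"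
  using form_phi[OF Hs_1_subset_H01[OF assms]] form_a_sym inner_commute by metis

end

section \<open>Fractional integrals and Abel inversion\<close>

text \<open>The causal power kernel \<open>x powr \<gamma>\<close>. Its vanishing on the negative axis lets all integrals be taken
  over the whole line, where Fubini's theorem and affine substitutions apply directly.\<close>

definition power_kernel :: "real \<Rightarrow> real \<Rightarrow> real" where
  "power_kernel \<gamma> x = (if 0 < x then x powr \<gamma> else 0)"

lemma power_kernel_measurable [measurable]: "power_kernel \<gamma> \<in> borel_measurable borel"
  unfolding power_kernel_def by measurable

lemma power_kernel_nonneg: "power_kernel \<gamma> x \<ge> 0"
  by (simp add: power_kernel_def)

lemma nn_integral_power_kernel:
  assumes "\<gamma> > -1" "t \<ge> 0"
  shows "(\<integral>\<^sup>+s. ennreal (power_kernel \<gamma> (t - s) * indicator {0<..} s) \<partial>lborel) = ennreal (t powr (\<gamma> + 1) / (\<gamma> + 1))"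
proof -
  have "((\<lambda>x. x powr \<gamma>) has_integral t powr (\<gamma> + 1) / (\<gamma> + 1)) {0<..<t}"
    using has_integral_powr_from_0[OF assms] by (simp add: has_integral_Icc_iff_Ioo)
  then have "(\<integral>\<^sup>+x. ennreal (x powr \<gamma>) * indicator {0<..<t} x \<partial>lborel) = ennreal (t powr (\<gamma> + 1) / (\<gamma> + 1))"
    by (intro nn_integral_has_integral_lebesgue') auto
  moreover have "(\<integral>\<^sup>+s. ennreal (power_kernel \<gamma> (t - s) * indicator {0<..} s) \<partial>lborel)
      = (\<integral>\<^sup>+x. ennreal (x powr \<gamma>) * indicator {0<..<t} x \<partial>lborel)"
    by (subst nn_integral_real_affine[where c = "-1" and t = t])
      (auto intro!: nn_integral_cong simp: power_kernel_def indicator_def)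
  ultimately show ?thesis by simp
qed

lemma integral_power_kernel:
  assumes "\<gamma> > -1" "t \<ge> 0"
  shows "integrable lborel (\<lambda>s. power_kernel \<gamma> (t - s) * indicator {0<..} s)"
    and "(LBINT s. power_kernel \<gamma> (t - s) * indicator {0<..} s) = t powr (\<gamma> + 1) / (\<gamma> + 1)"
proof -
  show "integrable lborel (\<lambda>s. power_kernel \<gamma> (t - s) * indicator {0<..} s)"
    by (rule integrableI_nn_integral_finite[OF _ _ nn_integral_power_kernel[OF assms]])
      (auto simp: power_kernel_nonneg)
  show "(LBINT s. power_kernel \<gamma> (t - s) * indicator {0<..} s) = t powr (\<gamma> + 1) / (\<gamma> + 1)"
    using assms by (subst integral_eq_nn_integral) (auto simp: power_kernel_nonneg nn_integral_power_kernel)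
qed

text \<open>For \<open>r < t\<close> the value does not depend on \<open>r\<close> and \<open>t\<close>: the substitution
  \<open>s = r + (t - r) x\<close> turns the integral into Euler's Beta integral.\<close>

lemma nn_integral_power_kernel_mult:
  assumes "0 < \<beta>" "\<beta> < 1"
  shows "(\<integral>\<^sup>+s. ennreal (power_kernel (-\<beta>) (t - s) * power_kernel (\<beta> - 1) (s - r)) \<partial>lborel)
    = ennreal (Beta \<beta> (1 - \<beta>)) * indicator {..<t} r"
proof (cases "r < t")
  case False
  then have z: "power_kernel (-\<beta>) (t - s) * power_kernel (\<beta> - 1) (s - r) = 0" for s
    by (auto simp: power_kernel_def)
  show ?thesis unfolding z using False by simp
next
  case True
  have "((\<lambda>x. x powr (\<beta> - 1) * (1 - x) powr (1 - \<beta> - 1)) has_integral Beta \<beta> (1 - \<beta>)) {0<..<1}"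
    using has_integral_Beta_real[of \<beta> "1 - \<beta>"] assms by (simp add: has_integral_Icc_iff_Ioo)
  then have B: "(\<integral>\<^sup>+x. ennreal (x powr (\<beta> - 1) * (1 - x) powr (- \<beta>)) * indicator {0<..<1} x \<partial>lborel)
      = ennreal (Beta \<beta> (1 - \<beta>))"
    by (intro nn_integral_has_integral_lebesgue') auto
  have pt: "ennreal (t - r) * ennreal (power_kernel (-\<beta>) (t - (r + (t - r) * x)) * power_kernel (\<beta> - 1) (r + (t - r) * x - r))
      = ennreal (x powr (\<beta> - 1) * (1 - x) powr (- \<beta>)) * indicator {0<..<1} x" for x
  proof (cases "0 < x \<and> x < 1")
    case x: True
    have e: "t - (r + (t - r) * x) = (t - r) * (1 - x)" by (simp add: algebra_simps)
    have "(t - r) * (((t - r) * (1 - x)) powr (- \<beta>) * ((t - r) * x) powr (\<beta> - 1))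
        = (t - r) * ((t - r) powr (-\<beta>) * (t - r) powr (\<beta> - 1)) * (x powr (\<beta> - 1) * (1 - x) powr (- \<beta>))"
      using x True by (simp add: powr_mult mult_ac)
    also have "(t - r) powr (-\<beta>) * (t - r) powr (\<beta> - 1) = inverse (t - r)"
      using True unfolding powr_add[symmetric] by (simp add: powr_minus)
    finally have "(t - r) * (((t - r) * (1 - x)) powr (- \<beta>) * ((t - r) * x) powr (\<beta> - 1))
        = x powr (\<beta> - 1) * (1 - x) powr (- \<beta>)"
      using True by simp
    then show ?thesis
      unfolding e using x True by (simp add: power_kernel_def ennreal_mult[symmetric])
  next
    case False
    then have "\<not> (0 < t - (r + (t - r) * x) \<and> 0 < r + (t - r) * x - r)"
    proof -
      have e: "t - (r + (t - r) * x) = (t - r) * (1 - x)" by (simp add: algebra_simps)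
      show ?thesis unfolding e using False True by (auto simp: zero_less_mult_iff)
    qed
    then show ?thesis using False by (auto simp: power_kernel_def)
  qed
  have "(\<integral>\<^sup>+s. ennreal (power_kernel (-\<beta>) (t - s) * power_kernel (\<beta> - 1) (s - r)) \<partial>lborel)
      = ennreal (t - r) * (\<integral>\<^sup>+x. ennreal (power_kernel (-\<beta>) (t - (r + (t - r) * x)) * power_kernel (\<beta> - 1) (r + (t - r) * x - r)) \<partial>lborel)"
    using True by (subst nn_integral_real_affine[where c = "t - r" and t = r]) auto
  also have "\<dots> = (\<integral>\<^sup>+x. ennreal (t - r) * ennreal (power_kernel (-\<beta>) (t - (r + (t - r) * x)) * power_kernel (\<beta> - 1) (r + (t - r) * x - r)) \<partial>lborel)"
    by (rule nn_integral_cmult[symmetric]) measurable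
  also have "\<dots> = ennreal (Beta \<beta> (1 - \<beta>))"
    unfolding pt by (rule B)
  finally show ?thesis using True by simp
qed

text \<open>The functions to which fractional integrals are applied are continuous on \<open>[0,T]\<close>; cut off to
  \<open>(0,T)\<close> they become bounded Borel functions on the line.\<close>

definition bounded_source :: "(real \<Rightarrow> real) \<Rightarrow> real \<Rightarrow> real \<Rightarrow> bool" where
  "bounded_source h M T \<longleftrightarrow> 0 \<le> M \<and> h \<in> borel_measurable borel \<and> (\<forall>s. \<bar>h s\<bar> \<le> M * indicator {0<..<T} s)"

definition kernel_conv :: "real \<Rightarrow> (real \<Rightarrow> real) \<Rightarrow> real \<Rightarrow> real" where
  "kernel_conv \<gamma> h t = (LBINT s. power_kernel \<gamma> (t - s) * h s)"

lemma kernel_conv_measurable [measurable]: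
  assumes [measurable]: "h \<in> borel_measurable borel"
  shows "kernel_conv \<gamma> h \<in> borel_measurable borel"
  unfolding kernel_conv_def by measurable

lemma kernel_conv_bound:
  assumes "\<gamma> > -1" "t \<ge> 0" "h \<in> borel_measurable borel" "\<And>s. s < t \<Longrightarrow> \<bar>h s\<bar> \<le> M * indicator {0<..} s"
  shows "integrable lborel (\<lambda>s. power_kernel \<gamma> (t - s) * h s)"
    and "\<bar>kernel_conv \<gamma> h t\<bar> \<le> M * (t powr (\<gamma> + 1) / (\<gamma> + 1))"
proof -
  note [measurable] = assms(3)
  have b: "\<bar>power_kernel \<gamma> (t - s) * h s\<bar> \<le> M * (power_kernel \<gamma> (t - s) * indicator {0<..} s)" for s
  proof (cases "s < t")
    case True
    then show ?thesis
      using mult_left_mono[OF assms(4)[OF True] power_kernel_nonneg[of \<gamma> "t - s"]] power_kernel_nonneg[of \<gamma> "t - s"]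
      by (simp add: abs_mult mult_ac)
  qed (simp add: power_kernel_def)
  have i: "integrable lborel (\<lambda>s. M * (power_kernel \<gamma> (t - s) * indicator {0<..} s))"
    using integral_power_kernel(1)[OF assms(1,2)] by simp
  show I: "integrable lborel (\<lambda>s. power_kernel \<gamma> (t - s) * h s)"
    by (rule Bochner_Integration.integrable_bound[OF i])
      (use b in \<open>auto intro!: AE_I2 intro: order_trans[OF _ abs_ge_self]\<close>)
  have "\<bar>kernel_conv \<gamma> h t\<bar> \<le> (LBINT s. \<bar>power_kernel \<gamma> (t - s) * h s\<bar>)"
    unfolding kernel_conv_def by (rule integral_abs_bound)
  also have "\<dots> \<le> (LBINT s. M * (power_kernel \<gamma> (t - s) * indicator {0<..} s))"
    by (rule integral_mono) (use I i b in auto)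
  finally show "\<bar>kernel_conv \<gamma> h t\<bar> \<le> M * (t powr (\<gamma> + 1) / (\<gamma> + 1))"
    by (simp add: integral_power_kernel[OF assms(1,2)])
qed

lemma bounded_sourceD:
  assumes "bounded_source h M T"
  shows "h \<in> borel_measurable borel" "\<bar>h s\<bar> \<le> M * indicator {0<..<T} s" "\<bar>h s\<bar> \<le> M * indicator {0<..} s"
proof -
  show "h \<in> borel_measurable borel" and 2: "\<bar>h s\<bar> \<le> M * indicator {0<..<T} s"
    using assms by (auto simp: bounded_source_def)
  have "0 \<le> M" using assms by (simp add: bounded_source_def)
  then have "M * indicator {0<..<T} s \<le> M * indicator {0<..} s"
    by (intro mult_left_mono) (auto simp: indicator_def)
  with 2 show "\<bar>h s\<bar> \<le> M * indicator {0<..} s" by linarith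
qed

text \<open>Exchanging the order of integration leaves the convolution of the two kernels, which is
  constant. Hence a function is recovered, up to the factor \<open>Beta \<beta> (1 - \<beta>)\<close> and one integration,
  from its fractional integral of order \<open>\<beta>\<close>.\<close>

lemma abel_inversion:
  assumes \<beta>: "0 < \<beta>" "\<beta> < 1" and h: "bounded_source h M T"
  shows "(LBINT s. power_kernel (-\<beta>) (t - s) * kernel_conv (\<beta> - 1) h s)
    = Beta \<beta> (1 - \<beta>) * (LBINT r. indicator {..<t} r * h r)"
proof -
  note [measurable] = bounded_sourceD(1)[OF h]
  let ?F = "\<lambda>r s. (power_kernel (-\<beta>) (t - s) * power_kernel (\<beta> - 1) (s - r)) * h r"
  have Bpos: "Beta \<beta> (1 - \<beta>) \<ge> 0"
    using \<beta> by (intro has_integral_nonneg[OF has_integral_Beta_real[of \<beta> "1 - \<beta>"]]) auto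
  have "(\<integral>\<^sup>+p. ennreal (norm (case p of (r, s) \<Rightarrow> ?F r s)) \<partial>(lborel \<Otimes>\<^sub>M lborel))
      = (\<integral>\<^sup>+r. (\<integral>\<^sup>+s. ennreal (norm (?F r s)) \<partial>lborel) \<partial>lborel)"
    by (subst lborel.nn_integral_fst[symmetric]) auto
  also have "\<dots> = (\<integral>\<^sup>+r. ennreal \<bar>h r\<bar> * (ennreal (Beta \<beta> (1 - \<beta>)) * indicator {..<t} r) \<partial>lborel)"
  proof (rule nn_integral_cong)
    fix r
    have "(\<integral>\<^sup>+s. ennreal (norm (?F r s)) \<partial>lborel)
      = (\<integral>\<^sup>+s. ennreal \<bar>h r\<bar> * ennreal (power_kernel (-\<beta>) (t - s) * power_kernel (\<beta> - 1) (s - r)) \<partial>lborel)"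
      by (intro nn_integral_cong) (simp add: ennreal_mult[symmetric] abs_mult power_kernel_nonneg mult_ac)
    also have "\<dots> = ennreal \<bar>h r\<bar> * (ennreal (Beta \<beta> (1 - \<beta>)) * indicator {..<t} r)"
      by (subst nn_integral_cmult) (simp_all add: nn_integral_power_kernel_mult[OF \<beta>])
    finally show "(\<integral>\<^sup>+s. ennreal (norm (?F r s)) \<partial>lborel)
      = ennreal \<bar>h r\<bar> * (ennreal (Beta \<beta> (1 - \<beta>)) * indicator {..<t} r)" .
  qed
  also have "\<dots> \<le> (\<integral>\<^sup>+r. ennreal (M * Beta \<beta> (1 - \<beta>)) * indicator {0<..<T} r \<partial>lborel)"
  proof (rule nn_integral_mono)
    fix r
    show "ennreal \<bar>h r\<bar> * (ennreal (Beta \<beta> (1 - \<beta>)) * indicator {..<t} r)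
        \<le> ennreal (M * Beta \<beta> (1 - \<beta>)) * indicator {0<..<T} r"
      using bounded_sourceD(2)[OF h, of r] Bpos
      by (auto simp: indicator_def ennreal_mult[symmetric] intro!: ennreal_leI mult_right_mono split: if_splits)
  qed
  also have "\<dots> < \<infinity>"
    by (subst nn_integral_cmult_indicator) (use emeasure_bounded_finite[of "{0<..<T}"] in \<open>auto simp: ennreal_mult_less_top\<close>)
  finally have int: "integrable (lborel \<Otimes>\<^sub>M lborel) (\<lambda>(r, s). ?F r s)"
    by (intro integrableI_bounded) auto
  have inner: "(LBINT s. ?F r s) = Beta \<beta> (1 - \<beta>) * (indicator {..<t} r * h r)" for r
  proof -
    have "(LBINT s. power_kernel (-\<beta>) (t - s) * power_kernel (\<beta> - 1) (s - r)) = Beta \<beta> (1 - \<beta>) * indicator {..<t} r"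
      using Bpos by (subst integral_eq_nn_integral)
        (auto simp: nn_integral_power_kernel_mult[OF \<beta>] power_kernel_nonneg indicator_def)
    then show ?thesis by simp
  qed
  have "(LBINT s. power_kernel (-\<beta>) (t - s) * kernel_conv (\<beta> - 1) h s) = (LBINT s. LBINT r. ?F r s)"
    unfolding kernel_conv_def by (simp add: mult.assoc)
  also have "\<dots> = (LBINT r. LBINT s. ?F r s)"
    using int by (rule lborel_pair.Fubini_integral)
  also have "\<dots> = Beta \<beta> (1 - \<beta>) * (LBINT r. indicator {..<t} r * h r)"
    unfolding inner by simp
  finally show ?thesis .
qed

lemma integral_lebesgue_on_Ioo:
  fixes f :: "real \<Rightarrow> real"
  assumes "(\<lambda>x. indicator {a<..<b} x * f x) \<in> borel_measurable borel"
  shows "(LINT x|lebesgue_on {a<..<b}. f x) = (LBINT x. indicator {a<..<b} x * f x)"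
  using assms by (simp add: integral_restrict_space integral_completion)

lemma bounded_source_continuous:
  assumes "continuous_on {0..T} g"
  obtains M where "bounded_source (\<lambda>s. indicator {0<..<T} s * g s) M T"
proof -
  have "bounded (g ` {0..T})"
    by (intro compact_imp_bounded compact_continuous_image assms) simp
  then obtain M where M: "\<forall>s\<in>{0..T}. \<bar>g s\<bar> \<le> M"
    unfolding bounded_iff by auto
  have "(\<lambda>s. indicator {0<..<T} s *\<^sub>R g s) \<in> borel_measurable borel"
    by (intro borel_measurable_continuous_on_indicator continuous_on_subset[OF assms]) auto
  moreover have "\<bar>indicator {0<..<T} s * g s\<bar> \<le> \<bar>M\<bar> * indicator {0<..<T} s" for s
    using M[rule_format, of s] by (cases "s \<in> {0<..<T}") auto
  ultimately show thesis
    by (intro that[of "\<bar>M\<bar>"]) (auto simp: bounded_source_def)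
qed

text \<open>\<open>RL_integral\<close> evaluated at a fixed vector, for which \<open>g\<close> is the evaluated integrand.\<close>

definition rl_integral :: "real \<Rightarrow> (real \<Rightarrow> real) \<Rightarrow> real \<Rightarrow> real" where
  "rl_integral \<beta> g t = 1 / Gamma \<beta> * (LINT s|lebesgue_on {0<..<t}. (t - s) powr (\<beta> - 1) * g s)"

lemma rl_integral_conv:
  assumes "continuous_on {0..T} g" "t \<le> T"
  shows "rl_integral \<beta> g t = kernel_conv (\<beta> - 1) (\<lambda>s. indicator {0<..<T} s * g s) t / Gamma \<beta>"
proof -
  have eq: "indicator {0<..<t} s * ((t - s) powr (\<beta> - 1) * g s)
      = power_kernel (\<beta> - 1) (t - s) * (indicator {0<..<T} s * g s)" for s
    using assms(2) by (auto simp: power_kernel_def indicator_def)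
  obtain M where M: "bounded_source (\<lambda>s. indicator {0<..<T} s * g s) M T"
    using assms(1) by (rule bounded_source_continuous)
  note [measurable] = bounded_sourceD(1)[OF M]
  show ?thesis
    unfolding rl_integral_def kernel_conv_def by (subst integral_lebesgue_on_Ioo) (simp_all add: eq)
qed


lemma integrable_Ioo_bounded:
  fixes f :: "real \<Rightarrow> real"
  assumes "(\<lambda>x. indicator {a<..<b} x * f x) \<in> borel_measurable borel"
    and "\<And>x. a < x \<Longrightarrow> x < b \<Longrightarrow> \<bar>f x\<bar> \<le> C"
  shows "integrable (lebesgue_on {a<..<b}) f"
proof -
  have "integrable lborel (\<lambda>x. C * indicator {a<..<b} x)"
    by (intro integrable_mult_right integrable_real_indicator emeasure_bounded_finite) auto
  then have "integrable lborel (\<lambda>x. indicator {a<..<b} x * f x)"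
    by (rule Bochner_Integration.integrable_bound)
      (use assms in \<open>auto simp: indicator_def intro!: AE_I2 intro: order_trans[OF _ abs_ge_self]\<close>)
  then show ?thesis
    using assms(1) by (simp add: integrable_restrict_space integrable_completion)
qed

lemma rl_integral_measurable_bound:
  assumes "continuous_on {0..T} g" "0 < \<beta>"
  shows "(\<lambda>t. indicator {0<..<T} t * rl_integral \<beta> g t) \<in> borel_measurable borel"
    and "\<exists>C. \<forall>t\<in>{0<..<T}. \<bar>rl_integral \<beta> g t\<bar> \<le> C * t powr \<beta>"
proof -
  let ?h = "\<lambda>s. indicator {0<..<T} s * g s"
  obtain M where M: "bounded_source ?h M T"
    using assms(1) by (rule bounded_source_continuous)
  have eq: "rl_integral \<beta> g t = kernel_conv (\<beta> - 1) ?h t / Gamma \<beta>" if "t \<in> {0<..<T}" for t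
    using rl_integral_conv[OF assms(1)] that by auto
  have [measurable]: "kernel_conv (\<beta> - 1) ?h \<in> borel_measurable borel"
    by (rule kernel_conv_measurable[OF bounded_sourceD(1)[OF M]])
  have "(\<lambda>t. indicator {0<..<T} t * rl_integral \<beta> g t) = (\<lambda>t. indicator {0<..<T} t * (kernel_conv (\<beta> - 1) ?h t / Gamma \<beta>))"
    using eq by (auto simp: indicator_def)
  then show "(\<lambda>t. indicator {0<..<T} t * rl_integral \<beta> g t) \<in> borel_measurable borel" by simp
  have G: "Gamma \<beta> > 0" using assms(2) by (simp add: Gamma_real_pos)
  have "\<bar>rl_integral \<beta> g t\<bar> \<le> (M / \<beta> / Gamma \<beta>) * t powr \<beta>" if "t \<in> {0<..<T}" for t
  proof -
    have "\<bar>kernel_conv (\<beta> - 1) ?h t\<bar> \<le> M * (t powr (\<beta> - 1 + 1) / (\<beta> - 1 + 1))"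
      using that assms(2) by (intro kernel_conv_bound(2) bounded_sourceD[OF M]) auto
    then have "\<bar>kernel_conv (\<beta> - 1) ?h t\<bar> / Gamma \<beta> \<le> M * (t powr \<beta> / \<beta>) / Gamma \<beta>"
      using G by (intro divide_right_mono) auto
    then show ?thesis using G by (simp add: eq[OF that])
  qed
  then show "\<exists>C. \<forall>t\<in>{0<..<T}. \<bar>rl_integral \<beta> g t\<bar> \<le> C * t powr \<beta>" by blast
qed

lemma rl_integral_lincomb:
  assumes "continuous_on {0..T} g" "continuous_on {0..T} h" "0 < \<beta>" "0 < t" "t < T"
  shows "rl_integral \<beta> (\<lambda>s. g s + c * h s) t = rl_integral \<beta> g t + c * rl_integral \<beta> h t"
proof -
  have i: "integrable lborel (\<lambda>s. power_kernel (\<beta> - 1) (t - s) * (indicator {0<..<T} s * f s))"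
    if f: "continuous_on {0..T} f" for f :: "real \<Rightarrow> real"
  proof -
    obtain M where M: "bounded_source (\<lambda>s. indicator {0<..<T} s * f s) M T"
      using f by (rule bounded_source_continuous)
    show ?thesis using assms by (intro kernel_conv_bound(1)[OF _ _ bounded_sourceD(1,3)[OF M]]) auto
  qed
  have "continuous_on {0..T} (\<lambda>s. g s + c * h s)" by (intro continuous_intros assms)
  from rl_integral_conv[OF this] rl_integral_conv[OF assms(1)] rl_integral_conv[OF assms(2)] show ?thesis
    using assms(5) i[OF assms(1)] i[OF assms(2)]
    by (simp add: kernel_conv_def distrib_left add_divide_distrib mult.left_commute[of _ c])
qed

section \<open>The scalar fractional problem\<close>

text \<open>The equation \<open>D y + l y = f\<close> with the Caputo derivative of order \<open>2 - \<beta>\<close> of a function with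
  time derivative \<open>z\<close>, in the sense of distributions. It is solved by each coefficient of a weak
  solution.\<close>

definition frac_sol ::
  "real \<Rightarrow> real \<Rightarrow> real \<Rightarrow> (real \<Rightarrow> real) \<Rightarrow> (real \<Rightarrow> real) \<Rightarrow> (real \<Rightarrow> real) \<Rightarrow> bool" where
  "frac_sol \<beta> T l f y z \<longleftrightarrow>
     (\<forall>t\<in>{0..T}. (y has_real_derivative z t) (at t within {0..T})) \<and> continuous_on {0..T} z \<and>
     integrable (lebesgue_on {0<..<T}) f \<and>
     (\<forall>\<psi>. test_fun 0 T \<psi> \<longrightarrow>
        (LINT t|lebesgue_on {0<..<T}. \<psi> t * (f t - l * y t)) =
        - (LINT t|lebesgue_on {0<..<T}. deriv \<psi> t * rl_integral \<beta> (\<lambda>s. z s - z 0) t))"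

lemma test_fun_bounded:
  assumes "test_fun a b \<psi>"
  obtains C where "\<And>t. a \<le> t \<Longrightarrow> t \<le> b \<Longrightarrow> \<bar>\<psi> t\<bar> \<le> C"
proof -
  have "bounded (\<psi> ` {a..b})"
    by (intro compact_imp_bounded compact_continuous_image test_fun_continuous[OF assms]) simp
  then obtain C where "\<forall>t\<in>{a..b}. \<bar>\<psi> t\<bar> \<le> C" unfolding bounded_iff by auto
  then show thesis by (intro that[of C]) auto
qed

lemma test_fun_borel: "test_fun a b \<psi> \<Longrightarrow> \<psi> \<in> borel_measurable borel"
  by (intro borel_measurable_continuous_onI test_fun_continuous)

lemma integrable_test_fun_mult:
  assumes "test_fun 0 T \<psi>" "integrable (lebesgue_on {0<..<T}) f"
  shows "integrable (lebesgue_on {0<..<T}) (\<lambda>t. \<psi> t * f t)"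
proof -
  obtain C where C: "\<And>t. 0 \<le> t \<Longrightarrow> t \<le> T \<Longrightarrow> \<bar>\<psi> t\<bar> \<le> C"
    using assms(1) by (rule test_fun_bounded) blast
  have [measurable]: "\<psi> \<in> borel_measurable (lebesgue_on {0<..<T})"
    using test_fun_borel[OF assms(1)] by (intro measurable_restrict_space1) (simp add: measurable_completion)
  have "AE t in lebesgue_on {0<..<T}. norm (\<psi> t * f t) \<le> norm (C * f t)"
    using C by (auto intro!: AE_I2 mult_right_mono simp: abs_mult space_restrict_space intro: order_trans[OF _ abs_ge_self])
  then show ?thesis
    using assms(2) by (intro Bochner_Integration.integrable_bound[OF integrable_mult_right[of C, OF assms(2)]]) auto
qed

lemma integrable_rl_integral:
  assumes "continuous_on {0..T} g" "0 < \<beta>"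
  shows "integrable (lebesgue_on {0<..<T}) (rl_integral \<beta> g)"
proof -
  obtain C where C: "\<forall>t\<in>{0<..<T}. \<bar>rl_integral \<beta> g t\<bar> \<le> C * t powr \<beta>"
    using rl_integral_measurable_bound(2)[OF assms] by blast
  show ?thesis
  proof (rule integrable_Ioo_bounded)
    show "(\<lambda>t. indicator {0<..<T} t * rl_integral \<beta> g t) \<in> borel_measurable borel"
      using assms by (rule rl_integral_measurable_bound)
    fix t assume t: "0 < t" "t < T"
    have "\<bar>rl_integral \<beta> g t\<bar> \<le> C * t powr \<beta>" using C t by auto
    also have "\<dots> \<le> \<bar>C\<bar> * T powr \<beta>"
      using t assms(2) by (intro mult_mono powr_mono2) auto
    finally show "\<bar>rl_integral \<beta> g t\<bar> \<le> \<bar>C\<bar> * T powr \<beta>" .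
  qed
qed

lemma frac_sol_lincomb:
  assumes 1: "frac_sol \<beta> T l f1 y1 z1" and 2: "frac_sol \<beta> T l f2 y2 z2" and \<beta>: "0 < \<beta>"
  shows "frac_sol \<beta> T l (\<lambda>t. f1 t + c * f2 t) (\<lambda>t. y1 t + c * y2 t) (\<lambda>t. z1 t + c * z2 t)"
  unfolding frac_sol_def
proof (intro conjI ballI allI impI)
  fix t assume "t \<in> {0..T}"
  then show "((\<lambda>t. y1 t + c * y2 t) has_real_derivative z1 t + c * z2 t) (at t within {0..T})"
    using 1 2 by (auto simp: frac_sol_def intro!: DERIV_add DERIV_cmult)
next
  show "continuous_on {0..T} (\<lambda>t. z1 t + c * z2 t)"
    using 1 2 by (auto simp: frac_sol_def intro!: continuous_intros)
next
  show "integrable (lebesgue_on {0<..<T}) (\<lambda>t. f1 t + c * f2 t)"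
    using 1 2 by (auto simp: frac_sol_def)
next
  fix \<psi> assume \<psi>: "test_fun 0 T \<psi>"
  have z: "continuous_on {0..T} (\<lambda>s. z1 s - z1 0)" "continuous_on {0..T} (\<lambda>s. z2 s - z2 0)"
    using 1 2 by (auto simp: frac_sol_def intro!: continuous_intros)
  let ?M = "lebesgue_on {0<..<T}"
  have y: "integrable ?M y1" "integrable ?M y2"
    using 1 2 by (auto intro!: continuous_integral_Ioo(1) simp: frac_sol_def
        intro: DERIV_continuous_on)
  have f: "integrable ?M f1" "integrable ?M f2" using 1 2 by (auto simp: frac_sol_def)
  have i: "integrable ?M (\<lambda>t. \<psi> t * (f1 t - l * y1 t))" "integrable ?M (\<lambda>t. \<psi> t * (f2 t - l * y2 t))"
    using f y by (auto intro!: integrable_test_fun_mult[OF \<psi>])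
  have j: "integrable ?M (\<lambda>t. deriv \<psi> t * rl_integral \<beta> (\<lambda>s. z1 s - z1 0) t)"
    "integrable ?M (\<lambda>t. deriv \<psi> t * rl_integral \<beta> (\<lambda>s. z2 s - z2 0) t)"
    by (intro integrable_test_fun_mult[OF test_fun_deriv[OF \<psi>]] integrable_rl_integral z \<beta>)+
  have "(LINT t|?M. \<psi> t * (f1 t + c * f2 t - l * (y1 t + c * y2 t)))
      = (LINT t|?M. \<psi> t * (f1 t - l * y1 t) + c * (\<psi> t * (f2 t - l * y2 t)))"
    by (intro Bochner_Integration.integral_cong) (auto simp: algebra_simps)
  also have "\<dots> = (LINT t|?M. \<psi> t * (f1 t - l * y1 t)) + c * (LINT t|?M. \<psi> t * (f2 t - l * y2 t))"
    using i by simp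
  also have "\<dots> = - ((LINT t|?M. deriv \<psi> t * rl_integral \<beta> (\<lambda>s. z1 s - z1 0) t)
      + c * (LINT t|?M. deriv \<psi> t * rl_integral \<beta> (\<lambda>s. z2 s - z2 0) t))"
    using 1 2 \<psi> by (simp add: frac_sol_def)
  also have "(LINT t|?M. deriv \<psi> t * rl_integral \<beta> (\<lambda>s. z1 s - z1 0) t)
      + c * (LINT t|?M. deriv \<psi> t * rl_integral \<beta> (\<lambda>s. z2 s - z2 0) t)
      = (LINT t|?M. deriv \<psi> t * rl_integral \<beta> (\<lambda>s. z1 s - z1 0) t
          + c * (deriv \<psi> t * rl_integral \<beta> (\<lambda>s. z2 s - z2 0) t))"
    using j by simp
  also have "\<dots> = (LINT t|?M. deriv \<psi> t * rl_integral \<beta> (\<lambda>s. z1 s + c * z2 s - (z1 0 + c * z2 0)) t)"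
  proof (intro Bochner_Integration.integral_cong refl)
    fix t assume "t \<in> space ?M"
    then have t: "0 < t" "t < T" by (auto simp: space_restrict_space)
    have eq: "(\<lambda>s. z1 s + c * z2 s - (z1 0 + c * z2 0)) = (\<lambda>s. (z1 s - z1 0) + c * (z2 s - z2 0))"
      by (auto simp: algebra_simps)
    show "deriv \<psi> t * rl_integral \<beta> (\<lambda>s. z1 s - z1 0) t + c * (deriv \<psi> t * rl_integral \<beta> (\<lambda>s. z2 s - z2 0) t)
        = deriv \<psi> t * rl_integral \<beta> (\<lambda>s. z1 s + c * z2 s - (z1 0 + c * z2 0)) t"
      unfolding eq rl_integral_lincomb[OF z \<beta> t] by (simp add: algebra_simps)
  qed
  finally show "(LINT t|?M. \<psi> t * (f1 t + c * f2 t - l * (y1 t + c * y2 t)))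
      = - (LINT t|?M. deriv \<psi> t * rl_integral \<beta> (\<lambda>s. z1 s + c * z2 s - (z1 0 + c * z2 0)) t)" .
qed

text \<open>With \<open>W\<close> the integral of \<open>\<bar>y\<bar>\<close>, the assumption says that \<open>W t * exp (- K * t)\<close> is nonincreasing.\<close>

lemma gronwall_zero:
  fixes y :: "real \<Rightarrow> real"
  assumes y: "continuous_on {0..T} y" and le: "\<And>t. 0 \<le> t \<Longrightarrow> t \<le> T \<Longrightarrow> \<bar>y t\<bar> \<le> K * integral {0..t} (\<lambda>s. \<bar>y s\<bar>)"
    and t: "0 \<le> t" "t \<le> T"
  shows "y t = 0"
proof (cases "t = 0")
  case True then show ?thesis using le[OF t] by simp
next
  case False
  define W where "W t = integral {0..t} (\<lambda>s. \<bar>y s\<bar>)" for t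
  have ya: "continuous_on {0..T} (\<lambda>s. \<bar>y s\<bar>)" by (intro continuous_intros y)
  have der: "(W has_real_derivative \<bar>y s\<bar>) (at s within {0..T})" if "s \<in> {0..T}" for s
    unfolding W_def by (rule integral_has_real_derivative[OF ya that])
  have cont: "continuous_on {0..T} W" using der by (rule DERIV_continuous_on)
  have "W t * exp (- K * t) \<le> W 0 * exp (- K * 0)"
  proof (rule DERIV_nonpos_imp_decreasing_open[of 0 t "\<lambda>t. W t * exp (- K * t)"])
    show "0 \<le> t" by fact
    show "continuous_on {0..t} (\<lambda>t. W t * exp (- K * t))"
      by (intro continuous_intros continuous_on_subset[OF cont]) (use t in auto)
    fix s assume s: "0 < s" "s < t"
    then have "at s within {0..T} = at s" using t by (intro at_within_interior) auto
    then have "(W has_real_derivative \<bar>y s\<bar>) (at s)" using der[of s] s t by simp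
    then have "((\<lambda>t. W t * exp (- K * t)) has_real_derivative (\<bar>y s\<bar> - K * W s) * exp (- K * s)) (at s)"
      by (auto intro!: derivative_eq_intros simp: algebra_simps)
    moreover have "(\<bar>y s\<bar> - K * W s) * exp (- K * s) \<le> 0"
      using le[of s] s t by (simp add: W_def mult_nonpos_nonneg)
    ultimately show "\<exists>y. ((\<lambda>t. W t * exp (- K * t)) has_real_derivative y) (at s) \<and> y \<le> 0" by blast
  qed
  then have "W t * exp (- K * t) \<le> 0" by (simp add: W_def)
  then have "W t \<le> 0" by (simp add: mult_le_0_iff)
  moreover have "W t \<ge> 0"
    unfolding W_def using t by (intro integral_nonneg integrable_continuous_real continuous_on_subset[OF ya]) auto
  ultimately show ?thesis using le[OF t] by (simp add: W_def)
qed

lemma test_fun_rescale: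
  assumes "test_fun 0 1 \<xi>" "T > 0"
  shows "test_fun 0 T (\<lambda>t. \<xi> (1 / T * t))"
proof -
  obtain c d where cd: "0 < c" "d < 1" "\<And>x. x < c \<or> d < x \<Longrightarrow> \<xi> x = 0"
    using assms(1) by (rule test_fun_support) blast
  show ?thesis
  proof (rule test_funI)
    show "smooth_fun (\<lambda>t. \<xi> (1 / T * t))" by (rule smooth_fun_rescale[OF test_fun_smooth[OF assms(1)]])
    show "0 < T * c" "T * d < T" using cd assms(2) by auto
    show "\<xi> (1 / T * t) = 0" if "t < T * c \<or> T * d < t" for t
      by (rule cd) (use that assms(2) in \<open>auto simp: field_simps\<close>)
  qed
qed

text \<open>The bound tends to zero at the origin, while the value \<open>c\<close> is attained in every neighbourhood of it.\<close>

lemma AE_const_bound_0: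
  assumes "AE t in lborel. t \<in> {0<..<T} \<longrightarrow> f t = (c::real)" "T > 0" "\<beta> > 0"
    and b: "\<And>t. 0 < t \<Longrightarrow> t < T \<Longrightarrow> \<bar>f t\<bar> \<le> C * t powr \<beta> + D * t"
  shows "c = 0"
proof (rule ccontr)
  assume "c \<noteq> 0"
  have "((\<lambda>t. C * t powr \<beta> + D * t) \<longlongrightarrow> C * 0 powr \<beta> + D * 0) (at_right 0)"
    using \<open>\<beta> > 0\<close> by (intro tendsto_intros) (auto simp: eventually_at_filter)
  then have "\<forall>\<^sub>F t in at_right 0. C * t powr \<beta> + D * t < \<bar>c\<bar>"
    by (rule order_tendstoD) (use \<open>c \<noteq> 0\<close> \<open>\<beta> > 0\<close> in simp)
  then obtain \<delta> where \<delta>: "\<delta> > 0" "\<And>t. 0 < t \<Longrightarrow> t < \<delta> \<Longrightarrow> C * t powr \<beta> + D * t < \<bar>c\<bar>"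
    unfolding eventually_at_right_field by auto
  define m where "m = min \<delta> T"
  have m: "m > 0" using \<delta> \<open>T > 0\<close> by (simp add: m_def)
  from assms(1) have "AE t in lborel. t \<notin> {0<..<m}"
  proof eventually_elim
    case (elim t)
    show ?case
    proof
      assume t: "t \<in> {0<..<m}"
      then have "f t = c" using elim by (auto simp: m_def)
      then show False using b[of t] \<delta>(2)[of t] t by (auto simp: m_def)
    qed
  qed
  then have "emeasure lborel {0<..<m} = 0"
    by (subst (asm) AE_iff_measurable[of "{0<..<m}"]) auto
  then show False using m by simp
qed

lemma square_int_one: "square_int (\<lambda>x. 1)"
  by (rule square_int_bounded[of _ 1]) auto

lemma measurable_lebesgue_on_AE_cong:
  fixes f g :: "real \<Rightarrow> real"
  assumes "f \<in> borel_measurable (lebesgue_on S)" "AE x in lebesgue_on S. f x = g x" "S \<in> sets lebesgue"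
  shows "g \<in> borel_measurable (lebesgue_on S)"
proof -
  have "(\<lambda>x. indicator S x *\<^sub>R g x) \<in> borel_measurable lebesgue"
  proof (rule borel_measurable_AE)
    show "(\<lambda>x. indicator S x *\<^sub>R f x) \<in> borel_measurable lebesgue"
      using assms(1,3) by (simp add: borel_measurable_restrict_space_iff)
    have "AE x in lebesgue. x \<in> S \<longrightarrow> f x = g x"
      using assms(2,3) by (simp add: AE_restrict_space_iff)
    then show "AE x in lebesgue. indicator S x *\<^sub>R f x = indicator S x *\<^sub>R g x"
      by eventually_elim (auto simp: indicator_def)
  qed
  then show ?thesis using assms(3) by (simp add: borel_measurable_restrict_space_iff)
qed

context singular_op
begin

text \<open>Fix a test function \<open>\<eta>\<close> with nonzero integral; it exists by density. For each test function
  \<open>\<xi>\<close>, the function \<open>\<xi> - (\<integral>\<xi> / \<integral>\<eta>) \<eta>\<close> has integral zero and is thus the derivative of a test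
  function, to which \<open>v\<close> is orthogonal.\<close>

lemma weak_deriv_zero_const:
  assumes "has_weak_deriv v 0"
  obtains c where "v = c *\<^sub>R abs_L2 (\<lambda>x. 1)"
proof -
  let ?one = "abs_L2 (\<lambda>x. 1)"
  have int: "(LINT x|Omega. \<xi> x) = ?one \<bullet> abs_L2 \<xi>" if "test_fun 0 1 \<xi>" for \<xi>
    by (simp add: inner_L2_abs square_int_one test_fun_square_int[OF that])
  have "(norm ?one)\<^sup>2 = 1"
    by (simp add: norm_L2_abs[OF square_int_one] measure_restrict_space)
  then have "?one \<noteq> 0" by auto
  then obtain \<eta> where \<eta>: "test_fun 0 1 \<eta>" "?one \<bullet> abs_L2 \<eta> \<noteq> 0"
    using test_fun_dense[of ?one] by blast
  define c where "c = (v \<bullet> abs_L2 \<eta>) / (?one \<bullet> abs_L2 \<eta>)"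
  have "v - c *\<^sub>R ?one = 0"
  proof (rule test_fun_dense)
    fix \<xi> assume \<xi>: "test_fun 0 1 \<xi>"
    define k where "k = - ((?one \<bullet> abs_L2 \<xi>) / (?one \<bullet> abs_L2 \<eta>))"
    let ?\<zeta> = "\<lambda>x. \<xi> x + k * \<eta> x"
    have \<zeta>: "test_fun 0 1 ?\<zeta>" by (rule test_fun_lincomb[OF \<xi> \<eta>(1)])
    have abs: "abs_L2 ?\<zeta> = abs_L2 \<xi> + k *\<^sub>R abs_L2 \<eta>"
      by (simp add: abs_L2_add abs_L2_scale square_int_scale test_fun_square_int[OF \<xi>] test_fun_square_int[OF \<eta>(1)])
    have "(LINT x|Omega. ?\<zeta> x) = 0"
      unfolding int[OF \<zeta>] abs using \<eta>(2) by (simp add: inner_add_right inner_diff_right k_def)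
    from test_fun_primitive[OF \<zeta> zero_less_one this]
    obtain \<psi> where \<psi>: "test_fun 0 1 \<psi>" "deriv \<psi> = ?\<zeta>" by blast
    then have "v \<bullet> abs_L2 ?\<zeta> = 0"
      using assms by (auto simp: has_weak_deriv_iff)
    then have "v \<bullet> abs_L2 \<xi> + k * (v \<bullet> abs_L2 \<eta>) = 0"
      unfolding abs by (simp add: inner_add_right)
    then show "(v - c *\<^sub>R ?one) \<bullet> abs_L2 \<xi> = 0"
      using \<eta>(2) by (simp add: inner_diff_left k_def c_def field_simps)
  qed
  then show thesis by (intro that[of c]) simp
qed

text \<open>Rescaled to the unit interval, the assumption says that \<open>H\<close> has weak derivative zero.\<close>

lemma du_bois_reymond:
  assumes H[measurable]: "H \<in> borel_measurable borel" and bd: "\<And>t. \<bar>H t\<bar> \<le> C * indicator {0<..<T} t"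
    and T: "T > 0" and orth: "\<And>\<psi>. test_fun 0 T \<psi> \<Longrightarrow> (LBINT t. deriv \<psi> t * H t) = 0"
  obtains c where "AE t in lborel. t \<in> {0<..<T} \<longrightarrow> H t = c"
proof -
  let ?H = "\<lambda>x. H (T * x)"
  have borel_Omega: "f \<in> borel_measurable borel \<Longrightarrow> f \<in> borel_measurable Omega" for f :: "real \<Rightarrow> real"
    by (intro measurable_restrict_space1) (simp add: measurable_completion)
  have out: "?H x = indicator {0<..<1} x * ?H x" for x
  proof (cases "0 < x \<and> x < 1")
    case False
    then have "T * x \<notin> {0<..<T}" using T by (auto simp: zero_less_mult_iff)
    then show ?thesis using bd[of "T * x"] by simp
  qed simp
  have "\<bar>?H x\<bar> \<le> \<bar>C\<bar>" for x
    using bd[of "T * x"] by (cases "T * x \<in> {0<..<T}") auto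
  then have sq: "square_int ?H"
    by (intro square_int_bounded[of _ "\<bar>C\<bar>"] borel_Omega) measurable
  have "has_weak_deriv (abs_L2 ?H) 0"
    unfolding has_weak_deriv_iff
  proof (intro allI impI)
    fix \<xi> assume \<xi>: "test_fun 0 1 \<xi>"
    note d = test_fun_deriv[OF \<xi>]
    have [measurable]: "deriv \<xi> \<in> borel_measurable borel" by (rule test_fun_borel[OF d])
    have "abs_L2 ?H \<bullet> abs_L2 (deriv \<xi>) = (LINT x|Omega. ?H x * deriv \<xi> x)"
      by (rule inner_L2_abs[OF sq test_fun_square_int[OF d]])
    also have "\<dots> = (LBINT x. indicator {0<..<1} x * (?H x * deriv \<xi> x))"
      by (rule integral_lebesgue_on_Ioo) measurable
    also have "\<dots> = (LBINT x. H (T * x) * deriv \<xi> x)"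
      by (subst (2) out) (simp add: mult.assoc)
    also have "\<dots> = (LBINT t. deriv (\<lambda>t. \<xi> (1 / T * t)) t * H t)"
      unfolding smooth_fun_rescale(2)[OF test_fun_smooth[OF \<xi>]]
      using T by (subst (2) lborel_integral_real_affine[of T _ 0]) (simp_all add: mult_ac)
    also have "\<dots> = 0"
      by (rule orth[OF test_fun_rescale[OF \<xi> T]])
    finally show "abs_L2 ?H \<bullet> abs_L2 (deriv \<xi>) = - (0 \<bullet> abs_L2 \<xi>)" by simp
  qed
  then obtain c where "abs_L2 ?H = c *\<^sub>R abs_L2 (\<lambda>x. 1)" by (rule weak_deriv_zero_const)
  also have "\<dots> = abs_L2 (\<lambda>x. c)"
    using abs_L2_scale[OF square_int_one, of c] by simp
  finally have "AE x in Omega. ?H x = c"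
    using abs_L2_eq_iff[OF sq square_int_scale[OF square_int_one, of c]] by simp
  then have ae: "AE x in lborel. x \<in> {0<..<1} \<longrightarrow> ?H x = c"
    by (simp add: AE_restrict_space_iff AE_completion_iff)
  define N where "N = {t. 0 < t \<and> t < T \<and> H t \<noteq> c}"
  have [measurable]: "N \<in> sets borel" unfolding N_def by measurable
  have "emeasure lborel N = (\<integral>\<^sup>+t. indicator N t \<partial>lborel)" by simp
  also have "\<dots> = ennreal \<bar>T\<bar> * (\<integral>\<^sup>+x. indicator N (0 + T * x) \<partial>lborel)"
    using T by (intro nn_integral_real_affine) auto
  also have "(\<integral>\<^sup>+x. indicator N (0 + T * x) \<partial>lborel) = 0"
  proof -
    have "AE x in lborel. (indicator N (0 + T * x) :: ennreal) = 0"
      using ae by eventually_elim (use T in \<open>auto simp: N_def indicator_def zero_less_mult_iff\<close>)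
    then show ?thesis by (subst nn_integral_0_iff_AE) auto
  qed
  finally have "N \<in> null_sets lborel" by (intro null_setsI) auto
  then have "AE t in lborel. t \<notin> N" by (rule AE_not_in)
  then have "AE t in lborel. t \<in> {0<..<T} \<longrightarrow> H t = c"
    by eventually_elim (auto simp: N_def)
  then show thesis by (rule that)
qed

text \<open>Let \<open>V\<close> be the integral of \<open>y\<close> from \<open>0\<close>. Integration by parts turns the equation into the
  statement that \<open>H = I\<^bsup>\<beta>\<^esup> z + l V\<close> has derivative zero, so \<open>H\<close> is almost everywhere a constant,
  which is zero as \<open>H\<close> tends to zero at the origin. Abel inversion applied to \<open>I\<^bsup>\<beta>\<^esup> z = - l V\<close>
  expresses \<open>y\<close> as a convolution of \<open>V\<close> with an integrable kernel, and \<open>\<bar>V\<bar>\<close> is bounded by the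
  integral of \<open>\<bar>y\<bar>\<close>.\<close>

lemma frac_sol_zero:
  assumes sol: "frac_sol \<beta> T l (\<lambda>t. 0) y z" and init: "y 0 = 0" "z 0 = 0"
    and \<beta>: "0 < \<beta>" "\<beta> < 1" and T: "T > 0" and t: "t \<in> {0..T}"
  shows "y t = 0"
proof -
  have der: "(y has_real_derivative z s) (at s within {0..T})" if "s \<in> {0..T}" for s
    using sol that by (auto simp: frac_sol_def)
  have zc: "continuous_on {0..T} z" using sol by (simp add: frac_sol_def)
  have yc: "continuous_on {0..T} y" using der by (rule DERIV_continuous_on)
  have yac: "continuous_on {0..T} (\<lambda>s. \<bar>y s\<bar>)" by (intro continuous_intros yc)
  define V where "V s = integral {0..s} y" for s
  define W where "W s = integral {0..s} (\<lambda>r. \<bar>y r\<bar>)" for s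
  have Vder: "(V has_real_derivative y s) (at s within {0..T})" if "s \<in> {0..T}" for s
    unfolding V_def by (rule integral_has_real_derivative[OF yc that])
  have Vc: "continuous_on {0..T} V" using Vder by (rule DERIV_continuous_on)
  have sub: "continuous_on {0..s} y" "continuous_on {0..s} (\<lambda>r. \<bar>y r\<bar>)" if "s \<le> T" for s
    using that by (auto intro: continuous_on_subset[OF yc] continuous_on_subset[OF yac])
  have VW: "\<bar>V s\<bar> \<le> W s" if "s \<le> T" for s
    unfolding V_def W_def
    by (rule integral_norm_bound_integral[where f = y, unfolded real_norm_def])
      (auto intro: integrable_continuous_real sub that)
  have Wmono: "W s \<le> W r" if "0 \<le> s" "s \<le> r" "r \<le> T" for s r
    unfolding W_def using that sub[of r] sub[of s]
    by (intro integral_subset_le integrable_continuous_real) auto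
  have W0: "W s \<ge> 0" if "s \<le> T" for s
    using VW[OF that] by linarith
  obtain Y where Y: "\<And>s. 0 \<le> s \<Longrightarrow> s \<le> T \<Longrightarrow> \<bar>y s\<bar> \<le> Y" "Y \<ge> 0"
  proof -
    have "bounded (y ` {0..T})"
      by (intro compact_imp_bounded compact_continuous_image yc) simp
    then obtain C where C: "\<forall>s\<in>{0..T}. \<bar>y s\<bar> \<le> C" unfolding bounded_iff by auto
    have "0 \<le> C" using C[rule_format, of 0] T init by simp
    with C show thesis by (intro that[of C]) auto
  qed
  have Vlin: "\<bar>V s\<bar> \<le> Y * s" if "0 \<le> s" "s \<le> T" for s
  proof -
    have "\<bar>V s\<bar> \<le> W s" using VW that by simp
    also have "\<dots> \<le> integral {0..s} (\<lambda>r. Y)"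
      unfolding W_def using that Y sub[of s] by (intro integral_le integrable_continuous_real) auto
    finally show ?thesis using that by (simp add: mult.commute)
  qed
  have zeq: "rl_integral \<beta> (\<lambda>s. z s - z 0) = rl_integral \<beta> z" using init by simp
  obtain C where C: "\<forall>t\<in>{0<..<T}. \<bar>rl_integral \<beta> z t\<bar> \<le> C * t powr \<beta>"
    using rl_integral_measurable_bound(2)[OF zc \<beta>(1)] by blast
  define H where "H t = indicator {0<..<T} t * (rl_integral \<beta> z t + l * V t)" for t
  have VB[measurable]: "(\<lambda>t. indicator {0<..<T} t * V t) \<in> borel_measurable borel"
    using borel_measurable_continuous_on_indicator[of "{0<..<T}" V] continuous_on_subset[OF Vc, of "{0<..<T}"]
    by (auto simp: greaterThanLessThan_subseteq_atLeastAtMost_iff)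
  have HB: "H \<in> borel_measurable borel"
  proof -
    have [measurable]: "(\<lambda>t. indicator {0<..<T} t * rl_integral \<beta> z t) \<in> borel_measurable borel"
      by (rule rl_integral_measurable_bound[OF zc \<beta>(1)])
    have "H = (\<lambda>t. indicator {0<..<T} t * rl_integral \<beta> z t + l * (indicator {0<..<T} t * V t))"
      by (auto simp: H_def algebra_simps)
    also have "\<dots> \<in> borel_measurable borel" by measurable
    finally show ?thesis .
  qed
  have Hsmall: "\<bar>H s\<bar> \<le> \<bar>C\<bar> * s powr \<beta> + (\<bar>l\<bar> * Y) * s" if "0 < s" "s < T" for s
  proof -
    have "\<bar>rl_integral \<beta> z s\<bar> \<le> \<bar>C\<bar> * s powr \<beta>"
      using C that by (auto intro: order_trans[OF _ mult_right_mono[OF abs_ge_self]])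
    moreover have "\<bar>l * V s\<bar> \<le> \<bar>l\<bar> * (Y * s)"
      unfolding abs_mult using Vlin[of s] that by (intro mult_left_mono) auto
    ultimately show ?thesis
      using that by (simp add: H_def)
  qed
  have "\<bar>H s\<bar> \<le> (\<bar>C\<bar> * T powr \<beta> + (\<bar>l\<bar> * Y) * T) * indicator {0<..<T} s" for s
  proof (cases "s \<in> {0<..<T}")
    case True
    then have "\<bar>H s\<bar> \<le> \<bar>C\<bar> * s powr \<beta> + (\<bar>l\<bar> * Y) * s" using Hsmall by auto
    also have "\<dots> \<le> \<bar>C\<bar> * T powr \<beta> + (\<bar>l\<bar> * Y) * T"
      using True \<beta> Y(2) by (intro add_mono mult_left_mono powr_mono2) auto
    finally show ?thesis using True by simp
  qed (simp add: H_def)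
  moreover have "(LBINT t. deriv \<psi> t * H t) = 0" if \<psi>: "test_fun 0 T \<psi>" for \<psi>
  proof -
    obtain c d where cd: "0 < c" "d < T" "\<And>x. x < c \<or> d < x \<Longrightarrow> \<psi> x = 0"
      using \<psi> by (rule test_fun_support) blast
    have \<psi>c: "continuous_on S \<psi>" "continuous_on S (deriv \<psi>)" for S
      using \<psi> test_fun_deriv[OF \<psi>] by (auto intro: test_fun_continuous)
    have "((\<lambda>s. deriv \<psi> s * V s + \<psi> s * y s) has_integral \<psi> T * V T - \<psi> 0 * V 0) {0..T}"
    proof (rule fundamental_theorem_of_calculus)
      fix s assume s: "s \<in> {0..T}"
      have "((\<lambda>s. \<psi> s * V s) has_real_derivative deriv \<psi> s * V s + y s * \<psi> s) (at s within {0..T})"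
        by (rule DERIV_mult[OF has_field_derivative_at_within[OF test_fun_has_deriv[OF \<psi>]] Vder[OF s]])
      then show "((\<lambda>s. \<psi> s * V s) has_vector_derivative deriv \<psi> s * V s + \<psi> s * y s) (at s within {0..T})"
        by (simp add: has_real_derivative_iff_has_vector_derivative mult.commute)
    qed (use T in simp)
    then have "integral {0..T} (\<lambda>s. deriv \<psi> s * V s + \<psi> s * y s) = 0"
      using cd by (simp add: integral_unique)
    moreover have "continuous_on {0..T} (\<lambda>s. deriv \<psi> s * V s)" "continuous_on {0..T} (\<lambda>s. \<psi> s * y s)"
      by (intro continuous_intros \<psi>c Vc yc)+
    note i = continuous_integral_Ioo[OF this(1)] continuous_integral_Ioo[OF this(2)] this
    ultimately have parts: "(LINT s|lebesgue_on {0<..<T}. deriv \<psi> s * V s) = - (LINT s|lebesgue_on {0<..<T}. \<psi> s * y s)"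
      using i by (subst (asm) Henstock_Kurzweil_Integration.integral_add) (auto intro: integrable_continuous_real)
    have "(LINT s|lebesgue_on {0<..<T}. deriv \<psi> s * rl_integral \<beta> z s) = l * (LINT s|lebesgue_on {0<..<T}. \<psi> s * y s)"
    proof -
      have "(LINT s|lebesgue_on {0<..<T}. \<psi> s * (0 - l * y s)) = - (LINT s|lebesgue_on {0<..<T}. deriv \<psi> s * rl_integral \<beta> z s)"
        using sol \<psi> unfolding frac_sol_def zeq by blast
      moreover have "(LINT s|lebesgue_on {0<..<T}. \<psi> s * (0 - l * y s))
          = (LINT s|lebesgue_on {0<..<T}. (- l) * (\<psi> s * y s))"
        by (intro Bochner_Integration.integral_cong) auto
      ultimately show ?thesis by (simp only: Bochner_Integration.integral_mult_right_zero)
    qed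
    moreover have j: "integrable (lebesgue_on {0<..<T}) (\<lambda>s. deriv \<psi> s * rl_integral \<beta> z s)"
      by (rule integrable_test_fun_mult[OF test_fun_deriv[OF \<psi>] integrable_rl_integral[OF zc \<beta>(1)]])
    ultimately have "(LINT s|lebesgue_on {0<..<T}. deriv \<psi> s * rl_integral \<beta> z s + l * (deriv \<psi> s * V s)) = 0"
      using i(1) by (simp add: parts)
    also have "(LINT s|lebesgue_on {0<..<T}. deriv \<psi> s * rl_integral \<beta> z s + l * (deriv \<psi> s * V s))
        = (LINT s|lebesgue_on {0<..<T}. deriv \<psi> s * H s)"
      by (intro Bochner_Integration.integral_cong) (auto simp: H_def space_restrict_space algebra_simps)
    also have "\<dots> = (LBINT s. indicator {0<..<T} s * (deriv \<psi> s * H s))"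
      using HB test_fun_borel[OF test_fun_deriv[OF \<psi>]] by (intro integral_lebesgue_on_Ioo) measurable
    also have "\<dots> = (LBINT s. deriv \<psi> s * H s)"
      by (intro Bochner_Integration.integral_cong) (auto simp: H_def indicator_def)
    finally show ?thesis .
  qed
  ultimately obtain c where c: "AE s in lborel. s \<in> {0<..<T} \<longrightarrow> H s = c"
    using du_bois_reymond[OF HB _ T] by blast
  have "c = 0" by (rule AE_const_bound_0[OF c T \<beta>(1) Hsmall])
  define h where "h = (\<lambda>s. indicator {0<..<T} s * z s)"
  obtain M where M: "bounded_source h M T"
    using zc unfolding h_def by (rule bounded_source_continuous)
  have G: "Gamma \<beta> > 0" using \<beta> by (simp add: Gamma_real_pos)
  have B: "Beta \<beta> (1 - \<beta>) > 0"
    using \<beta> by (simp add: Beta_def Gamma_real_pos)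
  define h2 where "h2 s = - (Gamma \<beta> * l) * (indicator {0<..<T} s * V s)" for s
  have h2B: "h2 \<in> borel_measurable borel" unfolding h2_def by measurable
  \<comment> \<open>For \<open>s \<le> 0\<close> both sides vanish, which extends the identity to all \<open>s < T\<close>.\<close>
  have conv_h: "AE s in lborel. s < T \<longrightarrow> kernel_conv (\<beta> - 1) h s = h2 s"
    using c
  proof eventually_elim
    case (elim s)
    show ?case
    proof
      assume s: "s < T"
      show "kernel_conv (\<beta> - 1) h s = h2 s"
      proof (cases "0 < s")
        case True
        with s have "rl_integral \<beta> z s = - l * V s" using elim \<open>c = 0\<close> by (simp add: H_def)
        moreover have "rl_integral \<beta> z s = kernel_conv (\<beta> - 1) h s / Gamma \<beta>"
          unfolding h_def using s by (intro rl_integral_conv[OF zc]) simp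
        ultimately show ?thesis using True s G by (simp add: h2_def field_simps)
      next
        case False
        then have zero: "power_kernel (\<beta> - 1) (s - r) * h r = 0" for r
          by (auto simp: power_kernel_def h_def indicator_def)
        show ?thesis unfolding kernel_conv_def zero using False by (simp add: h2_def)
      qed
    qed
  qed
  define K where "K = Gamma \<beta> * \<bar>l\<bar> * (T powr (1 - \<beta>) / (1 - \<beta>)) / Beta \<beta> (1 - \<beta>)"
  have "\<bar>y s\<bar> \<le> K * W s" if s: "0 \<le> s" "s \<le> T" for s
  proof -
    have zs: "continuous_on {0..s} z" using s by (intro continuous_on_subset[OF zc]) auto
    have "(z has_integral y s - y 0) {0..s}"
    proof (rule fundamental_theorem_of_calculus[OF s(1)])
      fix x assume "x \<in> {0..s}"
      then have "(y has_real_derivative z x) (at x within {0..s})"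
        using der[of x] s by (auto intro: has_field_derivative_subset)
      then show "(y has_vector_derivative z x) (at x within {0..s})"
        by (simp add: has_real_derivative_iff_has_vector_derivative)
    qed
    then have "y s = integral {0..s} z" using init by (simp add: integral_unique)
    also have "\<dots> = (LINT r|lebesgue_on {0<..<s}. z r)"
      using continuous_integral_Ioo(2)[OF zs] by simp
    also have "\<dots> = (LBINT r. indicator {0<..<s} r * z r)"
      using borel_measurable_continuous_on_indicator[of "{0<..<s}" z] continuous_on_subset[OF zs, of "{0<..<s}"]
      by (intro integral_lebesgue_on_Ioo) (auto simp: greaterThanLessThan_subseteq_atLeastAtMost_iff)
    also have "\<dots> = (LBINT r. indicator {..<s} r * h r)"
      using s by (intro Bochner_Integration.integral_cong) (auto simp: h_def indicator_def)
    finally have "Beta \<beta> (1 - \<beta>) * y s = (LBINT r. power_kernel (-\<beta>) (s - r) * kernel_conv (\<beta> - 1) h r)"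
      using abel_inversion[OF \<beta> M, of s] by simp
    also have "\<dots> = (LBINT r. power_kernel (-\<beta>) (s - r) * h2 r)"
    proof (rule integral_cong_AE)
      show "AE r in lborel. power_kernel (-\<beta>) (s - r) * kernel_conv (\<beta> - 1) h r = power_kernel (-\<beta>) (s - r) * h2 r"
        using conv_h by eventually_elim (use s in \<open>auto simp: power_kernel_def\<close>)
    qed (use kernel_conv_measurable[OF bounded_sourceD(1)[OF M]] h2B in measurable)
    finally have eq: "Beta \<beta> (1 - \<beta>) * y s = kernel_conv (-\<beta>) h2 s" by (simp add: kernel_conv_def)
    have "\<bar>kernel_conv (-\<beta>) h2 s\<bar> \<le> (Gamma \<beta> * \<bar>l\<bar> * W s) * (s powr (- \<beta> + 1) / (- \<beta> + 1))"
    proof (rule kernel_conv_bound(2)[OF _ s(1) h2B])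
      show "-1 < - \<beta>" using \<beta> by simp
      fix r assume r: "r < s"
      show "\<bar>h2 r\<bar> \<le> Gamma \<beta> * \<bar>l\<bar> * W s * indicator {0<..} r"
      proof (cases "0 < r")
        case True
        then have "\<bar>V r\<bar> \<le> W s"
          using VW[of r] Wmono[of r s] r s by simp
        then have "\<bar>Gamma \<beta> * l\<bar> * \<bar>V r\<bar> \<le> \<bar>Gamma \<beta> * l\<bar> * W s"
          by (rule mult_left_mono) simp
        then show ?thesis
          using True r s G by (simp add: h2_def abs_mult)
      qed (simp add: h2_def)
    qed
    also have "\<dots> \<le> (Gamma \<beta> * \<bar>l\<bar> * W s) * (T powr (1 - \<beta>) / (1 - \<beta>))"
    proof (rule mult_left_mono)
      have "s powr (1 - \<beta>) \<le> T powr (1 - \<beta>)" using \<beta> s by (intro powr_mono2) auto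
      then show "s powr (- \<beta> + 1) / (- \<beta> + 1) \<le> T powr (1 - \<beta>) / (1 - \<beta>)"
        using \<beta> by (simp add: divide_right_mono)
      show "0 \<le> Gamma \<beta> * \<bar>l\<bar> * W s" using G W0[OF s(2)] by simp
    qed
    finally have "Beta \<beta> (1 - \<beta>) * \<bar>y s\<bar> \<le> (Gamma \<beta> * \<bar>l\<bar> * W s) * (T powr (1 - \<beta>) / (1 - \<beta>))"
      using B by (simp add: eq[symmetric] abs_mult)
    then have "\<bar>y s\<bar> \<le> (Gamma \<beta> * \<bar>l\<bar> * W s) * (T powr (1 - \<beta>) / (1 - \<beta>)) / Beta \<beta> (1 - \<beta>)"
      unfolding pos_le_divide_eq[OF B] by (simp only: mult.commute)
    also have "\<dots> = K * W s" by (simp add: K_def)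
    finally show ?thesis .
  qed
  then show ?thesis
    using gronwall_zero[OF yc, of K t] t unfolding W_def by auto
qed

end

section \<open>Coefficients of weak solutions\<close>

context singular_op
begin

lemma Hs_1_iff: "v \<in> Hs \<phi> lam 1 \<longleftrightarrow> summable (\<lambda>n. lam n * (v \<bullet> \<phi> n)\<^sup>2)"
  using lam_pos by (simp add: Hs_def less_imp_le)

lemma Hs_1_norm: "Hs_norm \<phi> lam 1 v = sqrt (\<Sum>n. lam n * (v \<bullet> \<phi> n)\<^sup>2)"
  using lam_pos by (simp add: Hs_norm_def less_imp_le)

lemma scaled_phi_sums: "(\<lambda>k. lam k * ((c *\<^sub>R \<phi> n) \<bullet> \<phi> k)\<^sup>2) sums (lam n * c\<^sup>2)"
proof -
  have "(\<lambda>k. lam k * ((c *\<^sub>R \<phi> n) \<bullet> \<phi> k)\<^sup>2) = (\<lambda>k. if k = n then lam k * c\<^sup>2 else 0)"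
    by (auto simp: orth)
  then show ?thesis using sums_single[of n "\<lambda>k. lam k * c\<^sup>2"] by simp
qed

lemma scaled_phi_Hs: "c *\<^sub>R \<phi> n \<in> Hs \<phi> lam 1"
  unfolding Hs_1_iff using scaled_phi_sums by (rule sums_summable)

lemma phi_Hs: "\<phi> n \<in> Hs \<phi> lam 1"
  using scaled_phi_Hs[of 1] by simp

lemma Hdual_diff:
  assumes "l \<in> Hdual \<phi> lam 1" "m \<in> Hdual \<phi> lam 1"
  shows "(\<lambda>v. l v - m v) \<in> Hdual \<phi> lam 1"
proof -
  from assms obtain C C' where C: "\<forall>v\<in>Hs \<phi> lam 1. \<bar>l v\<bar> \<le> C * Hs_norm \<phi> lam 1 v"
    "\<forall>v\<in>Hs \<phi> lam 1. \<bar>m v\<bar> \<le> C' * Hs_norm \<phi> lam 1 v"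
    unfolding Hdual_def by auto
  have "\<bar>l v - m v\<bar> \<le> (C + C') * Hs_norm \<phi> lam 1 v" if "v \<in> Hs \<phi> lam 1" for v
    using C that abs_triangle_ineq4[of "l v" "m v"] by (fastforce simp: distrib_right)
  then have "\<exists>C. \<forall>v\<in>Hs \<phi> lam 1. \<bar>l v - m v\<bar> \<le> C * Hs_norm \<phi> lam 1 v" by blast
  with assms show ?thesis
    unfolding Hdual_def by (auto simp: algebra_simps)
qed

text \<open>The norm of order one dominates the norm of \<open>L\<^sup>2\<close>, since \<open>lam 0\<close> is the smallest eigenvalue.\<close>

lemma pivot_Hdual: "pivot f \<in> Hdual \<phi> lam 1"
proof -
  have "\<bar>f \<bullet> v\<bar> \<le> norm f * sqrt (1 / lam 0) * Hs_norm \<phi> lam 1 v" if v: "v \<in> Hs \<phi> lam 1" for v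
  proof -
    have "lam 0 * (norm v)\<^sup>2 \<le> (\<Sum>n. lam n * (v \<bullet> \<phi> n)\<^sup>2)"
    proof (rule sums_le[OF _ sums_mult[OF parseval] summable_sums])
      show "lam 0 * (v \<bullet> \<phi> n)\<^sup>2 \<le> lam n * (v \<bullet> \<phi> n)\<^sup>2" for n
        using eb by (intro mult_right_mono) (auto simp: eigenbasis_def incseq_def)
      show "summable (\<lambda>n. lam n * (v \<bullet> \<phi> n)\<^sup>2)" using v by (simp add: Hs_1_iff)
    qed
    then have "(norm v)\<^sup>2 \<le> 1 / lam 0 * (\<Sum>n. lam n * (v \<bullet> \<phi> n)\<^sup>2)"
      using lam_pos[of 0] by (simp add: field_simps)
    then have "norm v \<le> sqrt (1 / lam 0 * (\<Sum>n. lam n * (v \<bullet> \<phi> n)\<^sup>2))"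
      by (rule real_le_rsqrt)
    then have "norm v \<le> sqrt (1 / lam 0) * Hs_norm \<phi> lam 1 v"
      by (simp only: Hs_1_norm real_sqrt_mult)
    from order_trans[OF Cauchy_Schwarz_ineq2[of f v] mult_left_mono[OF this norm_ge_zero[of f]]]
    show ?thesis by (simp add: mult.assoc)
  qed
  then show ?thesis
    unfolding Hdual_def pivot_def by (auto simp: inner_add_right)
qed

text \<open>Evaluation at an eigenfunction is continuous for the dual norm, so all statements about the
  time regularity of functionals pass to the coefficients.\<close>

lemma Hdual_apply_phi:
  assumes "l \<in> Hdual \<phi> lam 1"
  shows "\<bar>l (\<phi> n)\<bar> \<le> sqrt (lam n) * Hdual_norm \<phi> lam 1 l"
proof -
  let ?v = "(1 / sqrt (lam n)) *\<^sub>R \<phi> n"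
  let ?B = "{v \<in> Hs \<phi> lam 1. Hs_norm \<phi> lam 1 v \<le> 1}"
  from assms obtain C where C: "\<forall>v\<in>Hs \<phi> lam 1. \<bar>l v\<bar> \<le> C * Hs_norm \<phi> lam 1 v"
    and hom: "\<And>c v. v \<in> Hs \<phi> lam 1 \<Longrightarrow> l (c *\<^sub>R v) = c * l v"
    unfolding Hdual_def by auto
  have "\<bar>l v\<bar> \<le> \<bar>C\<bar>" if "v \<in> ?B" for v
  proof -
    have "0 \<le> Hs_norm \<phi> lam 1 v"
      using that lam_pos by (auto simp: Hs_1_iff Hs_1_norm less_imp_le intro!: suminf_nonneg)
    then have "C * Hs_norm \<phi> lam 1 v \<le> \<bar>C\<bar> * 1"
      using that by (intro mult_mono) auto
    with C that show ?thesis by fastforce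
  qed
  then have bdd: "bdd_above ((\<lambda>v. \<bar>l v\<bar>) ` ?B)"
    by (intro bdd_aboveI2)
  have "(\<Sum>k. lam k * (?v \<bullet> \<phi> k)\<^sup>2) = lam n * (1 / sqrt (lam n))\<^sup>2"
    using scaled_phi_sums by (rule sums_unique[symmetric])
  also have "\<dots> = 1" using lam_pos[of n] by (simp add: power_divide)
  finally have "?v \<in> ?B" using scaled_phi_Hs by (simp add: Hs_1_norm)
  then have "\<bar>l ?v\<bar> \<le> Hdual_norm \<phi> lam 1 l"
    unfolding Hdual_norm_def using bdd by (rule cSUP_upper)
  then show ?thesis
    using lam_pos[of n] by (simp add: hom[OF phi_Hs] abs_mult field_simps)
qed

lemma Hdual_tendsto_phi:
  assumes "((\<lambda>s. Hdual_norm \<phi> lam 1 (\<lambda>v. f s v - l v)) \<longlongrightarrow> 0) F"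
    and "\<forall>\<^sub>F s in F. f s \<in> Hdual \<phi> lam 1" "l \<in> Hdual \<phi> lam 1"
  shows "((\<lambda>s. f s (\<phi> n)) \<longlongrightarrow> l (\<phi> n)) F"
proof (rule LIM_zero_cancel, rule Lim_null_comparison)
  show "\<forall>\<^sub>F s in F. norm (f s (\<phi> n) - l (\<phi> n)) \<le> sqrt (lam n) * Hdual_norm \<phi> lam 1 (\<lambda>v. f s v - l v)"
    using assms(2) by eventually_elim (use Hdual_apply_phi[OF Hdual_diff] assms(3) in auto)
  show "((\<lambda>s. sqrt (lam n) * Hdual_norm \<phi> lam 1 (\<lambda>v. f s v - l v)) \<longlongrightarrow> 0) F"
    using tendsto_mult_right_zero[OF assms(1)] .
qed

text \<open>Testing with \<open>\<phi> n\<close>. The time derivative of the coefficient is \<open>z t = w t (\<phi> n)\<close>, where \<open>w\<close> is the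
  time derivative of \<open>u\<close>; the form becomes multiplication by \<open>lam n\<close>, since \<open>u t\<close> has order one.\<close>

lemma weak_solution_coeff:
  assumes ws: "weak_solution \<mu> \<phi> lam T \<alpha> u0 u1 (\<lambda>t. q t *\<^sub>R p) u"
    and q: "Linf T q" and T: "T > 0"
  obtains z where "z 0 = u1 \<bullet> \<phi> n"
    "frac_sol (2 - \<alpha>) T (lam n) (\<lambda>t. q t * (p \<bullet> \<phi> n)) (\<lambda>t. u t \<bullet> \<phi> n) z"
proof -
  from ws obtain w D where u: "Cont_H1 \<phi> lam T u" and w: "C1_Hm1 \<phi> lam T u w"
    and w0: "\<forall>v\<in>Hs \<phi> lam 1. w 0 v = pivot u1 v" and cap: "Caputo_deriv \<phi> lam T \<alpha> w D"
    and eq: "AE t in lebesgue_on {0<..<T}. \<forall>v\<in>Hs \<phi> lam 1. D t v + form_a \<mu> (u t) v = (q t *\<^sub>R p) \<bullet> v"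
    unfolding weak_solution_def by blast
  define z where "z t = w t (\<phi> n)" for t
  let ?M = "lebesgue_on {0<..<T}"
  have wH: "w t \<in> Hdual \<phi> lam 1" if "t \<in> {0..T}" for t
    using w that by (auto simp: C1_Hm1_def Cont_Hm1_def)
  have der: "((\<lambda>t. u t \<bullet> \<phi> n) has_real_derivative z t) (at t within {0..T})" if t: "t \<in> {0..T}" for t
  proof -
    have "((\<lambda>s. pivot ((u s - u t) /\<^sub>R (s - t)) (\<phi> n)) \<longlongrightarrow> w t (\<phi> n)) (at t within {0..T})"
    proof (rule Hdual_tendsto_phi[of "\<lambda>s. pivot ((u s - u t) /\<^sub>R (s - t))" "w t"])
      show "((\<lambda>s. Hdual_norm \<phi> lam 1 (\<lambda>v. pivot ((u s - u t) /\<^sub>R (s - t)) v - w t v)) \<longlongrightarrow> 0)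
          (at t within {0..T})"
        using w t unfolding C1_Hm1_def by blast
    qed (simp_all add: pivot_Hdual wH[OF t])
    moreover have "(\<lambda>s. pivot ((u s - u t) /\<^sub>R (s - t)) (\<phi> n)) = (\<lambda>s. (u s \<bullet> \<phi> n - u t \<bullet> \<phi> n) / (s - t))"
      by (auto simp: pivot_def inner_diff_left divide_inverse mult.commute)
    ultimately show ?thesis by (simp add: has_field_derivative_iff z_def)
  qed
  have zc: "continuous_on {0..T} z"
    unfolding continuous_on_def z_def
  proof
    fix t assume t: "t \<in> {0..T}"
    show "((\<lambda>s. w s (\<phi> n)) \<longlongrightarrow> w t (\<phi> n)) (at t within {0..T})"
    proof (rule Hdual_tendsto_phi[of w "w t"])
      show "((\<lambda>s. Hdual_norm \<phi> lam 1 (\<lambda>v. w s v - w t v)) \<longlongrightarrow> 0) (at t within {0..T})"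
        using w t unfolding C1_Hm1_def Cont_Hm1_def by blast
      show "\<forall>\<^sub>F s in at t within {0..T}. w s \<in> Hdual \<phi> lam 1"
        using wH by (simp add: eventually_at_filter)
    qed (rule wH[OF t])
  qed
  have yi: "integrable ?M (\<lambda>t. u t \<bullet> \<phi> n)"
    by (rule continuous_integral_Ioo(1)[OF DERIV_continuous_on[OF der]])
  have fi: "integrable ?M (\<lambda>t. q t * (p \<bullet> \<phi> n))"
  proof -
    interpret finite_measure ?M
      by (rule finite_measureI) (use T in \<open>simp add: emeasure_restrict_space\<close>)
    obtain C where "AE t in ?M. \<bar>q t\<bar> \<le> C" using q by (auto simp: Linf_def)
    then have "integrable ?M q"
      using q by (intro integrable_const_bound[of _ C]) (auto simp: Linf_def)
    then show ?thesis by simp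
  qed
  have ae: "AE t in ?M. q t * (p \<bullet> \<phi> n) - lam n * (u t \<bullet> \<phi> n) = D t (\<phi> n)"
    using eq AE_space
  proof eventually_elim
    case (elim t)
    then have "u t \<in> Hs \<phi> lam 1" using u by (auto simp: Cont_H1_def space_restrict_space)
    moreover have "D t (\<phi> n) + form_a \<mu> (u t) (\<phi> n) = (q t *\<^sub>R p) \<bullet> \<phi> n"
      using elim phi_Hs by blast
    ultimately show ?case by (simp add: form_a_phi_right)
  qed
  have Dm: "(\<lambda>t. D t (\<phi> n)) \<in> borel_measurable ?M"
    using fi yi by (intro measurable_lebesgue_on_AE_cong[OF _ ae]) auto
  have "frac_sol (2 - \<alpha>) T (lam n) (\<lambda>t. q t * (p \<bullet> \<phi> n)) (\<lambda>t. u t \<bullet> \<phi> n) z"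
    unfolding frac_sol_def
  proof (intro conjI ballI allI impI der zc fi)
    fix \<psi> assume \<psi>: "test_fun 0 T \<psi>"
    have [measurable]: "\<psi> \<in> borel_measurable ?M"
      using test_fun_borel[OF \<psi>] by (intro measurable_restrict_space1) (simp add: measurable_completion)
    have "(LINT t|?M. \<psi> t * (q t * (p \<bullet> \<phi> n) - lam n * (u t \<bullet> \<phi> n))) = (LINT t|?M. \<psi> t * D t (\<phi> n))"
    proof (rule integral_cong_AE)
      show "AE t in ?M. \<psi> t * (q t * (p \<bullet> \<phi> n) - lam n * (u t \<bullet> \<phi> n)) = \<psi> t * D t (\<phi> n)"
        using ae by eventually_elim simp
    qed (use fi yi Dm in auto)
    also have "\<dots> = - (LINT t|?M. deriv \<psi> t * RL_integral (2 - \<alpha>) (\<lambda>s v. w s v - w 0 v) t (\<phi> n))"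
      using cap \<psi> phi_Hs by (simp add: Caputo_deriv_def distr_deriv_def)
    also have "\<dots> = - (LINT t|?M. deriv \<psi> t * rl_integral (2 - \<alpha>) (\<lambda>s. z s - z 0) t)"
      by (simp add: RL_integral_def rl_integral_def z_def)
    finally show "(LINT t|?M. \<psi> t * (q t * (p \<bullet> \<phi> n) - lam n * (u t \<bullet> \<phi> n)))
        = - (LINT t|?M. deriv \<psi> t * rl_integral (2 - \<alpha>) (\<lambda>s. z s - z 0) t)" .
  qed
  moreover have "z 0 = u1 \<bullet> \<phi> n" using w0 phi_Hs by (simp add: z_def pivot_def)
  ultimately show thesis by (intro that)
qed

text \<open>With \<open>c = p \<bullet> \<phi> n\<close>, the \<open>n\<close>-th coefficient of \<open>(u p - u 0) - c (u (\<phi> n) - u 0)\<close> solves the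
  homogeneous scalar problem with zero initial data.\<close>

lemma terminal_coeff:
  assumes sol: "\<And>p. weak_solution \<mu> \<phi> lam T \<alpha> u0 u1 (\<lambda>t. q t *\<^sub>R p) (u p)"
    and q: "Linf T q" and T: "T > 0" and \<alpha>: "1 < \<alpha>" "\<alpha> < 2"
  shows "(u p T - u 0 T) \<bullet> \<phi> n = ((u (\<phi> n) T - u 0 T) \<bullet> \<phi> n) * (p \<bullet> \<phi> n)"
proof -
  let ?F = "frac_sol (2 - \<alpha>) T (lam n)"
  obtain z where z: "z 0 = u1 \<bullet> \<phi> n" "?F (\<lambda>t. q t * (p \<bullet> \<phi> n)) (\<lambda>t. u p t \<bullet> \<phi> n) z"
    using sol q T by (rule weak_solution_coeff)
  obtain z0 where z0: "z0 0 = u1 \<bullet> \<phi> n" "?F (\<lambda>t. q t * (0 \<bullet> \<phi> n)) (\<lambda>t. u 0 t \<bullet> \<phi> n) z0"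
    using sol q T by (rule weak_solution_coeff)
  obtain z1 where z1: "z1 0 = u1 \<bullet> \<phi> n" "?F (\<lambda>t. q t * (\<phi> n \<bullet> \<phi> n)) (\<lambda>t. u (\<phi> n) t \<bullet> \<phi> n) z1"
    using sol q T by (rule weak_solution_coeff)
  define c where "c = p \<bullet> \<phi> n"
  have \<beta>: "0 < 2 - \<alpha>" "2 - \<alpha> < 1" using \<alpha> by auto
  note comb = frac_sol_lincomb[OF frac_sol_lincomb[OF z(2) z0(2) \<beta>(1), of "-1"]
    frac_sol_lincomb[OF z1(2) z0(2) \<beta>(1), of "-1"] \<beta>(1), of "- c"]
  have "(\<lambda>t. q t * (p \<bullet> \<phi> n) + -1 * (q t * (0 \<bullet> \<phi> n)) + - c * (q t * (\<phi> n \<bullet> \<phi> n) + -1 * (q t * (0 \<bullet> \<phi> n)))) = (\<lambda>t. 0)"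
    by (simp add: orth c_def)
  note comb' = comb[unfolded this]
  have u0: "u p 0 = u0" for p using sol[of p] by (simp add: weak_solution_def)
  have "u p T \<bullet> \<phi> n + -1 * (u 0 T \<bullet> \<phi> n) + - c * (u (\<phi> n) T \<bullet> \<phi> n + -1 * (u 0 T \<bullet> \<phi> n)) = 0"
    by (rule frac_sol_zero[OF comb' _ _ \<beta> T]) (use T in \<open>auto simp: u0 z z0 z1\<close>)
  then show ?thesis by (simp add: c_def inner_diff_left algebra_simps)
qed

end

theorem mainTheorem3:
  fixes T \<alpha> \<mu> :: real and q :: "real \<Rightarrow> real" and u0 u1 :: L2
    and \<phi> :: "nat \<Rightarrow> L2" and lam :: "nat \<Rightarrow> real"
    and u :: "L2 \<Rightarrow> real \<Rightarrow> L2"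
  assumes "T > 0" and "1 < \<alpha>" and "\<alpha> < 2" and "\<mu> < 1 / 4"
    and "eigenbasis \<mu> \<phi> lam"
    and "u0 \<in> Hs \<phi> lam 1"
    and "Linf T q"
    and "\<And>p. weak_solution \<mu> \<phi> lam T \<alpha> u0 u1 (\<lambda>t. q t *\<^sub>R p) (u p)"
  shows "compact_operator (\<lambda>p. u p T - u 0 T)"
proof -
  interpret singular_op \<mu> \<phi> lam
    using assms(4,5) by unfold_locales
  define m where "m n = (u (\<phi> n) T - u 0 T) \<bullet> \<phi> n" for n
  have coeff: "(u p T - u 0 T) \<bullet> \<phi> n = m n * (p \<bullet> \<phi> n)" for p n
    unfolding m_def using assms(8,7,1,2,3) by (rule terminal_coeff)
  \<comment> \<open>The terminal values \<open>u p T\<close> and \<open>u 0 T\<close> both belong to the space of order one.\<close>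
  have "summable (\<lambda>n. lam n * (m n * (p \<bullet> \<phi> n))\<^sup>2)" for p
  proof -
    have uH: "summable (\<lambda>n. lam n * (u p T \<bullet> \<phi> n)\<^sup>2)" for p
      using assms(1) assms(8)[of p]
      by (auto simp: weak_solution_def Cont_H1_def Hs_1_iff[symmetric])
    show ?thesis
    proof (rule summable_comparison_test')
      show "summable (\<lambda>n. 2 * (lam n * (u p T \<bullet> \<phi> n)\<^sup>2) + 2 * (lam n * (u 0 T \<bullet> \<phi> n)\<^sup>2))"
        by (intro summable_add summable_mult uH)
      fix n :: nat
      have "(m n * (p \<bullet> \<phi> n))\<^sup>2 = (u p T \<bullet> \<phi> n - u 0 T \<bullet> \<phi> n)\<^sup>2"
        by (simp add: coeff[symmetric] inner_diff_left)
      also have "\<dots> \<le> 2 * (u p T \<bullet> \<phi> n)\<^sup>2 + 2 * (u 0 T \<bullet> \<phi> n)\<^sup>2"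
        using zero_le_power2[of "u p T \<bullet> \<phi> n + u 0 T \<bullet> \<phi> n"] by (simp add: power2_eq_square algebra_simps)
      finally have "lam n * (m n * (p \<bullet> \<phi> n))\<^sup>2 \<le> lam n * (2 * (u p T \<bullet> \<phi> n)\<^sup>2 + 2 * (u 0 T \<bullet> \<phi> n)\<^sup>2)"
        using lam_pos[of n] by (intro mult_left_mono) auto
      then show "norm (lam n * (m n * (p \<bullet> \<phi> n))\<^sup>2)
          \<le> 2 * (lam n * (u p T \<bullet> \<phi> n)\<^sup>2) + 2 * (lam n * (u 0 T \<bullet> \<phi> n)\<^sup>2)"
        using lam_pos[of n] by (simp add: algebra_simps)
    qed
  qed
  moreover have "filterlim lam at_top sequentially"
    using assms(5) by (simp add: eigenbasis_def)
  ultimately have "m \<longlonglongrightarrow> 0" by (intro multiplier_tendsto_0)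
  with coeff show ?thesis by (rule diagonal_operator_compact)
qed

end
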